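(* Let $T>0$ and let $f:\mathbb{R}\times[0,\infty)\to\mathbb{R}$ be locally H\"older continuous, of class $C^1$ in $u$, such that $f(t,0)=0$ for all $t$, $f(t+T,u)=f(t,u)$ for all $t\in\mathbb{R}$, $u\ge0$, and $\partial_u f(t,u)$ is locally Lipschitz continuous in $u$ uniformly in $t$. Let $u_0\in L^\infty(\mathbb{R})$ be nonnegative with compact support and suppose the solution $u$ of $u_t=u_{xx}+f(t,u)$ ($x\in\mathbb{R}$, $t>0$), $u(\cdot,0)=u_0$, is bounded. Let $p\in\mathcal{X}_{per}$. Then the spatially constant function $(x,t)\mapsto p(t)$ does not belong to $\widetilde{\omega}(u)$ if one of the following holds for some $\varepsilon>0$: (i) $h(t;a)$ is $T$-monotone decreasing for every $a\in(p(0)-\varepsilon,p(0))$; (ii) $h(t;a)$ is $T$-monotone nonincreasing for every $a\in(p(0)-\varepsilon,p(0)+\varepsilon)$.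
   Context: $h(t;a)$ denotes the solution of $h_t=f(t,h)$, $h(0)=a$. It is $T$-monotone decreasing if $h(t+T;a)<h(t;a)$ for $t\ge0$, $T$-periodic if $h(t+T;a)=h(t;a)$ for $t\ge0$; $T$-monotone nonincreasing means $T$-periodic or $T$-monotone decreasing. $\mathcal{X}_{per}$ is the set of nonnegative $T$-periodic solutions of $p_t=f(t,p)$. An $\omega$-limit solution is an entire solution $v$ of $v_t=v_{xx}+f(t,v)$ on $\mathbb{R}^2$ such that $u(x,t+k_jT)\to v(x,t)$ locally uniformly for some sequence of positive integers $k_j\to\infty$; $\widetilde{\omega}(u)$ is the set of these. *)

theory Defs
  imports "HOL-Analysis.Analysis"
begin

text \<open>f :: real => real => real is read as f t u; only u >= 0 is relevant.\<close>

definition locally_hoelder_f :: "(real \<Rightarrow> real \<Rightarrow> real) \<Rightarrow> bool" where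
  "locally_hoelder_f f \<longleftrightarrow>
     (\<forall>K. compact K \<and> K \<subseteq> UNIV \<times> {0..} \<longrightarrow>
        (\<exists>\<alpha> C. 0 < \<alpha> \<and> \<alpha> \<le> 1 \<and>
          (\<forall>z1\<in>K. \<forall>z2\<in>K. \<bar>f (fst z1) (snd z1) - f (fst z2) (snd z2)\<bar> \<le> C * dist z1 z2 powr \<alpha>)))"

definition ode_sol :: "(real \<Rightarrow> real \<Rightarrow> real) \<Rightarrow> real \<Rightarrow> (real \<Rightarrow> real) \<Rightarrow> bool" where
  "ode_sol f a h \<longleftrightarrow> h 0 = a \<and>
     (\<forall>t\<ge>0. 0 \<le> h t \<and> (h has_real_derivative f t (h t)) (at t within {0..}))"

definition T_mono_decreasing :: "real \<Rightarrow> (real \<Rightarrow> real) \<Rightarrow> bool" where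
  "T_mono_decreasing T h \<longleftrightarrow> (\<forall>t\<ge>0. h (t + T) < h t)"

definition T_periodic_on :: "real \<Rightarrow> (real \<Rightarrow> real) \<Rightarrow> bool" where
  "T_periodic_on T h \<longleftrightarrow> (\<forall>t\<ge>0. h (t + T) = h t)"

definition T_mono_nonincreasing :: "real \<Rightarrow> (real \<Rightarrow> real) \<Rightarrow> bool" where
  "T_mono_nonincreasing T h \<longleftrightarrow> T_periodic_on T h \<or> T_mono_decreasing T h"

definition Xper :: "(real \<Rightarrow> real \<Rightarrow> real) \<Rightarrow> real \<Rightarrow> (real \<Rightarrow> real) set" where
  "Xper f T = {p. (\<forall>t. 0 \<le> p t \<and> p (t + T) = p t \<and> (p has_real_derivative f t (p t)) (at t))}"

definition classical_sol_on :: "(real \<Rightarrow> real \<Rightarrow> real) \<Rightarrow> real set \<Rightarrow> (real \<Rightarrow> real \<Rightarrow> real) \<Rightarrow> bool" where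
  "classical_sol_on f S v \<longleftrightarrow>
     (\<exists>vt vx vxx.
        continuous_on (UNIV \<times> S) (\<lambda>(x,t). v x t) \<and>
        continuous_on (UNIV \<times> S) (\<lambda>(x,t). vt x t) \<and>
        continuous_on (UNIV \<times> S) (\<lambda>(x,t). vx x t) \<and>
        continuous_on (UNIV \<times> S) (\<lambda>(x,t). vxx x t) \<and>
        (\<forall>x. \<forall>t\<in>S.
           ((\<lambda>s. v x s) has_real_derivative vt x t) (at t) \<and>
           ((\<lambda>y. v y t) has_real_derivative vx x t) (at x) \<and>
           ((\<lambda>y. vx y t) has_real_derivative vxx x t) (at x) \<and>
           vt x t = vxx x t + f t (v x t)))"

definition cauchy_sol :: "(real \<Rightarrow> real \<Rightarrow> real) \<Rightarrow> (real \<Rightarrow> real) \<Rightarrow> (real \<Rightarrow> real \<Rightarrow> real) \<Rightarrow> bool" where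
  "cauchy_sol f u0 u \<longleftrightarrow>
     classical_sol_on f {0<..} u \<and>
     (\<forall>x. \<forall>t>0. 0 \<le> u x t) \<and>
     (\<forall>a b. ((\<lambda>t. integral {a..b} (\<lambda>x. \<bar>u x t - u0 x\<bar>)) \<longlongrightarrow> 0) (at_right 0))"

definition omega_tilde :: "(real \<Rightarrow> real \<Rightarrow> real) \<Rightarrow> real \<Rightarrow> (real \<Rightarrow> real \<Rightarrow> real)
    \<Rightarrow> (real \<Rightarrow> real \<Rightarrow> real) set" where
  "omega_tilde f T u = {v. classical_sol_on f UNIV v \<and>
     (\<exists>k :: nat \<Rightarrow> nat. (\<forall>j. 0 < k j) \<and> filterlim k at_top sequentially \<and>
        (\<forall>K. compact (K :: (real \<times> real) set) \<longrightarrow>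
           (\<forall>e>0. \<forall>\<^sub>F j in sequentially. \<forall>(x,t)\<in>K. \<bar>u x (t + real (k j) * T) - v x t\<bar> < e)))}"

end

theory Submission
  imports Defs
begin

text \<open>
  Write \<open>w = u - p\<close>, and let \<open>P\<close> be the period map of the ODE for \<open>w\<close>, so that \<open>P 0 = 0\<close>. If \<open>\<Phi>\<close> is the flow of that ODE, then
  \<open>\<Phi>(t, A(x,t))\<close> is a supersolution of the equation for \<open>w\<close> over one period as soon as \<open>A\<^sub>t \<ge> A\<^sub>x\<^sub>x + C A\<^sub>x\<^sup>2\<close>; over several periods
  one also needs \<open>P(A(x,T)) \<le> A(x,0)\<close> for the next \<open>A\<close>. So the reaction enters only through \<open>P\<close>. By reflection, \<open>u\<close> is decreasing in \<open>x\<close> to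
  the right of the support of \<open>u0\<close>, and it decays at infinity. Suppose that \<open>w(\<cdot>, k\<^sub>j T) \<longrightarrow> 0\<close> locally uniformly.

  If \<open>P \<le> id\<close> near \<open>0\<close>, a spreading and decaying Gaussian on top of a negative constant is an admissible \<open>A\<close>, and it forces \<open>w\<close> below a
  negative constant for ever.

  If \<open>P < id\<close> below \<open>0\<close>, there are periodic barriers on an interval with a negative minimum at its centre and positive
  values at its ends: once \<open>w\<close> is negative on such an interval and stays small at the ends, it remains negative at the
  centre. If there are \<open>a > 0\<close> arbitrarily close to \<open>0\<close> with \<open>P a \<le> a\<close>, smallness is automatic. Otherwise \<open>0\<close> is unstable on both sides,
  the mirror image of the barrier is available above \<open>0\<close>, and the monotonicity in \<open>x\<close> allows both to be combined.
\<close>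

section \<open>Flows of globally Lipschitz periodic fields\<close>

text \<open>Formally, for \<open>v = flow t (A x t)\<close>, the expression
  \<open>v_t - v_xx - F t v\<close> equals Phi_a (A_t - A_xx) - Phi_aa A_x^2, where Phi_a and Phi_aa
  are the derivatives of the flow in the initial value. The Lipschitz bound on \<open>Fw\<close>
  gives |Phi_aa| \<le> C Phi_a, so the positive factor Phi_a cancels; this is the origin of the
  condition on A. The obstacle is that nothing is known about \<open>w\<close> uniformly in time:
  decay at infinity holds up to a finite time, on a set depending on that time, and smallness is
  known only near the times \<open>real (k j) * T\<close>. Barriers therefore have to survive
  arbitrarily many periods, and on a fixed interval their lateral bounds cannot come from decay.
  That \<open>w\<close> lies below a negative constant far out requires p to be bounded away from 0.
  This is hidden in the hypotheses: \<open>ode_sol\<close> demands nonnegative solutions, and they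
  are required for initial values below \<open>p 0\<close>, which forces
  \<open>p 0 > 0\<close>.\<close>

lemma continuous_on_nemytskii:
  fixes G :: "real \<Rightarrow> real \<Rightarrow> real" and y :: "'a::topological_space \<Rightarrow> real"
  assumes G_cont: "\<And>w. continuous_on UNIV (\<lambda>t. G t w)"
    and G_lip: "\<And>t a b. \<bar>G t a - G t b\<bar> \<le> K * \<bar>a - b\<bar>"
    and g: "continuous_on S g" and y: "continuous_on S y"
  shows "continuous_on S (\<lambda>z. G (g z) (y z))"
  unfolding continuous_on_def
proof
  fix z assume z: "z \<in> S"
  have y': "(y \<longlongrightarrow> y z) (at z within S)" using y z by (simp add: continuous_on_def)
  have g': "(g \<longlongrightarrow> g z) (at z within S)" using g z by (simp add: continuous_on_def)
  have "isCont (\<lambda>t. G t (y z)) (g z)"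
    using G_cont continuous_on_eq_continuous_at by blast
  then have 1: "((\<lambda>x. G (g x) (y z)) \<longlongrightarrow> G (g z) (y z)) (at z within S)"
    using g' isCont_tendsto_compose by blast
  have 2: "((\<lambda>x. K * \<bar>y x - y z\<bar>) \<longlongrightarrow> 0) (at z within S)"
    by (rule tendsto_eq_intros y' | simp)+
  have "((\<lambda>x. G (g x) (y x) - G (g x) (y z)) \<longlongrightarrow> 0) (at z within S)"
    by (rule Lim_null_comparison[OF _ 2]) (auto simp: G_lip)
  from tendsto_add[OF this 1] show "((\<lambda>x. G (g x) (y x)) \<longlongrightarrow> G (g z) (y z)) (at z within S)"
    by simp
qed

text \<open>After the last time with \<open>y >= 0\<close> the inequality holds throughout, so
  \<open>exp (- L * r) * y r\<close> is nondecreasing and starts nonnegative. That the inequality is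
  required only where \<open>y < 0\<close> is exploited in \<open>sol_diff_lower\<close>.\<close>

lemma nonneg_of_deriv_ge:
  fixes y :: "real \<Rightarrow> real"
  assumes der: "\<And>t. t \<ge> 0 \<Longrightarrow> (y has_real_derivative y' t) (at t within {0..})"
    and ge: "\<And>t. t \<ge> 0 \<Longrightarrow> y t < 0 \<Longrightarrow> y' t \<ge> L * y t"
    and y0: "y 0 \<ge> 0" and t: "t \<ge> 0"
  shows "y t \<ge> 0"
proof (rule ccontr)
  assume "\<not> y t \<ge> 0"
  then have neg: "y t < 0" by simp
  have cont: "continuous_on {0..} y"
    by (rule DERIV_continuous_on) (use der in auto)
  define Z where "Z = {s \<in> {0..t}. y s \<ge> 0}"
  have Z: "Z = {0..t} \<inter> y -` {0..}" by (auto simp: Z_def)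
  have "closed ({0..t} \<inter> y -` {0..})"
    by (rule continuous_closed_preimage) (auto intro: continuous_on_subset[OF cont])
  moreover have "bounded ({0..t} \<inter> y -` {0..})"
    by (rule bounded_subset[OF bounded_closed_interval[of 0 t]]) auto
  ultimately have "compact Z" unfolding Z by (simp only: compact_eq_bounded_closed)
  moreover have "0 \<in> Z" using y0 t by (simp add: Z_def)
  ultimately obtain s where s: "s \<in> Z" "\<And>r. r \<in> Z \<Longrightarrow> r \<le> s"
    using compact_attains_sup[of Z] by blast
  have "0 \<le> s" "s \<le> t" "y s \<ge> 0" using s(1) by (simp_all add: Z_def)
  moreover have "s \<noteq> t" using \<open>y s \<ge> 0\<close> neg by auto
  ultimately have st: "0 \<le> s" "s < t" "y s \<ge> 0" by simp_all
  have ineg: "y r < 0" if "s < r" "r \<le> t" for r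
  proof (rule ccontr)
    assume "\<not> y r < 0"
    then have "r \<in> Z" using that st by (simp add: Z_def)
    then show False using s(2) that by force
  qed
  have "exp (- L * s) * y s \<le> exp (- L * t) * y t"
  proof (rule DERIV_nonneg_imp_increasing_open[where f="\<lambda>r. exp (- L * r) * y r"])
    show "s \<le> t" using st by simp
    show "continuous_on {s..t} (\<lambda>r. exp (- L * r) * y r)"
      by (intro continuous_intros continuous_on_subset[OF cont]) (use st in auto)
    fix r assume r: "s < r" "r < t"
    have "(y has_real_derivative y' r) (at r)"
      using der[of r] r st at_within_interior[of r "{0..}"] by simp
    then have "((\<lambda>r. exp (- L * r) * y r) has_real_derivative (exp (- L * r) * (y' r - L * y r))) (at r)"
      by (auto intro!: derivative_eq_intros simp: algebra_simps)
    moreover have "exp (- L * r) * (y' r - L * y r) \<ge> 0"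
      using ge[of r] ineg[of r] r st by simp
    ultimately show "\<exists>d. ((\<lambda>r. exp (- L * r) * y r) has_real_derivative d) (at r) \<and> 0 \<le> d" by blast
  qed
  then show False using st neg
    by (meson exp_ge_zero exp_gt_zero mult_nonneg_nonneg mult_pos_neg not_le order_trans)
qed

text \<open>\<open>F\<close> is meant as the reaction in the equation for \<open>u - p\<close>, with
  derivative \<open>Fw\<close> in \<open>w\<close>, continued to all real \<open>w\<close> with
  global bounds, so that its flow exists for all \<open>t >= 0\<close> and all initial
  values.\<close>

locale c11_field =
  fixes F Fw :: "real \<Rightarrow> real \<Rightarrow> real" and L L2 T :: real
  assumes T_pos: "T > 0" and L_pos: "L > 0" and L2_nonneg: "L2 \<ge> 0"
    and F_zero: "F t 0 = 0"
    and F_per: "F (t + T) w = F t w"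
    and F_cont: "continuous_on UNIV (\<lambda>t. F t w)"
    and F_deriv: "(F t has_real_derivative Fw t w) (at w)"
    and Fw_cont: "continuous_on UNIV (\<lambda>t. Fw t w)"
    and Fw_bound: "\<bar>Fw t w\<bar> \<le> L"
    and Fw_lip: "\<bar>Fw t a - Fw t b\<bar> \<le> L2 * \<bar>a - b\<bar>"
begin

lemma F_mvt: "\<exists>\<xi>. \<bar>\<xi> - a\<bar> \<le> \<bar>b - a\<bar> \<and> F t b - F t a = (b - a) * Fw t \<xi>"
proof (cases a b rule: linorder_cases)
  case less
  from MVT2[OF less, of "F t" "Fw t"] F_deriv obtain z where "a < z" "z < b" "F t b - F t a = (b - a) * Fw t z"
    by blast
  then show ?thesis by (intro exI[of _ z]) auto
next
  case greater
  from MVT2[OF greater, of "F t" "Fw t"] F_deriv obtain z where "b < z" "z < a" "F t a - F t b = (a - b) * Fw t z"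
    by blast
  then show ?thesis by (intro exI[of _ z]) (auto simp: algebra_simps)
qed auto

lemma F_lip: "\<bar>F t a - F t b\<bar> \<le> L * \<bar>a - b\<bar>"
proof -
  obtain \<xi> where "F t a - F t b = (a - b) * Fw t \<xi>" using F_mvt by blast
  then have "\<bar>F t a - F t b\<bar> = \<bar>Fw t \<xi>\<bar> * \<bar>a - b\<bar>" by (simp add: abs_mult)
  then show ?thesis using Fw_bound by (simp add: mult_right_mono)
qed

lemma F_taylor: "\<bar>F t b - F t a - Fw t a * (b - a)\<bar> \<le> L2 * (b - a)\<^sup>2"
proof -
  obtain \<xi> where \<xi>: "\<bar>\<xi> - a\<bar> \<le> \<bar>b - a\<bar>" "F t b - F t a = (b - a) * Fw t \<xi>" using F_mvt by blast
  have "\<bar>F t b - F t a - Fw t a * (b - a)\<bar> = \<bar>Fw t \<xi> - Fw t a\<bar> * \<bar>b - a\<bar>"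
    unfolding \<xi> by (simp add: abs_mult[symmetric] algebra_simps)
  also have "\<dots> \<le> (L2 * \<bar>b - a\<bar>) * \<bar>b - a\<bar>"
    using Fw_lip[of t \<xi> a] \<xi>(1) L2_nonneg
    by (intro mult_right_mono) (auto intro: order_trans mult_left_mono)
  finally show ?thesis by (simp add: power2_eq_square abs_mult[symmetric])
qed

lemmas continuous_on_F = continuous_on_nemytskii[where G=F, OF F_cont F_lip]
lemmas continuous_on_Fw = continuous_on_nemytskii[where G=Fw, OF Fw_cont Fw_lip]

lemma F_per_nat: "F (t + real n * T) w = F t w"
proof (induction n)
  case (Suc n)
  have "F (t + real (Suc n) * T) w = F ((t + real n * T) + T) w" by (simp add: algebra_simps)
  then show ?case using Suc F_per by simp
qed simp

text \<open>Picard iteration in the weighted norm \<open>sup exp (-2 L t) \<bar>y t\<bar>\<close>, in which it is a contraction on the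
  whole half line; the unknown is \<open>z t = exp (-2 L t) * y t\<close>.\<close>

definition picard_map :: "real \<Rightarrow> (real \<Rightarrow> real) \<Rightarrow> real \<Rightarrow> real" where
  "picard_map a z t = exp (-2 * L * max 0 t) *
     (a + integral {0..max 0 t} (\<lambda>s. F s (exp (2 * L * s) * z s)))"

lemma integrable_F_comp:
  assumes "continuous_on UNIV z"
  shows "(\<lambda>s. F s (exp (2 * L * s) * z s)) integrable_on {a..b::real}"
  by (intro integrable_continuous_real continuous_on_F continuous_intros)
     (use assms continuous_on_subset in auto)

lemma integral_exp_2L:
  assumes "0 \<le> t" shows "((\<lambda>s. exp (2 * L * s)) has_integral (exp (2 * L * t) - 1) / (2 * L)) {0..t}"
proof -
  have "((\<lambda>s. exp (2 * L * s)) has_integral (exp (2 * L * t) / (2 * L) - exp (2 * L * 0) / (2 * L))) {0..t}"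
    by (rule fundamental_theorem_of_calculus[OF assms])
       (use L_pos in \<open>auto intro!: derivative_eq_intros simp: has_real_derivative_iff_has_vector_derivative[symmetric]\<close>)
  then show ?thesis by (simp add: diff_divide_distrib)
qed

text \<open>The weight produces a factor independent of \<open>t\<close>: the integral of
  \<open>L * exp (2 * L * s)\<close> up to \<open>t\<close>, multiplied by
  \<open>exp (-2 * L * t)\<close>, stays below 1/2.\<close>

lemma picard_diff:
  assumes z1: "continuous_on UNIV z1" and z2: "continuous_on UNIV z2" and D: "\<And>s. \<bar>z1 s - z2 s\<bar> \<le> D"
  shows "\<bar>picard_map a z1 t - picard_map a z2 t\<bar> \<le> D / 2"
proof -
  define \<tau> where "\<tau> = max 0 t"
  have \<tau>: "\<tau> \<ge> 0" by (simp add: \<tau>_def)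
  have D0: "D \<ge> 0" using D[of 0] by simp
  have i: "(\<lambda>s. F s (exp (2 * L * s) * z1 s)) integrable_on {0..\<tau>}"
    "(\<lambda>s. F s (exp (2 * L * s) * z2 s)) integrable_on {0..\<tau>}"
    using z1 z2 integrable_F_comp by auto
  have j: "((\<lambda>s. (L * D) * exp (2 * L * s)) has_integral (L * D) * ((exp (2 * L * \<tau>) - 1) / (2 * L))) {0..\<tau>}"
    using integral_exp_2L[OF \<tau>] by (rule has_integral_mult_right)
  have "norm (integral {0..\<tau>} (\<lambda>s. F s (exp (2 * L * s) * z1 s) - F s (exp (2 * L * s) * z2 s)))
     \<le> integral {0..\<tau>} (\<lambda>s. (L * D) * exp (2 * L * s))"
  proof (rule integral_norm_bound_integral)
    fix s
    have "\<bar>F s (exp (2 * L * s) * z1 s) - F s (exp (2 * L * s) * z2 s)\<bar> \<le> L * \<bar>exp (2 * L * s) * (z1 s - z2 s)\<bar>"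
      using F_lip[of s "exp (2 * L * s) * z1 s" "exp (2 * L * s) * z2 s"] by (simp only: right_diff_distrib)
    also have "\<dots> \<le> L * (exp (2 * L * s) * D)"
      using D[of s] L_pos by (intro mult_left_mono) (auto simp: abs_mult)
    finally show "norm (F s (exp (2 * L * s) * z1 s) - F s (exp (2 * L * s) * z2 s)) \<le> L * D * exp (2 * L * s)"
      by (simp add: algebra_simps)
  qed (use i j in \<open>auto intro: integrable_diff\<close>)
  also have "\<dots> = (L * D) * ((exp (2 * L * \<tau>) - 1) / (2 * L))" using j by (rule integral_unique)
  also have "\<dots> \<le> D / 2 * exp (2 * L * \<tau>)" using L_pos D0 by (simp add: field_simps)
  finally have k: "\<bar>integral {0..\<tau>} (\<lambda>s. F s (exp (2 * L * s) * z1 s)) - integral {0..\<tau>} (\<lambda>s. F s (exp (2 * L * s) * z2 s))\<bar>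
      \<le> D / 2 * exp (2 * L * \<tau>)" using i by (simp add: integral_diff)
  have "\<bar>picard_map a z1 t - picard_map a z2 t\<bar> = exp (-2 * L * \<tau>) * \<bar>integral {0..\<tau>} (\<lambda>s. F s (exp (2 * L * s) * z1 s)) - integral {0..\<tau>} (\<lambda>s. F s (exp (2 * L * s) * z2 s))\<bar>"
    unfolding picard_map_def \<tau>_def[symmetric]
    by (subst right_diff_distrib[symmetric], subst abs_mult) simp
  also have "\<dots> \<le> exp (-2 * L * \<tau>) * (D / 2 * exp (2 * L * \<tau>))" using k by (intro mult_left_mono) auto
  also have "\<dots> = D / 2" by (simp add: exp_minus field_simps)
  finally show ?thesis .
qed

lemma picard_cont:
  assumes z: "continuous_on UNIV z"
  shows "continuous_on UNIV (picard_map a z)"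
proof -
  have "continuous_on {0..} (\<lambda>b. integral {0..b} (\<lambda>s. F s (exp (2 * L * s) * z s)))"
  proof -
    have "continuous (at x within {0..}) (\<lambda>b. integral {0..b} (\<lambda>s. F s (exp (2 * L * s) * z s)))" if "x \<ge> 0" for x
    proof -
      have "continuous_on {0..x+1} (\<lambda>b. integral {0..b} (\<lambda>s. F s (exp (2 * L * s) * z s)))"
        by (rule indefinite_integral_continuous_1) (rule integrable_F_comp[OF z])
      then have "continuous (at x within {0..x+1}) (\<lambda>b. integral {0..b} (\<lambda>s. F s (exp (2 * L * s) * z s)))"
        using that by (simp add: continuous_on_eq_continuous_within)
      moreover have "at x within {0..x+1} = at x within {0..}"
        by (rule at_within_nhd[of _ "{..<x+1}"]) auto
      ultimately show ?thesis by simp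
    qed
    then show ?thesis by (simp add: continuous_on_eq_continuous_within)
  qed
  then have "continuous_on UNIV ((\<lambda>b. integral {0..b} (\<lambda>s. F s (exp (2 * L * s) * z s))) \<circ> (\<lambda>t. max 0 t))"
    by (intro continuous_on_compose continuous_intros) (auto elim: continuous_on_subset)
  then show ?thesis unfolding picard_map_def by (auto intro!: continuous_intros simp: o_def)
qed

text \<open>Through \<open>max 0 t\<close> the iterate is continued by the constant \<open>a\<close>
  to negative times, so that it lives in the complete space of bounded continuous functions on the
  whole line. Boundedness follows by comparison with the iterate of 0, which is at most
  \<open>\<bar>a\<bar>\<close> because \<open>F\<close> vanishes at 0.\<close>

lemma picard_bcontfun:
  assumes "z \<in> bcontfun" shows "picard_map a z \<in> bcontfun"
proof -
  obtain B where B: "\<And>s. \<bar>z s\<bar> \<le> B" and z: "continuous_on UNIV z"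
    using assms by (auto simp: bcontfun_def bounded_iff)
  have "\<bar>picard_map a z t\<bar> \<le> \<bar>a\<bar> + B / 2" for t
  proof -
    have "\<bar>picard_map a z t - picard_map a (\<lambda>_. 0) t\<bar> \<le> B / 2"
      by (rule picard_diff[OF z]) (use B in auto)
    moreover have "\<bar>picard_map a (\<lambda>_. 0) t\<bar> \<le> \<bar>a\<bar>"
      using L_pos by (simp add: picard_map_def F_zero abs_mult mult_left_le_one_le)
    ultimately show ?thesis by linarith
  qed
  then show ?thesis using picard_cont[OF z] by (auto simp: bcontfun_def bounded_iff)
qed

lemma flow_exists: "\<exists>y. y 0 = a \<and> (\<forall>t\<ge>0. (y has_real_derivative F t (y t)) (at t within {0..}))"
proof -
  define Q where "Q z = Bcontfun (picard_map a (apply_bcontfun z))" for z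
  have Q: "apply_bcontfun (Q z) = picard_map a (apply_bcontfun z)" for z
    unfolding Q_def by (rule Bcontfun_inverse[OF picard_bcontfun]) (rule apply_bcontfun)
  have zc: "continuous_on UNIV (apply_bcontfun z)" for z :: "real \<Rightarrow>\<^sub>C real"
    by (rule continuous_on_apply_bcontfun)
  have "\<exists>!z. Q z = z"
  proof (rule banach_fix_type)
    show "0 \<le> (1/2::real)" "(1/2::real) < 1" by auto
    show "\<forall>x y. dist (Q x) (Q y) \<le> 1 / 2 * dist x y"
    proof (intro allI)
      fix x y
      have "dist (Q x) (Q y) \<le> dist x y / 2"
        by (rule dist_bound) (use picard_diff[OF zc zc, of x y "dist x y"] dist_bounded[of x _ y] in \<open>simp add: Q dist_real_def\<close>)
      then show "dist (Q x) (Q y) \<le> 1 / 2 * dist x y" by simp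
    qed
  qed
  then obtain z where z: "Q z = z" by blast
  then have z': "apply_bcontfun z t = picard_map a (apply_bcontfun z) t" for t by (metis Q)
  define y where "y t = exp (2 * L * t) * apply_bcontfun z t" for t
  have y_eq: "y t = a + integral {0..t} (\<lambda>s. F s (y s))" if "t \<ge> 0" for t
    unfolding y_def using that by (subst z') (simp add: picard_map_def exp_minus field_simps)
  have Fy: "continuous_on S (\<lambda>s. F s (y s))" for S
    unfolding y_def by (intro continuous_on_F continuous_intros continuous_on_subset[OF zc]) auto
  have "(y has_real_derivative F t (y t)) (at t within {0..})" if "t \<ge> 0" for t
  proof -
    have "((\<lambda>u. integral {0..u} (\<lambda>s. F s (y s))) has_real_derivative F t (y t)) (at t within {0..t+1})"
      by (rule integral_has_real_derivative[OF Fy]) (use that in auto)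
    moreover have "at t within {0..t+1} = at t within {0..}"
      by (rule at_within_nhd[of _ "{..<t+1}"]) auto
    ultimately have "((\<lambda>u. a + integral {0..u} (\<lambda>s. F s (y s))) has_real_derivative F t (y t)) (at t within {0..})"
      by (auto intro!: derivative_eq_intros)
    then show ?thesis
      by (rule has_field_derivative_transform_within[of _ _ _ _ 1]) (use that y_eq in auto)
  qed
  moreover have "y 0 = a" using y_eq[of 0] by simp
  ultimately show ?thesis by blast
qed

text \<open>By \<open>flow_unique\<close> the choice is immaterial for \<open>t >= 0\<close>;
  nothing is claimed for negative times.\<close>

definition flow :: "real \<Rightarrow> real \<Rightarrow> real" where
  "flow t a = (SOME y. y 0 = a \<and> (\<forall>t\<ge>0. (y has_real_derivative F t (y t)) (at t within {0..}))) t"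

lemma flow_0 [simp]: "flow 0 a = a"
  and flow_deriv_within: "t \<ge> 0 \<Longrightarrow> ((\<lambda>t. flow t a) has_real_derivative F t (flow t a)) (at t within {0..})"
  using someI_ex[OF flow_exists[of a]] by (simp_all add: flow_def)

lemma flow_deriv: "t > 0 \<Longrightarrow> ((\<lambda>t. flow t a) has_real_derivative F t (flow t a)) (at t)"
  using flow_deriv_within[of t a] at_within_interior[of t "{0..}"] by simp

lemma flow_cont: "S \<subseteq> {0..} \<Longrightarrow> continuous_on S (\<lambda>t. flow t a)"
  by (rule continuous_on_subset[OF DERIV_continuous_on]) (use flow_deriv_within in auto)

text \<open>A Lipschitz field cannot bring trajectories together faster than exponentially. This
  gives order preservation and also the quantitative lower bound behind
  \<open>flow_abs_bounds\<close>.\<close>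

lemma sol_diff_lower:
  assumes h: "\<And>t. t \<ge> 0 \<Longrightarrow> (h has_real_derivative F t (h t)) (at t within {0..})"
    and k: "\<And>t. t \<ge> 0 \<Longrightarrow> (k has_real_derivative F t (k t)) (at t within {0..})"
    and le: "h 0 \<le> k 0" and t: "t \<ge> 0"
  shows "k t - h t \<ge> exp (- L * t) * (k 0 - h 0)"
proof -
  define D where "D = k 0 - h 0"
  define y where "y t = k t - h t - exp (- L * t) * D" for t
  have "y t \<ge> 0"
  proof (rule nonneg_of_deriv_ge[where y=y and t=t and y'="\<lambda>t. F t (k t) - F t (h t) + L * exp (- L * t) * D" and L=L])
    show "(y has_real_derivative F t (k t) - F t (h t) + L * exp (- L * t) * D) (at t within {0..})" if "t \<ge> 0" for t
      unfolding y_def using h[OF that] k[OF that] by (auto intro!: derivative_eq_intros)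
    show "F t (k t) - F t (h t) + L * exp (- L * t) * D \<ge> L * y t" if "y t < 0" for t
    proof -
      define e where "e = exp (- L * t) * D"
      have e: "e \<ge> 0" using le by (simp add: e_def D_def)
      have "F t (k t) - F t (h t) \<ge> - (L * \<bar>k t - h t\<bar>)" using F_lip[of t "k t" "h t"] by linarith
      \<comment> \<open>Where \<open>y t < 0\<close> the gap \<open>k t - h t\<close> is less than
        \<open>e\<close>, so this bound on its absolute value holds for either sign; the order of
        \<open>h\<close> and \<open>k\<close> need not be known beforehand.\<close>
      moreover have "L * \<bar>k t - h t\<bar> \<le> L * (2 * e - (k t - h t))"
        using that e L_pos by (intro mult_left_mono) (auto simp: y_def e_def)
      ultimately show ?thesis unfolding y_def mult.assoc e_def[symmetric] by (simp add: algebra_simps)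
    qed
  qed (use t in \<open>auto simp: y_def D_def\<close>)
  then show ?thesis by (simp add: y_def D_def)
qed

lemma sol_diff_upper:
  assumes h: "\<And>t. t \<ge> 0 \<Longrightarrow> (h has_real_derivative F t (h t)) (at t within {0..})"
    and k: "\<And>t. t \<ge> 0 \<Longrightarrow> (k has_real_derivative F t (k t)) (at t within {0..})"
    and le: "h 0 \<le> k 0" and t: "t \<ge> 0"
  shows "k t - h t \<le> exp (L * t) * (k 0 - h 0)"
proof -
  define D where "D = k 0 - h 0"
  define y where "y t = exp (L * t) * D - (k t - h t)" for t
  have "y t \<ge> 0"
  proof (rule nonneg_of_deriv_ge[where y=y and t=t and y'="\<lambda>t. L * exp (L * t) * D - (F t (k t) - F t (h t))" and L=L])
    show "(y has_real_derivative L * exp (L * t) * D - (F t (k t) - F t (h t))) (at t within {0..})" if "t \<ge> 0" for t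
      unfolding y_def using h[OF that] k[OF that] by (auto intro!: derivative_eq_intros)
    show "L * exp (L * t) * D - (F t (k t) - F t (h t)) \<ge> L * y t" if "t \<ge> 0" for t
    proof -
      have "k t - h t \<ge> 0" using sol_diff_lower[OF h k le that] le
        by (smt (verit) exp_ge_zero mult_nonneg_nonneg)
      then show ?thesis unfolding y_def using F_lip[of t "k t" "h t"] by (simp add: algebra_simps)
    qed
  qed (use t in \<open>auto simp: y_def D_def\<close>)
  then show ?thesis by (simp add: y_def D_def)
qed

lemma flow_unique:
  assumes h: "\<And>t. t \<ge> 0 \<Longrightarrow> (h has_real_derivative F t (h t)) (at t within {0..})" and t: "t \<ge> 0"
  shows "h t = flow t (h 0)"
  using sol_diff_upper[OF h flow_deriv_within[of _ "h 0"] _ t] sol_diff_lower[OF h flow_deriv_within[of _ "h 0"] _ t] by simp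

lemma flow_diff_lower: "a \<le> b \<Longrightarrow> t \<ge> 0 \<Longrightarrow> flow t b - flow t a \<ge> exp (- L * t) * (b - a)"
  using sol_diff_lower[OF flow_deriv_within flow_deriv_within, of a b t] by simp

lemma flow_diff_upper: "a \<le> b \<Longrightarrow> t \<ge> 0 \<Longrightarrow> flow t b - flow t a \<le> exp (L * t) * (b - a)"
  using sol_diff_upper[OF flow_deriv_within flow_deriv_within, of a b t] by simp

lemma flow_mono: "a \<le> b \<Longrightarrow> t \<ge> 0 \<Longrightarrow> flow t a \<le> flow t b"
  using flow_diff_lower[of a b t] by (smt (verit) exp_ge_zero mult_nonneg_nonneg)

lemma flow_lip: "t \<ge> 0 \<Longrightarrow> \<bar>flow t b - flow t a\<bar> \<le> exp (L * t) * \<bar>b - a\<bar>"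
  using flow_diff_upper[of a b t] flow_diff_upper[of b a t] flow_mono[of a b t] flow_mono[of b a t]
  by (cases "a \<le> b") auto

lemma flow_zero [simp]: "t \<ge> 0 \<Longrightarrow> flow t 0 = 0"
  using flow_unique[of "\<lambda>_. 0" t] by (simp add: F_zero)

end

section \<open>Comparison with flows of barriers\<close>

text \<open>One application of l'Hopital's rule turns the quotient into a symmetric difference
  quotient of \<open>g'\<close>, which needs only differentiability of \<open>g'\<close> at the
  single point \<open>x\<close>.\<close>

lemma second_difference_tendsto:
  fixes g g' :: "real \<Rightarrow> real"
  assumes "r > 0" and g: "\<And>y. \<bar>y - x\<bar> < r \<Longrightarrow> (g has_real_derivative g' y) (at y)"
    and g': "(g' has_real_derivative g'') (at x)"
  shows "((\<lambda>h. (g (x + h) + g (x - h) - 2 * g x) / h\<^sup>2) \<longlongrightarrow> g'') (at_right 0)"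
proof (rule lhopital_right_0[where f'="\<lambda>h. g' (x + h) - g' (x - h)" and g'="\<lambda>h. 2 * h"])
  have gc: "isCont g x" using g[of x] \<open>r > 0\<close> DERIV_isCont by auto
  have "((\<lambda>h. g (x + h) + g (x - h) - 2 * g x) \<longlongrightarrow> g (x + 0) + g (x - 0) - 2 * g x) (at_right 0)"
    by (intro tendsto_intros isCont_tendsto_compose[of _ g]) (use gc in auto)
  then show "((\<lambda>h. g (x + h) + g (x - h) - 2 * g x) \<longlongrightarrow> 0) (at_right 0)" by simp
  have "((\<lambda>h::real. h\<^sup>2) \<longlongrightarrow> 0\<^sup>2) (at_right 0)" by (intro tendsto_intros)
  then show "((\<lambda>h::real. h\<^sup>2) \<longlongrightarrow> 0) (at_right 0)" by simp
  show "\<forall>\<^sub>F h in at_right 0. (h::real)\<^sup>2 \<noteq> 0" "\<forall>\<^sub>F h in at_right 0. 2 * (h::real) \<noteq> 0"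
    by (auto intro: eventually_at_rightI[of 0 1])
  have ev: "\<forall>\<^sub>F h in at_right 0. 0 < h \<and> h < r"
    using \<open>r > 0\<close> by (auto intro: eventually_at_rightI[of 0 r])
  then show "\<forall>\<^sub>F h in at_right 0. ((\<lambda>h. g (x + h) + g (x - h) - 2 * g x) has_real_derivative g' (x + h) - g' (x - h)) (at h)"
  proof eventually_elim
    case (elim h)
    have "((\<lambda>h. g (x + h)) has_real_derivative g' (x + h) * 1) (at h)"
      by (rule DERIV_chain'[of "\<lambda>h. x + h" 1 h UNIV g]) (use elim g[of "x + h"] in \<open>auto intro!: derivative_eq_intros\<close>)
    moreover have "((\<lambda>h. g (x - h)) has_real_derivative g' (x - h) * (-1)) (at h)"
      by (rule DERIV_chain'[of "\<lambda>h. x - h" "-1" h UNIV g]) (use elim g[of "x - h"] in \<open>auto intro!: derivative_eq_intros\<close>)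
    ultimately show ?case by (auto intro!: derivative_eq_intros)
  qed
  show "\<forall>\<^sub>F h in at_right 0. ((\<lambda>h::real. h\<^sup>2) has_real_derivative 2 * h) (at h)"
    by (auto intro!: always_eventually derivative_eq_intros)
  have 1: "((\<lambda>h. (g' (x + h) - g' x) / h) \<longlongrightarrow> g'') (at 0)"
    using g' by (simp add: DERIV_def)
  then have "((\<lambda>h. (g' (x + (- h)) - g' x) / (- h)) \<longlongrightarrow> g'') (at 0)"
    by (rule filterlim_compose[where g="\<lambda>h. (g' (x + h) - g' x) / h"])
       (auto intro!: filterlim_atI tendsto_eq_intros simp: eventually_at_filter)
  with 1 have "((\<lambda>h. (g' (x + h) - g' x) / h / 2 + (g' (x + (- h)) - g' x) / (- h) / 2) \<longlongrightarrow> g'' / 2 + g'' / 2) (at 0)"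
    by (intro tendsto_intros) auto
  moreover have "(g' (x + h) - g' x) / h / 2 + (g' (x + (- h)) - g' x) / (- h) / 2 = (g' (x + h) - g' (x - h)) / (2 * h)" for h
    by (simp add: field_simps diff_divide_distrib add_divide_distrib)
  ultimately have "((\<lambda>h. (g' (x + h) - g' (x - h)) / (2 * h)) \<longlongrightarrow> g'') (at 0)" by simp
  then show "((\<lambda>h. (g' (x + h) - g' (x - h)) / (2 * h)) \<longlongrightarrow> g'') (at_right 0)"
    by (rule tendsto_within_subset) auto
qed

section \<open>First variation of the flow, the comparison principle and barriers over many
  periods\<close>

context c11_field
begin

text \<open>The solution of the linearised equation along the trajectory from \<open>a\<close>, with
  initial value 1; \<open>flow_taylor\<close> identifies it as the derivative of the flow in the
  initial value.\<close>

definition jac :: "real \<Rightarrow> real \<Rightarrow> real" where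
  "jac t a = exp (integral {0..t} (\<lambda>s. Fw s (flow s a)))"

lemma jac_pos [simp]: "jac t a > 0" by (simp add: jac_def)

lemma continuous_on_Fw_flow: "S \<subseteq> {0..} \<Longrightarrow> continuous_on S (\<lambda>s. Fw s (flow s a))"
  by (intro continuous_on_Fw flow_cont continuous_intros)

lemma jac_exponent_deriv:
  assumes "t \<ge> 0"
  shows "((\<lambda>t. integral {0..t} (\<lambda>s. Fw s (flow s a))) has_real_derivative Fw t (flow t a)) (at t within {0..})"
proof -
  have "((\<lambda>u. integral {0..u} (\<lambda>s. Fw s (flow s a))) has_real_derivative Fw t (flow t a)) (at t within {0..t+1})"
    by (rule integral_has_real_derivative) (use assms continuous_on_Fw_flow in auto)
  moreover have "at t within {0..t+1} = at t within {0..}"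
    by (rule at_within_nhd[of _ "{..<t+1}"]) auto
  ultimately show ?thesis by simp
qed

lemma jac_deriv:
  assumes "t > 0" shows "((\<lambda>t. jac t a) has_real_derivative Fw t (flow t a) * jac t a) (at t)"
  unfolding jac_def using jac_exponent_deriv[of t a] assms at_within_interior[of t "{0..}"]
  by (auto intro!: derivative_eq_intros)

lemma jac_exponent_lower:
  assumes "t \<ge> 0" shows "integral {0..t} (\<lambda>s. Fw s (flow s a)) \<ge> - L * t"
proof -
  have "norm (integral {0..t} (\<lambda>s. Fw s (flow s a))) \<le> L * (t - 0)"
    by (rule integral_bound) (use assms continuous_on_Fw_flow Fw_bound in auto)
  then show ?thesis by simp
qed

text \<open>Dividing the difference of two trajectories by \<open>jac\<close> removes the linear
  part; what is left is the quadratic Taylor error of \<open>F\<close>, integrated in time. Two of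
  the three factors \<open>exp (L * \<tau>)\<close> come from squaring \<open>flow_lip\<close>, the
  third from dividing by \<open>jac\<close>. The factor \<open>jac\<close> is kept in the bound so
  that it can cancel later.\<close>

lemma flow_taylor:
  assumes t: "0 \<le> t" "t \<le> \<tau>"
  shows "\<bar>flow t b - flow t a - jac t a * (b - a)\<bar> \<le> \<tau> * L2 * exp (3 * L * \<tau>) * jac t a * (b - a)\<^sup>2"
proof -
  define I where "I t = integral {0..t} (\<lambda>s. Fw s (flow s a))" for t
  define g where "g t = (flow t b - flow t a) * exp (- I t) - (b - a)" for t
  define g' where "g' t = (F t (flow t b) - F t (flow t a) - Fw t (flow t a) * (flow t b - flow t a)) * exp (- I t)" for t
  define B where "B = L2 * exp (3 * L * \<tau>) * (b - a)\<^sup>2"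
  have "norm (g t - g 0) \<le> B * norm (t - 0)"
  proof (rule field_differentiable_bound[where f=g and f'=g' and S="{0..\<tau>}"])
    fix s assume s: "s \<in> {0..\<tau>}"
    have "(I has_real_derivative Fw s (flow s a)) (at s within {0..})"
      unfolding I_def using jac_exponent_deriv s by simp
    then have "(g has_real_derivative g' s) (at s within {0..})"
      unfolding g_def g'_def using flow_deriv_within[of s a] flow_deriv_within[of s b] s
      by (auto intro!: derivative_eq_intros simp: algebra_simps)
    then show "(g has_field_derivative g' s) (at s within {0..\<tau>})"
      by (rule DERIV_subset) auto
    have e: "exp (- I s) \<le> exp (L * \<tau>)"
    proof -
      have "L * s \<le> L * \<tau>" using s L_pos by (intro mult_left_mono) auto
      then show ?thesis using jac_exponent_lower[of s a] s by (simp add: I_def)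
    qed
    have d: "(flow s b - flow s a)\<^sup>2 \<le> (exp (L * \<tau>) * \<bar>b - a\<bar>)\<^sup>2"
    proof -
      have "\<bar>flow s b - flow s a\<bar> \<le> exp (L * s) * \<bar>b - a\<bar>" using flow_lip s by simp
      also have "\<dots> \<le> exp (L * \<tau>) * \<bar>b - a\<bar>" using s L_pos by (intro mult_right_mono) auto
      finally show ?thesis by (metis abs_ge_zero power2_abs power_mono)
    qed
    have "norm (g' s) \<le> L2 * (flow s b - flow s a)\<^sup>2 * exp (- I s)"
      unfolding g'_def using F_taylor[of s "flow s b" "flow s a"] by (simp add: abs_mult mult_right_mono)
    also have "\<dots> \<le> L2 * (exp (L * \<tau>) * \<bar>b - a\<bar>)\<^sup>2 * exp (L * \<tau>)"
      using d e L2_nonneg by (intro mult_mono mult_left_mono) auto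
    also have "\<dots> = B"
    proof -
      have "exp (3 * L * \<tau>) = exp (L * \<tau>) * exp (L * \<tau>) * exp (L * \<tau>)"
        by (simp flip: exp_add)
      then show ?thesis by (simp add: B_def power_mult_distrib power2_eq_square)
    qed
    finally show "norm (g' s) \<le> B" .
  qed (use t in auto)
  moreover have "g 0 = 0" by (simp add: g_def I_def)
  moreover have "B * t \<le> B * \<tau>" using t L2_nonneg by (intro mult_left_mono) (auto simp: B_def)
  ultimately have g: "\<bar>g t\<bar> \<le> B * \<tau>" using t by simp
  have "flow t b - flow t a - jac t a * (b - a) = jac t a * g t"
    by (simp add: g_def jac_def I_def exp_minus field_simps)
  then have "\<bar>flow t b - flow t a - jac t a * (b - a)\<bar> = jac t a * \<bar>g t\<bar>"
    by (simp add: abs_mult abs_of_pos)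
  also have "\<dots> \<le> jac t a * (B * \<tau>)" using g by (intro mult_left_mono) (auto simp: less_imp_le)
  finally show ?thesis by (simp add: B_def algebra_simps)
qed

text \<open>The chain rule along a moving initial value. The remainder of \<open>flow_taylor\<close>
  is quadratic in \<open>A s - a\<close>, hence has derivative 0 at \<open>t\<close>, and the three
  remaining terms are differentiable separately.\<close>

lemma flow_curve_deriv:
  assumes t: "t > 0" and A: "(A has_real_derivative d) (at t)"
  shows "((\<lambda>s. flow s (A s)) has_real_derivative F t (flow t (A t)) + jac t (A t) * d) (at t)"
proof -
  define a where "a = A t"
  define C where "C = (t + 1) * L2 * exp (3 * L * (t + 1))"
  define r where "r s = flow s (A s) - flow s a - jac s a * (A s - a)" for s
  have Ac: "(A \<longlongrightarrow> a) (at t)" using DERIV_isCont[OF A] by (simp add: isCont_def a_def)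
  have jc: "((\<lambda>s. jac s a) \<longlongrightarrow> jac t a) (at t)"
    using DERIV_isCont[OF jac_deriv[OF t, of a]] by (simp add: isCont_def)
  have Ad: "((\<lambda>s. (A s - a) / (s - t)) \<longlongrightarrow> d) (at t)" using A by (simp add: has_field_derivative_iff a_def)
  have "((\<lambda>s. C * jac s a * \<bar>(A s - a) / (s - t)\<bar> * \<bar>A s - a\<bar>) \<longlongrightarrow> C * jac t a * \<bar>d\<bar> * \<bar>a - a\<bar>) (at t)"
    by (intro tendsto_intros jc Ad Ac)
  then have lim: "((\<lambda>s. C * jac s a * \<bar>(A s - a) / (s - t)\<bar> * \<bar>A s - a\<bar>) \<longlongrightarrow> 0) (at t)" by simp
  have "((\<lambda>s. (r s - r t) / (s - t)) \<longlongrightarrow> 0) (at t)"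
  proof (rule Lim_null_comparison[OF _ lim])
    have "\<forall>\<^sub>F s in at t. s \<in> {0<..<t+1}" using t by (intro eventually_at_in_open') auto
    then show "\<forall>\<^sub>F s in at t. norm ((r s - r t) / (s - t)) \<le> C * jac s a * \<bar>(A s - a) / (s - t)\<bar> * \<bar>A s - a\<bar>"
    proof eventually_elim
      case (elim s)
      have "\<bar>r s\<bar> \<le> C * jac s a * (A s - a)\<^sup>2"
        unfolding r_def C_def using elim by (intro flow_taylor) auto
      then have "\<bar>r s\<bar> / \<bar>s - t\<bar> \<le> C * jac s a * (A s - a)\<^sup>2 / \<bar>s - t\<bar>" by (rule divide_right_mono) simp
      moreover have "r t = 0" by (simp add: r_def a_def)
      moreover have "C * jac s a * (A s - a)\<^sup>2 / \<bar>s - t\<bar> = C * jac s a * \<bar>(A s - a) / (s - t)\<bar> * \<bar>A s - a\<bar>"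
        by (simp add: abs_divide power2_eq_square mult.assoc)
      ultimately show ?case by (simp add: abs_divide)
    qed
  qed
  then have "(r has_real_derivative 0) (at t)" by (simp add: has_field_derivative_iff)
  then have "((\<lambda>s. r s + flow s a + jac s a * (A s - a)) has_real_derivative F t (flow t a) + jac t a * d) (at t)"
    using flow_deriv[OF t, of a] jac_deriv[OF t, of a] A by (auto intro!: derivative_eq_intros simp: a_def)
  then show ?thesis by (simp add: r_def a_def)
qed

text \<open>The supersolution \<open>G\<close> is only asked for an upper bound of its second differences: flows of
  \<open>C\<^sup>1\<^sup>,\<^sup>1\<close> fields are not twice differentiable in the initial value.\<close>

lemma comparison:
  assumes u_cont: "continuous_on ({\<alpha>..\<beta>} \<times> {s..\<tau>}) (\<lambda>(x, t). u x t)"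
    and G_cont: "continuous_on ({\<alpha>..\<beta>} \<times> {s..\<tau>}) (\<lambda>(x, t). G x t)"
    and u_t: "\<And>x t. \<alpha> < x \<Longrightarrow> x < \<beta> \<Longrightarrow> s < t \<Longrightarrow> t \<le> \<tau> \<Longrightarrow> ((\<lambda>r. u x r) has_real_derivative ut x t) (at t)"
    and u_x: "\<And>x t. \<alpha> < x \<Longrightarrow> x < \<beta> \<Longrightarrow> s < t \<Longrightarrow> t \<le> \<tau> \<Longrightarrow> ((\<lambda>y. u y t) has_real_derivative ux x t) (at x)"
    and u_xx: "\<And>x t. \<alpha> < x \<Longrightarrow> x < \<beta> \<Longrightarrow> s < t \<Longrightarrow> t \<le> \<tau> \<Longrightarrow> ((\<lambda>y. ux y t) has_real_derivative uxx x t) (at x)"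
    and u_eq: "\<And>x t. \<alpha> < x \<Longrightarrow> x < \<beta> \<Longrightarrow> s < t \<Longrightarrow> t \<le> \<tau> \<Longrightarrow> ut x t = uxx x t + F t (u x t)"
    and G_super: "\<And>x t. \<alpha> < x \<Longrightarrow> x < \<beta> \<Longrightarrow> s < t \<Longrightarrow> t \<le> \<tau> \<Longrightarrow>
      \<exists>d c. ((\<lambda>r. G x r) has_real_derivative d) (at t) \<and>
        (\<forall>\<epsilon>>0. \<forall>\<^sub>F h in at_right 0. G (x + h) t + G (x - h) t - 2 * G x t \<le> (c + \<epsilon>) * h\<^sup>2) \<and>
        d \<ge> c + F t (G x t)"
    and init: "\<And>x. \<alpha> \<le> x \<Longrightarrow> x \<le> \<beta> \<Longrightarrow> u x s \<le> G x s"
    and bd: "\<And>t. s \<le> t \<Longrightarrow> t \<le> \<tau> \<Longrightarrow> u \<alpha> t \<le> G \<alpha> t \<and> u \<beta> t \<le> G \<beta> t"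
    and xt: "\<alpha> \<le> x" "x \<le> \<beta>" "s \<le> t" "t \<le> \<tau>"
  shows "u x t \<le> G x t"
proof (rule ccontr)
  assume neg: "\<not> u x t \<le> G x t"
  \<comment> \<open>Since \<open>K > L\<close>, at a positive maximum of the weighted difference the
    time derivative exceeds what the Lipschitz reaction can supply.\<close>
  define K where "K = L + 1"
  define \<phi> where "\<phi> z = (case z of (x, t) \<Rightarrow> (u x t - G x t) * exp (- K * t))" for z
  have phi: "\<phi> (x, t) = (u x t - G x t) * exp (- K * t)" for x t by (simp add: \<phi>_def)
  have "continuous_on ({\<alpha>..\<beta>} \<times> {s..\<tau>}) \<phi>"
    unfolding \<phi>_def case_prod_unfold
    by (intro continuous_intros) (use u_cont G_cont in \<open>auto simp: case_prod_unfold\<close>)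
  then obtain z where z: "z \<in> {\<alpha>..\<beta>} \<times> {s..\<tau>}" "\<And>y. y \<in> {\<alpha>..\<beta>} \<times> {s..\<tau>} \<Longrightarrow> \<phi> y \<le> \<phi> z"
    using continuous_attains_sup[of "{\<alpha>..\<beta>} \<times> {s..\<tau>}" \<phi>] xt by (force simp: compact_Times)
  obtain x0 t0 where z0: "z = (x0, t0)" by (cases z)
  have in0: "\<alpha> \<le> x0" "x0 \<le> \<beta>" "s \<le> t0" "t0 \<le> \<tau>" using z(1) z0 by auto
  have mx: "\<phi> (y, r) \<le> \<phi> (x0, t0)" if "\<alpha> \<le> y" "y \<le> \<beta>" "s \<le> r" "r \<le> \<tau>" for y r
    using z(2)[of "(y, r)"] z0 that by auto
  define D where "D = u x0 t0 - G x0 t0"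
  have "0 < \<phi> (x, t)" using neg by (simp add: phi)
  also have "\<dots> \<le> \<phi> (x0, t0)" using mx xt by blast
  finally have D: "D > 0" by (simp add: phi D_def zero_less_mult_iff)
  have x0: "\<alpha> < x0" "x0 < \<beta>" using D bd[of t0] in0 by (auto simp: D_def order_le_less)
  have t0: "s < t0" using D init[of x0] in0 by (auto simp: D_def order_le_less)
  obtain d c where d: "((\<lambda>r. G x0 r) has_real_derivative d) (at t0)"
    and c: "\<And>\<epsilon>. \<epsilon> > 0 \<Longrightarrow> \<forall>\<^sub>F h in at_right 0. G (x0 + h) t0 + G (x0 - h) t0 - 2 * G x0 t0 \<le> (c + \<epsilon>) * h\<^sup>2"
    and dc: "d \<ge> c + F t0 (G x0 t0)"
    using G_super[OF x0 t0 in0(4)] by blast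
  \<comment> \<open>The maximum is compared with earlier times only, because \<open>t0\<close> may
    be the final time.\<close>
  have ut: "ut x0 t0 \<ge> d + K * D"
  proof (rule ccontr)
    assume less: "\<not> ut x0 t0 \<ge> d + K * D"
    have "((\<lambda>r. (u x0 r - G x0 r) * exp (- K * r)) has_real_derivative (ut x0 t0 - d - K * D) * exp (- K * t0)) (at t0)"
      using u_t[OF x0 t0 in0(4)] d by (auto intro!: derivative_eq_intros simp: D_def algebra_simps)
    moreover have "(ut x0 t0 - d - K * D) * exp (- K * t0) < 0" using less by (simp add: mult_less_0_iff)
    ultimately obtain e where e: "e > 0" "\<And>h. h > 0 \<Longrightarrow> h < e \<Longrightarrow> \<phi> (x0, t0) < \<phi> (x0, t0 - h)"
      using DERIV_neg_dec_left unfolding phi by blast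
    define h where "h = min (e / 2) (t0 - s)"
    have "h > 0" "h < e" "s \<le> t0 - h" "t0 - h \<le> \<tau>" using e(1) t0 in0 by (auto simp: h_def min_def)
    then show False using e(2)[of h] mx[of x0 "t0 - h"] in0 by simp
  qed
  have uxx: "uxx x0 t0 \<le> c + \<epsilon>" if "\<epsilon> > 0" for \<epsilon>
  proof (rule tendsto_upperbound)
    define r where "r = min (x0 - \<alpha>) (\<beta> - x0)"
    have r: "r > 0" using x0 by (simp add: r_def)
    show "((\<lambda>h. (u (x0 + h) t0 + u (x0 - h) t0 - 2 * u x0 t0) / h\<^sup>2) \<longlongrightarrow> uxx x0 t0) (at_right 0)"
      by (rule second_difference_tendsto[OF r, where g'="\<lambda>y. ux y t0"])
         (use u_x u_xx x0 t0 in0 r_def in \<open>auto simp: abs_less_iff\<close>)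
    have "\<forall>\<^sub>F h in at_right 0. 0 < h \<and> h < r" using r by (auto intro: eventually_at_rightI[of 0 r])
    with c[OF that] show "\<forall>\<^sub>F h in at_right 0. (u (x0 + h) t0 + u (x0 - h) t0 - 2 * u x0 t0) / h\<^sup>2 \<le> c + \<epsilon>"
    proof eventually_elim
      case (elim h)
      have "u y t0 - G y t0 \<le> D" if "\<alpha> \<le> y" "y \<le> \<beta>" for y
        using mx[OF that in0(3,4)] by (simp add: phi D_def)
      from this[of "x0 + h"] this[of "x0 - h"] elim
      have "u (x0 + h) t0 + u (x0 - h) t0 - 2 * u x0 t0 \<le> (c + \<epsilon>) * h\<^sup>2"
        by (auto simp: D_def r_def)
      then show ?case using elim by (simp add: divide_le_eq)
    qed
  qed auto
  then have "uxx x0 t0 \<le> c" by (rule field_le_epsilon)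
  moreover have "F t0 (u x0 t0) \<le> F t0 (G x0 t0) + L * D"
    using F_lip[of t0 "u x0 t0" "G x0 t0"] D by (simp add: D_def)
  ultimately have "d + K * D \<le> d + L * D" using ut u_eq[OF x0 t0 in0(4)] dc by linarith
  then show False using D by (simp add: K_def algebra_simps)
qed

text \<open>Twice the constant of \<open>flow_taylor\<close> over a full period: a second difference
  collects the quadratic error from both sides.\<close>

definition Cq :: real where "Cq = 2 * (T * L2 * exp (3 * L * T))"

lemma Cq_nonneg: "Cq \<ge> 0" using T_pos L2_nonneg by (simp add: Cq_def)

text \<open>The differential inequality is required only where the comparison principle tests it: in
  the open interval and after time 0, with the final time included.\<close>

definition barrier_on :: "real \<Rightarrow> real \<Rightarrow> (real \<Rightarrow> real \<Rightarrow> real) \<Rightarrow> bool" where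
  "barrier_on \<alpha> \<beta> A \<longleftrightarrow> continuous_on ({\<alpha>..\<beta>} \<times> {0..T}) (\<lambda>(x, t). A x t) \<and>
     (\<exists>At Ax Axx. \<forall>x\<in>{\<alpha><..<\<beta>}. \<forall>t\<in>{0<..T}.
        ((\<lambda>r. A x r) has_real_derivative At x t) (at t) \<and>
        ((\<lambda>y. A y t) has_real_derivative Ax x t) (at x) \<and>
        ((\<lambda>y. Ax y t) has_real_derivative Axx x t) (at x) \<and>
        Axx x t + Cq * (Ax x t)\<^sup>2 \<le> At x t)"

lemma barrier_onE:
  assumes "barrier_on \<alpha> \<beta> A"
  obtains At Ax Axx where "continuous_on ({\<alpha>..\<beta>} \<times> {0..T}) (\<lambda>(x, t). A x t)"
    and "\<And>x t. \<alpha> < x \<Longrightarrow> x < \<beta> \<Longrightarrow> 0 < t \<Longrightarrow> t \<le> T \<Longrightarrow> ((\<lambda>r. A x r) has_real_derivative At x t) (at t)"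
    and "\<And>x t. \<alpha> < x \<Longrightarrow> x < \<beta> \<Longrightarrow> 0 < t \<Longrightarrow> t \<le> T \<Longrightarrow> ((\<lambda>y. A y t) has_real_derivative Ax x t) (at x)"
    and "\<And>x t. \<alpha> < x \<Longrightarrow> x < \<beta> \<Longrightarrow> 0 < t \<Longrightarrow> t \<le> T \<Longrightarrow> ((\<lambda>y. Ax y t) has_real_derivative Axx x t) (at x)"
    and "\<And>x t. \<alpha> < x \<Longrightarrow> x < \<beta> \<Longrightarrow> 0 < t \<Longrightarrow> t \<le> T \<Longrightarrow> Axx x t + Cq * (Ax x t)\<^sup>2 \<le> At x t"
proof -
  obtain At Ax Axx where c: "continuous_on ({\<alpha>..\<beta>} \<times> {0..T}) (\<lambda>(x, t). A x t)"
    and *: "\<forall>x\<in>{\<alpha><..<\<beta>}. \<forall>t\<in>{0<..T}.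
        ((\<lambda>r. A x r) has_real_derivative At x t) (at t) \<and>
        ((\<lambda>y. A y t) has_real_derivative Ax x t) (at x) \<and>
        ((\<lambda>y. Ax y t) has_real_derivative Axx x t) (at x) \<and>
        Axx x t + Cq * (Ax x t)\<^sup>2 \<le> At x t"
    using assms unfolding barrier_on_def by blast
  show thesis by (rule that[OF c, of At Ax Axx]) (use * in auto)
qed

text \<open>Clamping the time to the period makes the Lipschitz constant in the initial value
  uniform, so \<open>continuous_on_nemytskii\<close> applies with the flow in place of the
  field.\<close>

lemma flow_joint_cont:
  assumes "continuous_on S A" "continuous_on S g" "\<And>z. z \<in> S \<Longrightarrow> 0 \<le> g z \<and> g z \<le> T"
  shows "continuous_on S (\<lambda>z. flow (g z) (A z))"
proof -
  define \<Phi> where "\<Phi> t a = flow (min T (max 0 t)) a" for t a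
  have "continuous_on S (\<lambda>z. \<Phi> (g z) (A z))"
  proof (rule continuous_on_nemytskii[where K="exp (L * T)" and G=\<Phi> and g=g and y=A])
    show "continuous_on UNIV (\<lambda>t. \<Phi> t w)" for w
    proof -
      have "continuous_on UNIV ((\<lambda>t. flow t w) \<circ> (\<lambda>t. min T (max 0 t)))"
        by (intro continuous_on_compose continuous_intros flow_cont) (use T_pos in auto)
      then show ?thesis by (simp add: \<Phi>_def o_def)
    qed
    fix t a b
    have "\<bar>\<Phi> t a - \<Phi> t b\<bar> \<le> exp (L * min T (max 0 t)) * \<bar>a - b\<bar>"
      unfolding \<Phi>_def by (rule flow_lip) (use T_pos in auto)
    also have "\<dots> \<le> exp (L * T) * \<bar>a - b\<bar>" using L_pos by (intro mult_right_mono) auto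
    finally show "\<bar>\<Phi> t a - \<Phi> t b\<bar> \<le> exp (L * T) * \<bar>a - b\<bar>" .
  qed (use assms in auto)
  moreover have "\<Phi> (g z) (A z) = flow (g z) (A z)" if "z \<in> S" for z
    using assms(3)[OF that] by (simp add: \<Phi>_def)
  ultimately show ?thesis by (simp cong: continuous_on_cong)
qed

text \<open>The upper half of \<open>flow_taylor\<close>, used at \<open>x + h\<close> and at
  \<open>x - h\<close>: the linear terms combine to \<open>jac\<close> times the second difference
  of \<open>g\<close>, and each quadratic term contributes one square of \<open>g'\<close>.\<close>

lemma flow_second_difference:
  assumes "r > 0" and g: "\<And>y. \<bar>y - x\<bar> < r \<Longrightarrow> (g has_real_derivative g' y) (at y)"
    and g': "(g' has_real_derivative g'') (at x)" and t: "0 \<le> t" "t \<le> T" and "\<epsilon> > 0"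
  shows "\<forall>\<^sub>F h in at_right 0. flow t (g (x + h)) + flow t (g (x - h)) - 2 * flow t (g x)
    \<le> (jac t (g x) * (g'' + Cq * (g' x)\<^sup>2) + \<epsilon>) * h\<^sup>2"
proof -
  define J where "J = jac t (g x)"
  define C where "C = T * L2 * exp (3 * L * T)"
  define q where "q h = J * ((g (x + h) + g (x - h) - 2 * g x) / h\<^sup>2)
      + C * J * (((g (x + h) - g x) / h)\<^sup>2 + ((g (x - h) - g x) / (- h))\<^sup>2)" for h
  have gx: "(g has_real_derivative g' x) (at x)" using g[of x] \<open>r > 0\<close> by simp
  then have 1: "((\<lambda>h. (g (x + h) - g x) / h) \<longlongrightarrow> g' x) (at 0)" by (simp add: DERIV_def)
  then have 2: "((\<lambda>h. (g (x + (- h)) - g x) / (- h)) \<longlongrightarrow> g' x) (at 0)"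
    by (rule filterlim_compose[where g="\<lambda>h. (g (x + h) - g x) / h"])
       (auto intro!: filterlim_atI tendsto_eq_intros simp: eventually_at_filter)
  then have 3: "((\<lambda>h. (g (x - h) - g x) / (- h)) \<longlongrightarrow> g' x) (at 0)"
    by (simp only: add_uminus_conv_diff)
  have lim: "(q \<longlongrightarrow> J * g'' + C * J * ((g' x)\<^sup>2 + (g' x)\<^sup>2)) (at_right 0)"
    unfolding q_def
    by (intro tendsto_intros second_difference_tendsto[OF assms(1-3)] tendsto_within_subset[OF 1]
        tendsto_within_subset[OF 3]) auto
  have "\<forall>\<^sub>F h in at_right 0. q h < J * g'' + C * J * ((g' x)\<^sup>2 + (g' x)\<^sup>2) + \<epsilon>"
    by (rule order_tendstoD(2)[OF lim]) (use \<open>\<epsilon> > 0\<close> in simp)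
  moreover have "\<forall>\<^sub>F h in at_right 0. (h::real) > 0" by (auto intro: eventually_at_rightI[of 0 1])
  ultimately show ?thesis
  proof eventually_elim
    case (elim h)
    have tay: "flow t b - flow t (g x) \<le> J * (b - g x) + C * J * (b - g x)\<^sup>2" for b
      using flow_taylor[OF t, of b "g x"] by (simp add: J_def C_def)
    have "flow t (g (x + h)) + flow t (g (x - h)) - 2 * flow t (g x)
      \<le> J * (g (x + h) + g (x - h) - 2 * g x) + C * J * ((g (x + h) - g x)\<^sup>2 + (g (x - h) - g x)\<^sup>2)"
      using tay[of "g (x + h)"] tay[of "g (x - h)"] by (simp add: algebra_simps)
    also have "\<dots> = q h * h\<^sup>2"
      using elim by (simp add: q_def power_divide add_divide_distrib[symmetric] field_simps)
    also have "\<dots> \<le> (J * g'' + C * J * ((g' x)\<^sup>2 + (g' x)\<^sup>2) + \<epsilon>) * h\<^sup>2"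
      using elim by (intro mult_right_mono) auto
    also have "\<dots> = (jac t (g x) * (g'' + Cq * (g' x)\<^sup>2) + \<epsilon>) * h\<^sup>2"
      by (simp add: J_def C_def Cq_def algebra_simps)
    finally show ?case .
  qed
qed

text \<open>Flows start at time 0, so a comparison during period \<open>n\<close> is shifted back by
  periodicity of \<open>F\<close>. The majorant \<open>G\<close> is left general because
  \<open>local_comparison\<close> uses one that is not the flow of a barrier.\<close>

lemma period_comparison:
  assumes w: "classical_sol_on F {0<..} w"
    and \<rho>: "0 \<le> \<rho>" "real n * T + \<rho> > 0"
    and G_cont: "continuous_on ({\<alpha>..\<beta>} \<times> {\<rho>..\<tau>}) (\<lambda>(x, t). G x t)"
    and G_super: "\<And>x t. \<alpha> < x \<Longrightarrow> x < \<beta> \<Longrightarrow> \<rho> < t \<Longrightarrow> t \<le> \<tau> \<Longrightarrow>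
      \<exists>d c. ((\<lambda>r. G x r) has_real_derivative d) (at t) \<and>
        (\<forall>\<epsilon>>0. \<forall>\<^sub>F h in at_right 0. G (x + h) t + G (x - h) t - 2 * G x t \<le> (c + \<epsilon>) * h\<^sup>2) \<and>
        d \<ge> c + F t (G x t)"
    and init: "\<And>x. \<alpha> \<le> x \<Longrightarrow> x \<le> \<beta> \<Longrightarrow> w x (real n * T + \<rho>) \<le> G x \<rho>"
    and bd: "\<And>\<sigma>. \<rho> \<le> \<sigma> \<Longrightarrow> \<sigma> \<le> \<tau> \<Longrightarrow> w \<alpha> (real n * T + \<sigma>) \<le> G \<alpha> \<sigma> \<and> w \<beta> (real n * T + \<sigma>) \<le> G \<beta> \<sigma>"
    and x: "\<alpha> \<le> x" "x \<le> \<beta>" "\<rho> \<le> \<sigma>" "\<sigma> \<le> \<tau>"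
  shows "w x (real n * T + \<sigma>) \<le> G x \<sigma>"
proof -
  obtain wt wx wxx where wc: "continuous_on (UNIV \<times> {0<..}) (\<lambda>(x, t). w x t)"
    and *: "\<forall>x. \<forall>t\<in>{0<..}. ((\<lambda>s. w x s) has_real_derivative wt x t) (at t) \<and>
           ((\<lambda>y. w y t) has_real_derivative wx x t) (at x) \<and>
           ((\<lambda>y. wx y t) has_real_derivative wxx x t) (at x) \<and>
           wt x t = wxx x t + F t (w x t)"
    using w unfolding classical_sol_on_def by blast
  have w_t: "((\<lambda>s. w x s) has_real_derivative wt x t) (at t)"
    and w_x: "((\<lambda>y. w y t) has_real_derivative wx x t) (at x)"
    and w_xx: "((\<lambda>y. wx y t) has_real_derivative wxx x t) (at x)"
    and w_eq: "wt x t = wxx x t + F t (w x t)" if "t > 0" for x t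
    using * that by (metis greaterThan_iff)+
  define N where "N = real n * T"
  have N: "N \<ge> 0" using T_pos by (simp add: N_def)
  have pos: "N + r > 0" if "\<rho> \<le> r" for r using \<rho> that by (simp add: N_def)
  have "w x (N + \<sigma>) \<le> G x \<sigma>"
  proof (rule comparison[where u="\<lambda>x t. w x (N + t)" and G=G and s=\<rho> and \<tau>=\<tau> and \<alpha>=\<alpha> and \<beta>=\<beta>
        and ut="\<lambda>x t. wt x (N + t)" and ux="\<lambda>x t. wx x (N + t)" and uxx="\<lambda>x t. wxx x (N + t)"])
    show "continuous_on ({\<alpha>..\<beta>} \<times> {\<rho>..\<tau>}) (\<lambda>(x, t). w x (N + t))"
    proof -
      have "continuous_on ({\<alpha>..\<beta>} \<times> {\<rho>..\<tau>}) ((\<lambda>(x, t). w x t) \<circ> (\<lambda>(x, t). (x, N + t)))"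
        by (intro continuous_on_compose continuous_on_subset[OF wc])
           (use pos in \<open>auto intro!: continuous_intros simp: case_prod_unfold\<close>)
      then show ?thesis by (simp add: o_def case_prod_unfold)
    qed
    fix y t assume yt: "\<alpha> < y" "y < \<beta>" "\<rho> < t" "t \<le> \<tau>"
    have t: "0 < t" "N + t > 0" using yt \<rho> pos by auto
    have "((\<lambda>r. w y (N + r)) has_real_derivative wt y (N + t) * 1) (at t)"
      by (rule DERIV_chain'[of "\<lambda>r. N + r" 1 t UNIV "w y"]) (use t w_t[of "N + t" y] in \<open>auto intro!: derivative_eq_intros\<close>)
    then show "((\<lambda>r. w y (N + r)) has_real_derivative wt y (N + t)) (at t)" by simp
    show "((\<lambda>y. w y (N + t)) has_real_derivative wx y (N + t)) (at y)"
      "((\<lambda>y. wx y (N + t)) has_real_derivative wxx y (N + t)) (at y)"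
      using w_x w_xx t by auto
    have "F (N + t) v = F t v" for v using F_per_nat[of t n v] by (simp add: N_def add.commute)
    then show "wt y (N + t) = wxx y (N + t) + F t (w y (N + t))"
      using w_eq t by simp
  qed (use assms N_def in auto)
  then show ?thesis by (simp add: N_def)
qed

text \<open>In the supersolution inequality for \<open>flow t (A x t)\<close> the reaction cancels,
  and both remaining sides carry the same positive factor \<open>jac\<close>; the inequality in
  \<open>barrier_on\<close> is what is left.\<close>

lemma period_barrier:
  assumes w: "classical_sol_on F {0<..} w" and A: "barrier_on \<alpha> \<beta> A"
    and \<rho>: "0 \<le> \<rho>" "\<tau> \<le> T" "real n * T + \<rho> > 0"
    and init: "\<And>x. \<alpha> \<le> x \<Longrightarrow> x \<le> \<beta> \<Longrightarrow> w x (real n * T + \<rho>) \<le> flow \<rho> (A x \<rho>)"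
    and bd: "\<And>\<sigma>. \<rho> \<le> \<sigma> \<Longrightarrow> \<sigma> \<le> \<tau> \<Longrightarrow> w \<alpha> (real n * T + \<sigma>) \<le> flow \<sigma> (A \<alpha> \<sigma>)
                 \<and> w \<beta> (real n * T + \<sigma>) \<le> flow \<sigma> (A \<beta> \<sigma>)"
    and x: "\<alpha> \<le> x" "x \<le> \<beta>" "\<rho> \<le> \<sigma>" "\<sigma> \<le> \<tau>"
  shows "w x (real n * T + \<sigma>) \<le> flow \<sigma> (A x \<sigma>)"
proof -
  obtain At Ax Axx where Ac: "continuous_on ({\<alpha>..\<beta>} \<times> {0..T}) (\<lambda>(x, t). A x t)"
    and A_t: "\<And>x t. \<alpha> < x \<Longrightarrow> x < \<beta> \<Longrightarrow> 0 < t \<Longrightarrow> t \<le> T \<Longrightarrow> ((\<lambda>r. A x r) has_real_derivative At x t) (at t)"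
    and A_x: "\<And>x t. \<alpha> < x \<Longrightarrow> x < \<beta> \<Longrightarrow> 0 < t \<Longrightarrow> t \<le> T \<Longrightarrow> ((\<lambda>y. A y t) has_real_derivative Ax x t) (at x)"
    and A_xx: "\<And>x t. \<alpha> < x \<Longrightarrow> x < \<beta> \<Longrightarrow> 0 < t \<Longrightarrow> t \<le> T \<Longrightarrow> ((\<lambda>y. Ax y t) has_real_derivative Axx x t) (at x)"
    and A_ineq: "\<And>x t. \<alpha> < x \<Longrightarrow> x < \<beta> \<Longrightarrow> 0 < t \<Longrightarrow> t \<le> T \<Longrightarrow> Axx x t + Cq * (Ax x t)\<^sup>2 \<le> At x t"
    by (rule barrier_onE[OF A]) blast
  show ?thesis
  proof (rule period_comparison[OF w \<rho>(1,3), where G="\<lambda>x t. flow t (A x t)" and \<alpha>=\<alpha> and \<beta>=\<beta> and \<tau>=\<tau>])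
    show "continuous_on ({\<alpha>..\<beta>} \<times> {\<rho>..\<tau>}) (\<lambda>(x, t). flow t (A x t))"
      unfolding case_prod_unfold
      by (intro flow_joint_cont continuous_intros continuous_on_subset[OF Ac[unfolded case_prod_unfold]])
         (use \<rho> in auto)
    fix y t assume yt: "\<alpha> < y" "y < \<beta>" "\<rho> < t" "t \<le> \<tau>"
    have t: "0 < t" "t \<le> T" using yt \<rho> by auto
    define r where "r = min (y - \<alpha>) (\<beta> - y)"
    have r: "r > 0" using yt by (simp add: r_def)
    have "\<forall>\<epsilon>>0. \<forall>\<^sub>F h in at_right 0. flow t (A (y + h) t) + flow t (A (y - h) t) - 2 * flow t (A y t)
        \<le> (jac t (A y t) * (Axx y t + Cq * (Ax y t)\<^sup>2) + \<epsilon>) * h\<^sup>2"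
      by (intro allI impI flow_second_difference[OF r, where g="\<lambda>y. A y t" and g'="\<lambda>y. Ax y t"])
         (use A_x A_xx yt t in \<open>auto simp: r_def abs_less_iff\<close>)
    moreover have "((\<lambda>r. flow r (A y r)) has_real_derivative F t (flow t (A y t)) + jac t (A y t) * At y t) (at t)"
      using flow_curve_deriv[OF t(1) A_t[OF yt(1,2) t(1,2)]] .
    moreover have "jac t (A y t) * (Axx y t + Cq * (Ax y t)\<^sup>2) \<le> jac t (A y t) * At y t"
      using A_ineq[OF yt(1,2) t(1,2)] by (intro mult_left_mono) (auto simp: less_imp_le)
    ultimately show "\<exists>d c. ((\<lambda>r. flow r (A y r)) has_real_derivative d) (at t) \<and>
        (\<forall>\<epsilon>>0. \<forall>\<^sub>F h in at_right 0. flow t (A (y + h) t) + flow t (A (y - h) t) - 2 * flow t (A y t) \<le> (c + \<epsilon>) * h\<^sup>2) \<and>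
        d \<ge> c + F t (flow t (A y t))"
      by (intro exI conjI) (assumption+, simp)
  qed (use init bd x in auto)
qed

text \<open>Induction over the periods, in which \<open>step\<close> makes the end of one period an
  admissible start of the next. Start and end may lie inside a period, because trapping is invoked
  at arbitrary times and lateral bounds may be known only up to \<open>\<tau>\<close>.\<close>

lemma barrier_chain:
  assumes w: "classical_sol_on F {0<..} w" and A: "\<And>n. k \<le> n \<Longrightarrow> barrier_on \<alpha> \<beta> (A n)"
    and step: "\<And>n x. k \<le> n \<Longrightarrow> \<alpha> \<le> x \<Longrightarrow> x \<le> \<beta> \<Longrightarrow> flow T (A n x T) \<le> A (Suc n) x 0"
    and s: "0 < s" "real k * T \<le> s" "s \<le> real k * T + T"
    and init: "\<And>x. \<alpha> \<le> x \<Longrightarrow> x \<le> \<beta> \<Longrightarrow> w x s \<le> flow (s - real k * T) (A k x (s - real k * T))"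
    and bd: "\<And>n \<sigma>. k \<le> n \<Longrightarrow> 0 \<le> \<sigma> \<Longrightarrow> \<sigma> \<le> T \<Longrightarrow> s \<le> real n * T + \<sigma> \<Longrightarrow> real n * T + \<sigma> \<le> \<tau> \<Longrightarrow>
       w \<alpha> (real n * T + \<sigma>) \<le> flow \<sigma> (A n \<alpha> \<sigma>) \<and> w \<beta> (real n * T + \<sigma>) \<le> flow \<sigma> (A n \<beta> \<sigma>)"
    and n: "k \<le> n" and x: "\<alpha> \<le> x" "x \<le> \<beta>"
    and \<sigma>: "0 \<le> \<sigma>" "\<sigma> \<le> T" "s \<le> real n * T + \<sigma>" "real n * T + \<sigma> \<le> \<tau>"
  shows "w x (real n * T + \<sigma>) \<le> flow \<sigma> (A n x \<sigma>)"
  using n x \<sigma>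
proof (induction n arbitrary: x \<sigma> rule: dec_induct)
  case (base x \<sigma>)
  show ?case
    by (rule period_barrier[OF w A[OF order_refl], where \<rho>="s - real k * T" and \<tau>="\<sigma>"])
       (use base s init bd[of k] in auto)
next
  case (step n x \<sigma>)
  have le: "s \<le> real n * T + T" using step.hyps s T_pos
    by (smt (verit, best) mult_right_mono of_nat_le_iff)
  have e: "real (Suc n) * T = real n * T + T" by (simp add: algebra_simps)
  have le': "real n * T + T \<le> \<tau>" using step.prems e by linarith
  show ?case
  proof (rule period_barrier[OF w A, where \<rho>=0 and \<tau>="\<sigma>"])
    show "k \<le> Suc n" using step.hyps by simp
    fix y assume y: "\<alpha> \<le> y" "y \<le> \<beta>"
    have "w y (real n * T + T) \<le> flow T (A n y T)"
      by (rule step.IH) (use y T_pos le le' in auto)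
    also have "\<dots> \<le> A (Suc n) y 0" using assms(3) step.hyps y by simp
    finally show "w y (real (Suc n) * T + 0) \<le> flow 0 (A (Suc n) y 0)" by (simp only: e add_0_right flow_0)
  next
    fix r assume "0 \<le> r" "r \<le> \<sigma>"
    then show "w \<alpha> (real (Suc n) * T + r) \<le> flow r (A (Suc n) \<alpha> r) \<and> w \<beta> (real (Suc n) * T + r) \<le> flow r (A (Suc n) \<beta> r)"
      by (intro bd) (use step.hyps step.prems le e in auto)
  qed (use step.prems s le e in auto)
qed

end

section \<open>Trapping below an equilibrium unstable from below\<close>

lemma period_decomposition:
  fixes T t :: real
  assumes "T > 0" "t \<ge> 0"
  obtains n where "real n * T \<le> t" "t < real n * T + T"
proof
  define n where "n = nat \<lfloor>t / T\<rfloor>"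
  have n: "real n = of_int \<lfloor>t / T\<rfloor>" using assms by (simp add: n_def)
  show "real n * T \<le> t" "t < real n * T + T"
    unfolding n using floor_divide_lower[OF assms(1), of t] floor_divide_upper[OF assms(1), of t]
    by (simp_all add: algebra_simps)
qed

lemma cos_ge_of_abs_le:
  fixes l x :: real
  assumes "\<bar>x\<bar> \<le> l" "l \<le> pi" shows "cos l \<le> cos x"
  using cos_monotone_0_pi_le[of "\<bar>x\<bar>" l] assms by simp

context c11_field
begin

lemma flow_abs_bounds:
  assumes "0 \<le> t" "t \<le> T"
  shows "a \<ge> 0 \<Longrightarrow> a / exp (L * T) \<le> flow t a" "a \<ge> 0 \<Longrightarrow> flow t a \<le> exp (L * T) * a"
    "a \<le> 0 \<Longrightarrow> flow t a \<le> a / exp (L * T)" "a \<le> 0 \<Longrightarrow> exp (L * T) * a \<le> flow t a"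
proof -
  have e: "exp (L * t) \<le> exp (L * T)" using assms L_pos by simp
  have e': "1 / exp (L * T) \<le> exp (- L * t)" using e by (simp add: exp_minus field_simps)
  { assume a: "a \<ge> 0"
    have "a * (1 / exp (L * T)) \<le> a * exp (- L * t)" using e' a by (rule mult_left_mono)
    then show "a / exp (L * T) \<le> flow t a" using flow_diff_lower[of 0 a t] a assms by (simp add: mult.commute)
    have "a * exp (L * t) \<le> a * exp (L * T)" using e a by (rule mult_left_mono)
    then show "flow t a \<le> exp (L * T) * a" using flow_diff_upper[of 0 a t] a assms by (simp add: mult.commute) }
  { assume a: "a \<le> 0"
    have "a * exp (- L * t) \<le> a * (1 / exp (L * T))" using e' a by (rule mult_left_mono_neg)
    then show "flow t a \<le> a / exp (L * T)" using flow_diff_lower[of a 0 t] a assms by (simp add: mult.commute)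
    have "a * exp (L * T) \<le> a * exp (L * t)" using e a by (rule mult_left_mono_neg)
    then show "exp (L * T) * a \<le> flow t a" using flow_diff_upper[of a 0 t] a assms by (simp add: mult.commute) }
qed

lemma flow_T_cont: "continuous_on S (flow T)"
  using flow_joint_cont[of S "\<lambda>a. a" "\<lambda>_. T"] T_pos by auto

text \<open>The strict decrease holds only pointwise; on a compact interval that avoids both
  \<open>- r\<close> and 0, continuity makes it uniform.\<close>

lemma flow_T_gap:
  assumes P: "\<And>a. - r < a \<Longrightarrow> a < 0 \<Longrightarrow> flow T a < a" and "- r < b" "c < 0"
  obtains g where "g > 0" "\<And>a. b \<le> a \<Longrightarrow> a \<le> c \<Longrightarrow> flow T a \<le> a - g"
proof (cases "b \<le> c")
  case True
  have "continuous_on {b..c} (\<lambda>a. a - flow T a)"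
    by (intro continuous_intros flow_T_cont)
  then obtain a where a: "a \<in> {b..c}" "\<And>a'. a' \<in> {b..c} \<Longrightarrow> a - flow T a \<le> a' - flow T a'"
    using continuous_attains_inf[of "{b..c}" "\<lambda>a. a - flow T a"] True by auto
  show thesis
    by (rule that[of "a - flow T a"]) (use a P[of a] assms(2,3) in force)+
next
  case False
  then show thesis by (intro that[of 1]) auto
qed

text \<open>The profile below is \<open>V + t q\<close> with \<open>V = - \<alpha> (1/2 + cos k x)\<close> and \<open>q = \<alpha> k\<^sup>2 (1/4 + cos k x)\<close>. Where \<open>q \<ge> 0\<close> the
  profile lies in a region in which one period pushes down by more than \<open>T q\<close>; where it reaches above \<open>0\<close>, \<open>q\<close> is
  negative enough to compensate for any growth there, and it ends strictly above \<open>0\<close>.\<close>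

lemma trapping_barrier:
  assumes r: "r > 0" and P: "\<And>a. - r < a \<Longrightarrow> a < 0 \<Longrightarrow> flow T a < a" and "\<theta> > 0"
  obtains \<alpha> l e A where "\<alpha> > 0" "l > 0" "e > 0" "exp (L * T) * (2 * \<alpha>) \<le> \<theta>"
    "\<And>X. barrier_on (X - l) (X + l) (\<lambda>x. A (x - X))"
    "\<And>x. \<bar>x\<bar> \<le> l \<Longrightarrow> flow T (A x T) \<le> A x 0"
    "\<And>x t. \<bar>x\<bar> \<le> l \<Longrightarrow> 0 \<le> t \<Longrightarrow> t \<le> T \<Longrightarrow> - (2 * \<alpha>) \<le> A x t"
    "\<And>t. 0 \<le> t \<Longrightarrow> t \<le> T \<Longrightarrow> e \<le> A l t" "\<And>t. 0 \<le> t \<Longrightarrow> t \<le> T \<Longrightarrow> e \<le> A (- l) t"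
    "\<And>t. 0 \<le> t \<Longrightarrow> t \<le> T \<Longrightarrow> A 0 t \<le> - \<alpha>"
proof -
  define \<Lambda> where "\<Lambda> = exp (L * T)"
  have Lam: "\<Lambda> > 1" using L_pos T_pos by (simp add: \<Lambda>_def)
  \<comment> \<open>The three bounds keep the negative part of the profile in the range of
    \<open>P\<close>, make the gradient term small (\<open>Cq * \<alpha>\<close> at most 1/32), and
    keep the flow started at \<open>- (2 * \<alpha>)\<close> above \<open>- \<theta>\<close> for a
    period.\<close>
  define \<alpha> where "\<alpha> = min (r / 2) (min (1 / (32 * (Cq + 1))) (\<theta> / (2 * \<Lambda>)))"
  have al: "\<alpha> > 0" using r Cq_nonneg \<open>\<theta> > 0\<close> Lam by (simp add: \<alpha>_def)
  have al_r: "3 * \<alpha> / 2 < r" using r al by (auto simp: \<alpha>_def min_def)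
  have al_C: "Cq * \<alpha> \<le> 1 / 32"
  proof -
    have "Cq * \<alpha> \<le> (Cq + 1) * (1 / (32 * (Cq + 1)))"
      using Cq_nonneg al by (intro mult_mono) (auto simp: \<alpha>_def)
    also have "\<dots> = 1 / 32" using Cq_nonneg by (simp add: field_simps)
    finally show ?thesis .
  qed
  have "\<alpha> \<le> \<theta> / (2 * \<Lambda>)" by (simp add: \<alpha>_def)
  then have al_th: "\<Lambda> * (2 * \<alpha>) \<le> \<theta>" using Lam by (simp add: field_simps)
  obtain g where g: "g > 0" "\<And>a. - (3 * \<alpha> / 2) \<le> a \<Longrightarrow> a \<le> - (\<alpha> / 4) \<Longrightarrow> flow T a \<le> a - g"
    using flow_T_gap[OF P, of r "- (3 * \<alpha> / 2)" "- (\<alpha> / 4)"] al al_r by auto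
  \<comment> \<open>\<open>\<delta>\<close> is the size of the time perturbation after a full
    period, relative to \<open>\<alpha>\<close>. The second bound lets the gap \<open>g\<close>
    absorb the perturbation even when the flow magnifies it by \<open>\<Lambda>\<close>; the third
    makes the ends positive in the end.\<close>
  define \<delta> where "\<delta> = min (1 / 8) (min (g / \<Lambda> / (2 * \<alpha>)) (1 / (4 * \<Lambda>)))"
  have de: "\<delta> > 0" "\<delta> \<le> 1 / 8" using g al Lam by (simp_all add: \<delta>_def)
  have "\<delta> \<le> g / \<Lambda> / (2 * \<alpha>)" by (simp add: \<delta>_def)
  then have de_g: "\<Lambda> * (2 * \<alpha> * \<delta>) \<le> g" using Lam al by (simp add: field_simps)
  have "\<delta> \<le> 1 / (4 * \<Lambda>)" by (simp add: \<delta>_def)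
  then have de_L: "\<delta> * \<Lambda> \<le> 1 / 4" using Lam by (simp add: field_simps)
  define k where "k = sqrt (\<delta> / T)"
  have k: "k > 0" "k\<^sup>2 = \<delta> / T" using de T_pos by (simp_all add: k_def)
  have Tk: "T * k\<^sup>2 = \<delta>" using T_pos by (simp add: k)
  \<comment> \<open>\<open>\<alpha> * y\<close> is the height of the profile at its ends at time 0.
    The value lies strictly between \<open>\<delta> / 4\<close>, roughly the loss during a period,
    and \<open>\<Lambda> * \<delta> / (4 * (\<Lambda> - 1))\<close>, beyond which growth by the
    factor \<open>\<Lambda>\<close> could outweigh that loss.\<close>
  define y where "y = (1 + 1 / \<Lambda>) * \<delta> / 4"
  have y: "y > 0" "y < 1 / 2"
  proof -
    have "1 + 1 / \<Lambda> > 0" using Lam by (simp add: add_pos_pos)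
    then show "y > 0" using de by (simp add: y_def)
    have "(1 + 1 / \<Lambda>) * \<delta> \<le> 2 * (1 / 8)" using Lam de by (intro mult_mono) auto
    then have "(1 + 1 / \<Lambda>) * \<delta> < 2" by (rule le_less_trans) simp
    then show "y < 1 / 2" unfolding y_def by (subst divide_less_eq) simp
  qed
  define l where "l = arccos (- 1 / 2 - y) / k"
  have kl: "k * l = arccos (- 1 / 2 - y)" using k by (simp add: l_def)
  have cl: "cos (k * l) = - 1 / 2 - y" unfolding kl by (rule cos_arccos) (use y in auto)
  have kl_pi: "k * l \<le> pi" unfolding kl by (rule arccos_ubound) (use y in auto)
  have "arccos (- 1 / 2 - y) > 0" using arccos_lt_bounded[of "- 1 / 2 - y"] y by simp
  then have l: "l > 0" using k by (simp add: l_def)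
  have cos_lb: "- 1 / 2 - y \<le> cos (k * x)" if "\<bar>x\<bar> \<le> l" for x
    using cos_ge_of_abs_le[of "k * x" "k * l"] kl_pi k that unfolding cl
    by (simp add: abs_mult mult_left_mono)
  \<comment> \<open>The second space derivative of the initial profile is
    \<open>\<alpha> * k\<^sup>2 * cos (k * x)\<close>. The spare 1/4 in the time derivative pays for
    the error \<open>\<delta>\<close>, at most 1/8, of the time-dependent term and for the gradient
    error 1/32.\<close>
  define A where "A x t = - \<alpha> * (1 / 2 + cos (k * x)) + t * (\<alpha> * k\<^sup>2 * (cos (k * x) + 1 / 4))" for x t
  have A0: "A x 0 = - \<alpha> * (1 / 2 + cos (k * x))" for x by (simp add: A_def)
  have AT: "A x T = - \<alpha> * (1 / 2 + cos (k * x)) + \<alpha> * \<delta> * (cos (k * x) + 1 / 4)" for x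
    by (simp add: A_def Tk[symmetric])
  have tk: "0 \<le> t * k\<^sup>2" "t * k\<^sup>2 \<le> \<delta>" if "0 \<le> t" "t \<le> T" for t
    using that mult_right_mono[of t T "k\<^sup>2"] by (simp_all add: Tk)
  have A_alt: "A x t = - \<alpha> * (1 / 2 + cos (k * x)) + \<alpha> * ((t * k\<^sup>2) * (cos (k * x) + 1 / 4))" for x t
    by (simp add: A_def algebra_simps)
  have bar: "barrier_on (X - l) (X + l) (\<lambda>x. A (x - X))" for X
    unfolding barrier_on_def
  proof (intro conjI exI ballI)
    show "continuous_on ({X - l..X + l} \<times> {0..T}) (\<lambda>(x, t). A (x - X) t)"
      unfolding A_def case_prod_unfold by (intro continuous_intros)
    fix x t assume t: "t \<in> {0<..T}"
    define s where "s = sin (k * (x - X))"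
    define c where "c = cos (k * (x - X))"
    define q where "q = t * k\<^sup>2"
    have q: "0 \<le> q" "q \<le> \<delta>" using tk[of t] t by (auto simp: q_def)
    show "((\<lambda>r. A (x - X) r) has_real_derivative \<alpha> * k\<^sup>2 * (cos (k * (x - X)) + 1 / 4)) (at t)"
      unfolding A_def by (auto intro!: derivative_eq_intros)
    show "((\<lambda>y. A (y - X) t) has_real_derivative \<alpha> * k * sin (k * (x - X)) * (1 - t * k\<^sup>2)) (at x)"
      unfolding A_def by (auto intro!: derivative_eq_intros simp: algebra_simps)
    show "((\<lambda>y. \<alpha> * k * sin (k * (y - X)) * (1 - t * k\<^sup>2)) has_real_derivative
        \<alpha> * k\<^sup>2 * cos (k * (x - X)) * (1 - t * k\<^sup>2)) (at x)"
      by (auto intro!: derivative_eq_intros simp: power2_eq_square)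
    have "c * (1 - q) \<le> c + \<delta>"
    proof -
      have "- c \<le> 1" using cos_ge_minus_one[of "k * (x - X)"] by (simp add: c_def)
      then have "- c * q \<le> 1 * q" using q by (intro mult_right_mono) auto
      with q have "- c * q \<le> \<delta>" by linarith
      then show ?thesis by (simp add: algebra_simps)
    qed
    moreover have "Cq * \<alpha> * (s * (1 - q))\<^sup>2 \<le> 1 / 32"
    proof -
      have "\<bar>s * (1 - q)\<bar> \<le> 1 * 1"
        unfolding abs_mult by (rule mult_mono) (use q de in \<open>auto simp: s_def\<close>)
      then have "(s * (1 - q))\<^sup>2 \<le> 1" by (simp add: abs_square_le_1)
      then have "Cq * \<alpha> * (s * (1 - q))\<^sup>2 \<le> Cq * \<alpha> * 1"
        using Cq_nonneg al by (intro mult_left_mono) auto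
      then show ?thesis using al_C by simp
    qed
    ultimately have "c * (1 - q) + Cq * \<alpha> * (s * (1 - q))\<^sup>2 \<le> c + 1 / 4" using de by linarith
    then have "\<alpha> * k\<^sup>2 * (c * (1 - q) + Cq * \<alpha> * (s * (1 - q))\<^sup>2) \<le> \<alpha> * k\<^sup>2 * (c + 1 / 4)"
      using al by (intro mult_left_mono) auto
    then show "\<alpha> * k\<^sup>2 * cos (k * (x - X)) * (1 - t * k\<^sup>2) + Cq * (\<alpha> * k * sin (k * (x - X)) * (1 - t * k\<^sup>2))\<^sup>2
        \<le> \<alpha> * k\<^sup>2 * (cos (k * (x - X)) + 1 / 4)"
      unfolding c_def[symmetric] s_def[symmetric] q_def[symmetric]
      by (simp add: power2_eq_square algebra_simps)
  qed
  have step: "flow T (A x T) \<le> A x 0" if x: "\<bar>x\<bar> \<le> l" for x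
  proof -
    define c where "c = cos (k * x)"
    have c: "c \<le> 1" "- 1 / 2 - y \<le> c" using cos_lb[OF x] by (simp_all add: c_def)
    have A0: "A x 0 = - \<alpha> * (1 / 2 + c)" and AT: "A x T = - \<alpha> * (1 / 2 + c) + \<alpha> * \<delta> * (c + 1 / 4)"
      by (simp_all add: A0 AT c_def)
    consider "c \<ge> - 1 / 4" | "c < - 1 / 4" "c \<ge> - 1 / 2" | "c < - 1 / 2" by linarith
    then show ?thesis
    proof cases
      case 1
      define V where "V = A x 0"
      define z where "z = \<alpha> * \<delta> * (c + 1 / 4)"
      have z: "0 \<le> z" "z \<le> 2 * \<alpha> * \<delta>"
        using 1 c al de mult_left_mono[of "c + 1 / 4" 2 "\<alpha> * \<delta>"] by (simp_all add: z_def)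
      have V: "- (3 * \<alpha> / 2) \<le> V" "V \<le> - (\<alpha> / 4)"
        using al c 1 mult_left_mono[of c 1 \<alpha>] mult_left_mono[of "- 1 / 4" c \<alpha>] by (simp_all add: V_def A0 algebra_simps)
      have "flow T (V + z) - flow T V \<le> \<Lambda> * z"
        using flow_diff_upper[of V "V + z" T] z T_pos by (simp add: \<Lambda>_def)
      moreover have "\<Lambda> * z \<le> \<Lambda> * (2 * \<alpha> * \<delta>)" using z Lam by (intro mult_left_mono) auto
      ultimately have "flow T (V + z) \<le> V" using g(2)[OF V] de_g by linarith
      moreover have "A x T = V + z" by (simp add: V_def z_def A0 AT)
      ultimately show ?thesis by (simp add: V_def)
    next
      case 2
      have p: "\<alpha> * \<delta> * (c + 1 / 4) \<le> 0" using 2 al de by (intro mult_nonneg_nonpos) auto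
      have p2: "\<alpha> * \<delta> * (c + 1 / 4) \<ge> \<alpha> * \<delta> * (- 1)" using 2 al de by (intro mult_left_mono) auto
      have p3: "\<alpha> * \<delta> \<le> \<alpha> * (1 / 8)" using al de by (intro mult_left_mono) auto
      have p4: "\<alpha> * (1 / 2 + c) \<le> \<alpha> * (1 / 4)" using 2 al by (intro mult_left_mono) auto
      have p5: "\<alpha> * (1 / 2 + c) \<ge> 0" using 2 al by simp
      have "A x T \<le> A x 0" "A x T \<le> 0" "- r < A x T"
        using p p2 p3 p4 p5 al_r al unfolding A0 AT by linarith+
      then have "flow T (A x T) \<le> A x T" using P[of "A x T"] T_pos by (cases "A x T = 0") auto
      then show ?thesis using \<open>A x T \<le> A x 0\<close> by linarith
    next
      case 3
      define v where "v = - c - 1 / 2"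
      have v: "0 < v" "v \<le> y" using 3 c by (simp_all add: v_def)
      have A0': "A x 0 = \<alpha> * v" and AT': "A x T = \<alpha> * (v - \<delta> * (1 / 4 + v))"
        unfolding A0 AT by (simp_all add: v_def algebra_simps)
      show ?thesis
      proof (cases "A x T \<le> 0")
        case True
        then have "flow T (A x T) \<le> flow T 0" using T_pos by (intro flow_mono) auto
        moreover have "0 \<le> A x 0" using v al by (simp add: A0')
        ultimately show ?thesis using T_pos by simp
      next
        case False
        then have "flow T (A x T) \<le> \<Lambda> * A x T" using flow_abs_bounds(2)[of T "A x T"] T_pos by (simp add: \<Lambda>_def)
        also have "\<dots> = \<alpha> * (\<Lambda> * (v - \<delta> * (1 / 4 + v)))" by (simp add: AT')
        also have "\<dots> \<le> \<alpha> * v"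
        proof (rule mult_left_mono)
          have "\<Lambda> * (v - \<delta> * (1 / 4 + v)) \<le> \<Lambda> * (v - \<delta> / 4)"
            using Lam v de by (intro mult_left_mono) (auto simp: algebra_simps)
          also have "\<dots> = (\<Lambda> - 1) * v - \<Lambda> * \<delta> / 4 + v" by (simp add: algebra_simps)
          also have "(\<Lambda> - 1) * v \<le> (\<Lambda> - 1) * y" using v Lam by (intro mult_left_mono) auto
          also have "(\<Lambda> - 1) * y = \<Lambda> * \<delta> / 4 - \<delta> / \<Lambda> / 4" using Lam by (simp add: y_def field_simps)
          finally have "\<Lambda> * (v - \<delta> * (1 / 4 + v)) \<le> v - \<delta> / \<Lambda> / 4" by simp
          moreover have "\<delta> / \<Lambda> / 4 \<ge> 0" using de Lam by simp
          ultimately show "\<Lambda> * (v - \<delta> * (1 / 4 + v)) \<le> v" by linarith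
        qed (use al in simp)
        finally show ?thesis by (simp add: A0')
      qed
    qed
  qed
  have low: "- (2 * \<alpha>) \<le> A x t" if "0 \<le> t" "t \<le> T" for x t
  proof -
    define c where "c = cos (k * x)"
    have "- 1 \<le> c + 1 / 4" using cos_ge_minus_one[of "k * x"] unfolding c_def by linarith
    then have "(t * k\<^sup>2) * (c + 1 / 4) \<ge> (t * k\<^sup>2) * (- 1)" using tk[OF that]
      by (intro mult_left_mono) auto
    moreover have "- \<delta> \<le> (t * k\<^sup>2) * (- 1)" using tk[OF that] by simp
    ultimately have "- \<delta> \<le> (t * k\<^sup>2) * (c + 1 / 4)" by (rule order_trans[rotated])
    then have "\<alpha> * ((t * k\<^sup>2) * (c + 1 / 4)) \<ge> \<alpha> * (- \<delta>)"
      using al by (intro mult_left_mono) auto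
    moreover have "\<alpha> * \<delta> \<le> \<alpha> * (1 / 8)" using al de by (intro mult_left_mono) auto
    moreover have "\<alpha> * (1 / 2 + c) \<le> \<alpha> * (3 / 2)" using al by (intro mult_left_mono) (auto simp: c_def)
    ultimately show ?thesis using al unfolding A_alt c_def[symmetric] by linarith
  qed
  \<comment> \<open>This is the value at the ends at time \<open>T\<close>, the lowest there during
    a period. It is positive because \<open>\<delta> * y\<close> is at most
    \<open>\<delta> / \<Lambda> / 8\<close>, half of the margin of \<open>y\<close> above
    \<open>\<delta> / 4\<close>.\<close>
  define e where "e = \<alpha> * (y - \<delta> * (1 / 4 + y))"
  have e: "e > 0"
  proof -
    have "\<delta> * y = \<delta> * \<delta> * (1 + 1 / \<Lambda>) / 4" by (simp add: y_def)
    also have "\<dots> \<le> \<delta> * (1 / (4 * \<Lambda>)) * 2 / 4"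
      using de_L Lam de by (intro divide_right_mono mult_mono mult_left_mono) (auto simp: field_simps)
    finally have "\<delta> * y \<le> \<delta> / \<Lambda> / 8" using Lam by (simp add: field_simps)
    moreover have "y = \<delta> / 4 + \<delta> / \<Lambda> / 4" using Lam by (simp add: y_def field_simps)
    moreover have "\<delta> / \<Lambda> > 0" using de Lam by simp
    ultimately have "y - \<delta> * (1 / 4 + y) > 0" by (simp add: algebra_simps)
    then show ?thesis using al by (simp add: e_def)
  qed
  have ends: "e \<le> A l t" "e \<le> A (- l) t" if "0 \<le> t" "t \<le> T" for t
  proof -
    have "(t * k\<^sup>2) * (1 / 4 + y) \<le> \<delta> * (1 / 4 + y)" using tk[OF that] y by (intro mult_right_mono) auto
    then have "e \<le> \<alpha> * (y - (t * k\<^sup>2) * (1 / 4 + y))" unfolding e_def using al by (intro mult_left_mono) auto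
    also have "\<dots> = A l t" unfolding A_alt cl by (simp add: algebra_simps)
    finally show "e \<le> A l t" .
    then show "e \<le> A (- l) t" by (simp add: A_def)
  qed
  have mid: "A 0 t \<le> - \<alpha>" if "0 \<le> t" "t \<le> T" for t
  proof -
    have "\<alpha> * (t * k\<^sup>2) \<le> \<alpha> * (1 / 8)" using tk[OF that] de al by (intro mult_left_mono) auto
    then show ?thesis unfolding A_alt using al by (simp add: algebra_simps)
  qed
  show thesis
    by (rule that[of \<alpha> l e A]) (use al l e al_th bar step low ends mid in \<open>auto simp: \<Lambda>_def\<close>)
qed

text \<open>The point is uniformity: the parameters do not depend on the solution, on the centre
  \<open>X\<close>, or on the duration from \<open>s\<close> to \<open>t\<close>, which may span any
  number of periods.\<close>

definition traps :: "real \<Rightarrow> real \<Rightarrow> real \<Rightarrow> real \<Rightarrow> bool" where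
  "traps l \<eta> \<theta> \<theta>' \<longleftrightarrow> (\<forall>w X s t. classical_sol_on F {0<..} w \<longrightarrow> 0 < s \<longrightarrow> s \<le> t \<longrightarrow>
      (\<forall>x. X - l \<le> x \<longrightarrow> x \<le> X + l \<longrightarrow> w x s \<le> - \<theta>) \<longrightarrow>
      (\<forall>r. s \<le> r \<longrightarrow> r \<le> t \<longrightarrow> w (X - l) r \<le> \<eta> \<and> w (X + l) r \<le> \<eta>) \<longrightarrow> w X t \<le> - \<theta>')"

text \<open>The barrier of \<open>trapping_barrier\<close> is repeated in every period. The initial
  level \<open>- \<theta>\<close> lies below its flow at any phase of a period,
  \<open>\<eta>\<close> is what remains of the end height \<open>e\<close>, and
  \<open>\<theta>'\<close> is what remains of the central depth \<open>\<alpha>\<close>, after the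
  largest distortion within a period.\<close>

lemma trapping:
  assumes r: "r > 0" and P: "\<And>a. - r < a \<Longrightarrow> a < 0 \<Longrightarrow> flow T a < a" and "\<theta> > 0"
  obtains l \<eta> \<theta>' where "l > 0" "\<eta> > 0" "\<theta>' > 0"
    "traps l \<eta> \<theta> \<theta>'"
proof -
  obtain \<alpha> l e A where al: "\<alpha> > 0" "l > 0" "e > 0" "exp (L * T) * (2 * \<alpha>) \<le> \<theta>"
    and bar: "\<And>X. barrier_on (X - l) (X + l) (\<lambda>x. A (x - X))"
    and step: "\<And>x. \<bar>x\<bar> \<le> l \<Longrightarrow> flow T (A x T) \<le> A x 0"
    and low: "\<And>x t. \<bar>x\<bar> \<le> l \<Longrightarrow> 0 \<le> t \<Longrightarrow> t \<le> T \<Longrightarrow> - (2 * \<alpha>) \<le> A x t"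
    and ends: "\<And>t. 0 \<le> t \<Longrightarrow> t \<le> T \<Longrightarrow> e \<le> A l t" "\<And>t. 0 \<le> t \<Longrightarrow> t \<le> T \<Longrightarrow> e \<le> A (- l) t"
    and mid: "\<And>t. 0 \<le> t \<Longrightarrow> t \<le> T \<Longrightarrow> A 0 t \<le> - \<alpha>"
    using trapping_barrier[OF assms] by blast
  define \<eta> where "\<eta> = e / exp (L * T)"
  define \<theta>' where "\<theta>' = \<alpha> / exp (L * T)"
  show thesis
  proof (rule that[of l \<eta> \<theta>'])
    show "l > 0" "\<eta> > 0" "\<theta>' > 0" using al by (simp_all add: \<eta>_def \<theta>'_def)
  next
    show "traps l \<eta> \<theta> \<theta>'"
      unfolding traps_def
    proof (intro allI impI)
      fix w X s t
      assume w: "classical_sol_on F {0<..} w" and s: "0 < s" "s \<le> t"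
        and init': "\<forall>x. X - l \<le> x \<longrightarrow> x \<le> X + l \<longrightarrow> w x s \<le> - \<theta>"
        and bd'': "\<forall>r. s \<le> r \<longrightarrow> r \<le> t \<longrightarrow> w (X - l) r \<le> \<eta> \<and> w (X + l) r \<le> \<eta>"
      note init = init'[rule_format] and bd = bd''[rule_format]
      obtain k where k: "real k * T \<le> s" "s < real k * T + T" using period_decomposition[OF T_pos, of s] s by auto
      obtain n where n: "real n * T \<le> t" "t < real n * T + T" using period_decomposition[OF T_pos, of t] s by auto
      have "real k * T < (real n + 1) * T" using k n s by (simp add: algebra_simps)
      then have kn: "k \<le> n" using T_pos by simp
      have bd': "w (X - l) (real n * T + \<sigma>) \<le> flow \<sigma> (A (X - l - X) \<sigma>) \<and> w (X + l) (real n * T + \<sigma>) \<le> flow \<sigma> (A (X + l - X) \<sigma>)"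
        if "0 \<le> \<sigma>" "\<sigma> \<le> T" "s \<le> real n * T + \<sigma>" "real n * T + \<sigma> \<le> t" for n \<sigma>
      proof -
        have "\<eta> \<le> flow \<sigma> a" if "e \<le> a" for a
          using flow_abs_bounds(1)[of \<sigma> e] flow_mono[OF that, of \<sigma>] \<open>0 \<le> \<sigma>\<close> \<open>\<sigma> \<le> T\<close> al by (simp add: \<eta>_def)
        from this[OF ends(1)] this[OF ends(2)] show ?thesis using bd[of "real n * T + \<sigma>"] that by force
      qed
      have "w X (real n * T + (t - real n * T)) \<le> flow (t - real n * T) (A (X - X) (t - real n * T))"
      proof (rule barrier_chain[OF w, where A="\<lambda>_ x. A (x - X)" and \<alpha>="X - l" and \<beta>="X + l" and k=k and s=s and \<tau>=t])
        fix x assume x: "X - l \<le> x" "x \<le> X + l"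
        define \<sigma> where "\<sigma> = s - real k * T"
        have \<sigma>: "0 \<le> \<sigma>" "\<sigma> \<le> T" using k by (simp_all add: \<sigma>_def)
        have "w x s \<le> - \<theta>" using init x by simp
        also have "\<dots> \<le> exp (L * T) * (- (2 * \<alpha>))" using al by simp
        also have "\<dots> \<le> flow \<sigma> (- (2 * \<alpha>))" using flow_abs_bounds(4)[OF \<sigma>, of "- (2 * \<alpha>)"] al by simp
        also have "\<dots> \<le> flow \<sigma> (A (x - X) \<sigma>)" using low[of "x - X" \<sigma>] x \<sigma> by (intro flow_mono) (auto simp: abs_le_iff)
        finally show "w x s \<le> flow (s - real k * T) (A (x - X) (s - real k * T))" by (simp add: \<sigma>_def)
      qed (use bar step bd' s k n kn al in \<open>auto simp: abs_le_iff\<close>)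
      also have "\<dots> \<le> flow (t - real n * T) (- \<alpha>)" using mid n by (intro flow_mono) auto
      also have "\<dots> \<le> - \<theta>'" using flow_abs_bounds(3)[of "t - real n * T" "- \<alpha>"] n al by (simp add: \<theta>'_def)
      finally show "w X t \<le> - \<theta>'" by simp
    qed
  qed
qed

text \<open>A solution that lies below a trajectory on a long interval cannot exceed it much near
  the centre one period later. The majorant adds
  \<open>H = \<delta> * exp ((L + 1) * t) * cosh (x - X)\<close> to the trajectory: \<open>H\<close>
  equals its second space derivative, so one unit of its growth rate pays for diffusion and
  \<open>L\<close> units pay for the reaction.\<close>

lemma local_comparison:
  assumes "B \<ge> 0" "\<epsilon> > 0" "m \<ge> 0"
  shows "\<exists>K\<ge>m. \<forall>w X n \<rho> a. classical_sol_on F {0<..} w \<longrightarrow> (\<forall>x t. t > 0 \<longrightarrow> w x t \<le> M) \<longrightarrow>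
     \<bar>a\<bar> \<le> B \<longrightarrow> 0 \<le> \<rho> \<longrightarrow> \<rho> \<le> T \<longrightarrow> real n * T + \<rho> > 0 \<longrightarrow>
     (\<forall>x. X - K \<le> x \<and> x \<le> X + K \<longrightarrow> w x (real n * T + \<rho>) \<le> flow \<rho> a) \<longrightarrow>
     (\<forall>x. X - m \<le> x \<and> x \<le> X + m \<longrightarrow> w x (real n * T + T) \<le> flow T a + \<epsilon>)"
proof -
  \<comment> \<open>\<open>\<delta>\<close> makes the correction at most \<open>\<epsilon>\<close>
    for \<open>\<bar>x - X\<bar> <= m\<close> at time \<open>T\<close>; \<open>K\<close> is then
    taken so large that at the ends the correction alone exceeds \<open>M\<close> plus the size of
    the trajectory.\<close>
  define \<delta> where "\<delta> = \<epsilon> / (exp ((L + 1) * T) * cosh m)"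
  have de: "\<delta> > 0" using assms by (simp add: \<delta>_def)
  have "filterlim (cosh :: real \<Rightarrow> real) at_top at_top" by (rule cosh_real_at_top)
  then have "eventually (\<lambda>K. cosh K \<ge> (M + exp (L * T) * B) / \<delta>) at_top"
    by (simp add: filterlim_at_top)
  then obtain K where "\<And>K'. K' \<ge> K \<Longrightarrow> cosh K' \<ge> (M + exp (L * T) * B) / \<delta>"
    by (auto simp: eventually_at_top_linorder)
  then obtain K where K: "K \<ge> m" "cosh K \<ge> (M + exp (L * T) * B) / \<delta>"
    using that[of "max K m"] by auto
  have K': "\<delta> * cosh K \<ge> M + exp (L * T) * B" using K(2) de by (simp add: field_simps)
  show ?thesis
  proof (intro exI[of _ K] conjI allI impI)
    show "m \<le> K" by (rule K(1))
    fix w X n \<rho> a x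
    assume w: "classical_sol_on F {0<..} w" and M: "\<forall>x t. t > 0 \<longrightarrow> w x t \<le> M" and a: "\<bar>a\<bar> \<le> B"
      and \<rho>: "0 \<le> \<rho>" "\<rho> \<le> T" "real n * T + \<rho> > 0"
      and init: "\<forall>x. X - K \<le> x \<and> x \<le> X + K \<longrightarrow> w x (real n * T + \<rho>) \<le> flow \<rho> a"
      and x': "X - m \<le> x \<and> x \<le> X + m"
    from x' have x: "X - m \<le> x" "x \<le> X + m" by simp_all
    define H where "H x t = \<delta> * exp ((L + 1) * t) * cosh (x - X)" for x t
    have Hpos: "H x t > 0" for x t using de by (simp add: H_def)
    have "w x (real n * T + T) \<le> flow T a + H x T"
    proof (rule period_comparison[OF w \<rho>(1,3), where G="\<lambda>x t. flow t a + H x t" and \<alpha>="X - K" and \<beta>="X + K" and \<tau>=T])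
      show "continuous_on ({X - K..X + K} \<times> {\<rho>..T}) (\<lambda>(x, t). flow t a + H x t)"
        unfolding case_prod_unfold H_def cosh_def
        by (intro continuous_intros flow_joint_cont) (use \<rho> in auto)
    next
      fix y assume "X - K \<le> y" "y \<le> X + K"
      then show "w y (real n * T + \<rho>) \<le> flow \<rho> a + H y \<rho>" using init[rule_format, of y] Hpos[of y \<rho>] by linarith
    next
      fix \<sigma> assume \<sigma>: "\<rho> \<le> \<sigma>" "\<sigma> \<le> T"
      have "\<bar>flow \<sigma> a\<bar> \<le> exp (L * \<sigma>) * \<bar>a\<bar>" using flow_lip[of \<sigma> a 0] \<sigma> \<rho> by simp
      also have "\<dots> \<le> exp (L * T) * B" using \<sigma> \<rho> a L_pos by (intro mult_mono) auto
      finally have 1: "- (exp (L * T) * B) \<le> flow \<sigma> a" by linarith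
      have "\<delta> * cosh K * 1 \<le> \<delta> * cosh K * exp ((L + 1) * \<sigma>)" using de \<sigma> \<rho> L_pos by (intro mult_left_mono) auto
      then have 2: "M + exp (L * T) * B \<le> \<delta> * exp ((L + 1) * \<sigma>) * cosh K" using K' by (simp add: algebra_simps)
      have "H (X - K) \<sigma> = \<delta> * exp ((L + 1) * \<sigma>) * cosh K" "H (X + K) \<sigma> = \<delta> * exp ((L + 1) * \<sigma>) * cosh K"
        by (simp_all add: H_def)
      moreover have "w (X - K) (real n * T + \<sigma>) \<le> M" "w (X + K) (real n * T + \<sigma>) \<le> M" using M \<rho> \<sigma> by simp_all
      ultimately show "w (X - K) (real n * T + \<sigma>) \<le> flow \<sigma> a + H (X - K) \<sigma> \<and>
           w (X + K) (real n * T + \<sigma>) \<le> flow \<sigma> a + H (X + K) \<sigma>"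
        using 1 2 by linarith
    next
      fix y t assume t: "\<rho> < t" "t \<le> T"
      define S where "S y = \<delta> * exp ((L + 1) * t) * sinh (y - X)" for y
      have HS: "((\<lambda>y. H y t) has_real_derivative S y) (at y)" for y
        unfolding H_def S_def by (auto intro!: derivative_eq_intros)
      have SH: "(S has_real_derivative H y t) (at y)"
        unfolding H_def S_def by (auto intro!: derivative_eq_intros)
      have lim: "((\<lambda>h. (H (y + h) t + H (y - h) t - 2 * H y t) / h\<^sup>2) \<longlongrightarrow> H y t) (at_right 0)"
        by (rule second_difference_tendsto[of 1 y "\<lambda>y. H y t" S]) (use HS SH in auto)
      have "\<forall>\<^sub>F h in at_right 0. (flow t a + H (y + h) t) + (flow t a + H (y - h) t) - 2 * (flow t a + H y t) \<le> (H y t + \<epsilon>') * h\<^sup>2"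
        if "\<epsilon>' > 0" for \<epsilon>'
      proof -
        have "\<forall>\<^sub>F h in at_right 0. (H (y + h) t + H (y - h) t - 2 * H y t) / h\<^sup>2 < H y t + \<epsilon>'"
          by (rule order_tendstoD(2)[OF lim]) (use that in simp)
        moreover have "\<forall>\<^sub>F h in at_right 0. (h::real) > 0" by (auto intro: eventually_at_rightI[of 0 1])
        ultimately show ?thesis
          by eventually_elim (simp add: divide_less_eq less_imp_le)
      qed
      moreover have "((\<lambda>r. flow r a + H y r) has_real_derivative F t (flow t a) + (L + 1) * H y t) (at t)"
        using flow_deriv[of t a] t \<rho> unfolding H_def by (auto intro!: derivative_eq_intros)
      moreover have "F t (flow t a) + (L + 1) * H y t \<ge> H y t + F t (flow t a + H y t)"
        using F_lip[of t "flow t a + H y t" "flow t a"] Hpos[of y t] by (simp add: algebra_simps)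
      ultimately show "\<exists>d c. ((\<lambda>r. flow r a + H y r) has_real_derivative d) (at t) \<and>
        (\<forall>\<epsilon>>0. \<forall>\<^sub>F h in at_right 0. (flow t a + H (y + h) t) + (flow t a + H (y - h) t) - 2 * (flow t a + H y t) \<le> (c + \<epsilon>) * h\<^sup>2) \<and>
        d \<ge> c + F t (flow t a + H y t)"
        by blast
    qed (use x K \<rho> in auto)
    also have "H x T \<le> \<epsilon>"
    proof -
      have "cosh (x - X) \<le> cosh m" using x cosh_real_nonneg_le_iff[of "\<bar>x - X\<bar>" m] assms(3) by (simp add: abs_le_iff)
      then have "H x T \<le> \<delta> * exp ((L + 1) * T) * cosh m" unfolding H_def using de by (intro mult_left_mono) auto
      then show ?thesis by (simp add: \<delta>_def)
    qed
    finally show "w x (real n * T + T) \<le> flow T a + \<epsilon>" by simp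
  qed
qed

text \<open>The time \<open>s'\<close> may depend on the solution, but the waiting time is bounded
  by \<open>N\<close> alone. In \<open>not_unstable\<close> this is applied to \<open>- w\<close>,
  where it says that a small positive plateau grows within bounded time.\<close>

definition sinks :: "real \<Rightarrow> real \<Rightarrow> real \<Rightarrow> real \<Rightarrow> real \<Rightarrow> real \<Rightarrow> bool" where
  "sinks M m \<eta>' \<eta> K N \<longleftrightarrow> (\<forall>w X s. classical_sol_on F {0<..} w \<longrightarrow> (\<forall>x t. t > 0 \<longrightarrow> w x t \<le> M) \<longrightarrow> 0 < s \<longrightarrow>
     (\<forall>x. X - K \<le> x \<longrightarrow> x \<le> X + K \<longrightarrow> w x s \<le> - \<eta>') \<longrightarrow>
     (\<exists>s'. s \<le> s' \<and> s' \<le> s + N \<and> (\<forall>x. X - m \<le> x \<and> x \<le> X + m \<longrightarrow> w x s' \<le> - \<eta>)))"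

text \<open>Iteration of \<open>local_comparison\<close>: one period lowers the level by at least
  \<open>g\<close>, of which half is given up to the localisation error. The number of periods is
  fixed by the levels, so finitely many enlargements of the interval suffice.\<close>

lemma descent:
  assumes r: "r > 0" and P: "\<And>a. - r < a \<Longrightarrow> a < 0 \<Longrightarrow> flow T a < a"
    and eta: "0 < \<eta>'" "0 < \<eta>" "\<eta> < r" and "m \<ge> 0"
  obtains K N where "K \<ge> m" "N \<ge> 0" "sinks M m \<eta>' \<eta> K N"
proof (cases "\<eta> \<le> \<eta>' / exp (L * T)")
  case True
  moreover have "\<eta>' / exp (L * T) \<le> \<eta>'" using eta L_pos T_pos by (simp add: field_simps)
  ultimately have "\<eta> \<le> \<eta>'" by simp
  show thesis
  proof (rule that[of m 0])
    have "\<forall>x. X - m \<le> x \<and> x \<le> X + m \<longrightarrow> w x s \<le> - \<eta>"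
      if "\<forall>x. X - m \<le> x \<longrightarrow> x \<le> X + m \<longrightarrow> w x s \<le> - \<eta>'" for w :: "real \<Rightarrow> real \<Rightarrow> real" and X s :: real
      using that \<open>\<eta> \<le> \<eta>'\<close> by force
    then show "sinks M m \<eta>' \<eta> m 0"
      unfolding sinks_def
      by (metis add_0_right order_refl)
  qed (use \<open>m \<ge> 0\<close> in simp_all)
next
  case False
  \<comment> \<open>Started at \<open>- b\<close>, the flow stays above \<open>- \<eta>'\<close> for
    a whole period, so data below \<open>- \<eta>'\<close> at an arbitrary phase lie below this
    trajectory.\<close>
  define b where "b = \<eta>' / exp (L * T)"
  have b: "b > 0" "b < \<eta>" using False eta by (simp_all add: b_def)
  obtain g where g: "g > 0" "\<And>a. - \<eta> \<le> a \<Longrightarrow> a \<le> - b \<Longrightarrow> flow T a \<le> a - g"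
    using flow_T_gap[OF P, of r "- \<eta>" "- b"] eta b by auto
  define \<epsilon> where "\<epsilon> = g / 2"
  have eps: "\<epsilon> > 0" using g by (simp add: \<epsilon>_def)
  define lev where "lev j = max (- \<eta>) (- b - real j * \<epsilon>)" for j
  have lev: "- \<eta> \<le> lev j" "lev j \<le> - b" for j using b eps by (simp_all add: lev_def)
  have lev_step: "flow T (lev j) + \<epsilon> \<le> lev (Suc j)" for j
  proof -
    have "flow T (lev j) + \<epsilon> \<le> lev j - \<epsilon>" using g(2)[OF lev(1)[of j] lev(2)[of j]] unfolding \<epsilon>_def by linarith
    also have "\<dots> \<le> lev (Suc j)" using eps by (auto simp: lev_def max_def algebra_simps)
    finally show ?thesis .
  qed
  \<comment> \<open>The interval is built backwards: \<open>m\<close> is arbitrary in the induction,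
    since the last of the \<open>Suc j\<close> periods asks for the conclusion of the first
    \<open>j\<close> on the longer interval of half-width \<open>K1\<close>.\<close>
  have it: "\<exists>K\<ge>m. \<forall>w X n. classical_sol_on F {0<..} w \<longrightarrow> (\<forall>x t. t > 0 \<longrightarrow> w x t \<le> M) \<longrightarrow> n > 0 \<longrightarrow>
     (\<forall>x. X - K \<le> x \<and> x \<le> X + K \<longrightarrow> w x (real n * T) \<le> lev 0) \<longrightarrow>
     (\<forall>x. X - m \<le> x \<and> x \<le> X + m \<longrightarrow> w x (real (n + j) * T) \<le> lev j)" if "m \<ge> 0" for j m
    using that
  proof (induction j arbitrary: m)
    case 0
    then show ?case by (intro exI[of _ m]) auto
  next
    case (Suc j)
    obtain K1 where K1: "K1 \<ge> m" and loc: "\<And>w X n \<rho> a. classical_sol_on F {0<..} w \<Longrightarrow> \<forall>x t. t > 0 \<longrightarrow> w x t \<le> M \<Longrightarrow>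
       \<bar>a\<bar> \<le> \<eta> \<Longrightarrow> 0 \<le> \<rho> \<Longrightarrow> \<rho> \<le> T \<Longrightarrow> real n * T + \<rho> > 0 \<Longrightarrow>
       \<forall>x. X - K1 \<le> x \<and> x \<le> X + K1 \<longrightarrow> w x (real n * T + \<rho>) \<le> flow \<rho> a \<Longrightarrow>
       \<forall>x. X - m \<le> x \<and> x \<le> X + m \<longrightarrow> w x (real n * T + T) \<le> flow T a + \<epsilon>"
      using local_comparison[OF less_imp_le[OF eta(2)] eps Suc.prems, where M=M] by (elim exE conjE) (rule that; blast)
    have "K1 \<ge> 0" using K1 Suc.prems by simp
    from Suc.IH[OF this] obtain K where K: "K \<ge> K1" and IH: "\<forall>w X n. classical_sol_on F {0<..} w \<longrightarrow> (\<forall>x t. t > 0 \<longrightarrow> w x t \<le> M) \<longrightarrow> n > 0 \<longrightarrow>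
       (\<forall>x. X - K \<le> x \<and> x \<le> X + K \<longrightarrow> w x (real n * T) \<le> lev 0) \<longrightarrow>
       (\<forall>x. X - K1 \<le> x \<and> x \<le> X + K1 \<longrightarrow> w x (real (n + j) * T) \<le> lev j)"
      by (elim exE conjE)
    show ?case
    proof (intro exI[of _ K] conjI allI impI)
      show "m \<le> K" using K K1 by simp
      fix w X n x
      assume w: "classical_sol_on F {0<..} w" and M: "\<forall>x t. t > 0 \<longrightarrow> w x t \<le> M" and n: "n > 0"
        and i: "\<forall>x. X - K \<le> x \<and> x \<le> X + K \<longrightarrow> w x (real n * T) \<le> lev 0" and x: "X - m \<le> x \<and> x \<le> X + m"
      have h: "\<forall>x. X - K1 \<le> x \<and> x \<le> X + K1 \<longrightarrow> w x (real (n + j) * T) \<le> lev j" using IH[THEN spec, THEN spec, THEN spec, THEN mp, THEN mp, THEN mp, THEN mp, OF w M n i] .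
      have "w x (real (n + j) * T + T) \<le> flow T (lev j) + \<epsilon>"
        by (rule loc[OF w M, where \<rho>=0 and X=X, rule_format])
           (use lev[of j] b n T_pos h x in \<open>auto simp: abs_le_iff\<close>)
      also have "\<dots> \<le> lev (Suc j)" by (rule lev_step)
      finally show "w x (real (n + Suc j) * T) \<le> lev (Suc j)" by (simp add: algebra_simps)
    qed
  qed
  obtain J where J: "real J * \<epsilon> \<ge> \<eta>" 
  proof -
    obtain J where "\<eta> / \<epsilon> < real J" using reals_Archimedean2 by blast
    then have "real J * \<epsilon> \<ge> \<eta>" using eps by (simp add: field_simps)
    then show thesis by (rule that)
  qed
  then have levJ: "lev J = - \<eta>" using b by (simp add: lev_def)
  from it[OF \<open>m \<ge> 0\<close>, of J] obtain K1 where K1: "K1 \<ge> m" and IJ: "\<forall>w X n. classical_sol_on F {0<..} w \<longrightarrow> (\<forall>x t. t > 0 \<longrightarrow> w x t \<le> M) \<longrightarrow> n > 0 \<longrightarrow>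
     (\<forall>x. X - K1 \<le> x \<and> x \<le> X + K1 \<longrightarrow> w x (real n * T) \<le> lev 0) \<longrightarrow>
     (\<forall>x. X - m \<le> x \<and> x \<le> X + m \<longrightarrow> w x (real (n + J) * T) \<le> lev J)"
    by (elim exE conjE)
  \<comment> \<open>One more application carries the data from the time \<open>s\<close> inside a
    period to the next multiple of \<open>T\<close>; hence \<open>Suc J\<close> periods in the
    waiting time.\<close>
  obtain K where K: "K \<ge> K1" and loc: "\<And>w X n \<rho> a. classical_sol_on F {0<..} w \<Longrightarrow> \<forall>x t. t > 0 \<longrightarrow> w x t \<le> M \<Longrightarrow>
       \<bar>a\<bar> \<le> \<eta> \<Longrightarrow> 0 \<le> \<rho> \<Longrightarrow> \<rho> \<le> T \<Longrightarrow> real n * T + \<rho> > 0 \<Longrightarrow>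
       \<forall>x. X - K \<le> x \<and> x \<le> X + K \<longrightarrow> w x (real n * T + \<rho>) \<le> flow \<rho> a \<Longrightarrow>
       \<forall>x. X - K1 \<le> x \<and> x \<le> X + K1 \<longrightarrow> w x (real n * T + T) \<le> flow T a + \<epsilon>"
    using local_comparison[OF less_imp_le[OF eta(2)] eps order_trans[OF \<open>m \<ge> 0\<close> K1], where M=M] by (elim exE conjE) (rule that; blast)
  show thesis
  proof (rule that[of K "real (Suc J) * T"])
    show "m \<le> K" "0 \<le> real (Suc J) * T" using K K1 T_pos by simp_all
  next
    show "sinks M m \<eta>' \<eta> K (real (Suc J) * T)"
      unfolding sinks_def
    proof (intro allI impI)
      fix w X s
      assume w: "classical_sol_on F {0<..} w" and M': "\<forall>x t. t > 0 \<longrightarrow> w x t \<le> M" and s: "0 < s"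
        and i: "\<forall>x. X - K \<le> x \<longrightarrow> x \<le> X + K \<longrightarrow> w x s \<le> - \<eta>'"
      obtain n where n: "real n * T \<le> s" "s < real n * T + T" using period_decomposition[OF T_pos, of s] s by auto
      have fl: "- \<eta>' \<le> flow (s - real n * T) (- b)"
        using flow_abs_bounds(4)[of "s - real n * T" "- b"] n b by (simp add: b_def)
      have st: "\<forall>x. X - K \<le> x \<and> x \<le> X + K \<longrightarrow> w x (real n * T + (s - real n * T)) \<le> flow (s - real n * T) (- b)"
        using i fl by force
      have "\<forall>x. X - K1 \<le> x \<and> x \<le> X + K1 \<longrightarrow> w x (real n * T + T) \<le> flow T (- b) + \<epsilon>"
        by (rule loc[OF w M' _ _ _ _ st]) (use b n s in auto)
      moreover have "flow T (- b) + \<epsilon> \<le> lev 0" using g(2)[of "- b"] b eps by (simp add: lev_def \<epsilon>_def)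
      moreover have "real (Suc n) * T = real n * T + T" by (simp add: distrib_right)
      ultimately have i': "\<forall>x. X - K1 \<le> x \<and> x \<le> X + K1 \<longrightarrow> w x (real (Suc n) * T) \<le> lev 0"
        by (simp only:) (meson order_trans)
      note IJ[THEN spec, THEN spec, THEN spec, THEN mp, THEN mp, THEN mp, THEN mp, OF w M' zero_less_Suc i']
      moreover have "s \<le> real (Suc n + J) * T" "real (Suc n + J) * T \<le> s + real (Suc J) * T"
      proof -
        define q where "q = real J * T"
        have e: "real (Suc n + J) * T = real n * T + T + q" "real (Suc J) * T = T + q"
          by (simp_all add: q_def distrib_right)
        have "q \<ge> 0" using T_pos by (simp add: q_def)
        then show "s \<le> real (Suc n + J) * T" "real (Suc n + J) * T \<le> s + real (Suc J) * T"
          unfolding e using n by linarith+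
      qed
      ultimately show "\<exists>s'. s \<le> s' \<and> s' \<le> s + real (Suc J) * T \<and> (\<forall>x. X - m \<le> x \<and> x \<le> X + m \<longrightarrow> w x s' \<le> - \<eta>)"
        unfolding levJ by blast
    qed
  qed
qed

end

section \<open>Reflection and decay for compactly supported initial values\<close>

lemma has_integral_point_reflect:
  fixes g :: "real \<Rightarrow> real"
  assumes "(g has_integral I) {a..2 * a + N}"
  shows "((\<lambda>x. g (2 * a - x)) has_integral I) {- N..a}"
proof -
  have "((\<lambda>x. g (x + 2 * a)) has_integral I) {a - 2 * a..2 * a + N - 2 * a}"
    using assms by (rule has_integral_shift_real_ivl)
  then have "((\<lambda>x. g (x + 2 * a)) has_integral I) {- a..N}" by simp
  then have "((\<lambda>x. g (- x + 2 * a)) has_integral I) {- N..- (- a)}"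
    by (subst has_integral_reflect_real[where f="\<lambda>x. g (x + 2 * a)"])
  then show ?thesis by simp
qed

lemma continuous_on_of_DERIV:
  fixes g :: "real \<Rightarrow> real"
  assumes "\<And>x. (g has_real_derivative g' x) (at x)"
  shows "continuous_on S g"
  using assms DERIV_isCont continuous_at_imp_continuous_on by blast

text \<open>The left side is the weight of the reflection argument: \<open>exp x\<close> corrected
  so that it vanishes together with its derivative at \<open>- N\<close>. As a square times an
  exponential it is visibly nonnegative.\<close>

lemma exp_weight_eq:
  fixes x N :: real
  shows "exp x - 2 * exp (- N) + exp (- 2 * N - x) = exp x * (1 - exp (- (x + N)))\<^sup>2"
proof -
  have a: "exp x * exp (- (x + N)) = exp (- N)" by (simp flip: exp_add)
  have b: "exp (- (x + N)) * exp (- N) = exp (- 2 * N - x)" by (simp flip: exp_add)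
  have "exp x * (1 - e)\<^sup>2 = exp x - 2 * (exp x * e) + e * (exp x * e)" for e :: real
    by (simp add: power2_eq_square algebra_simps)
  from this[of "exp (- (x + N))"] show ?thesis unfolding a b by simp
qed

lemma max_zero_power_deriv:
  "((\<lambda>z::real. max 0 z ^ Suc (Suc n)) has_real_derivative real (Suc (Suc n)) * max 0 z ^ Suc n) (at z)"
proof (cases z "0::real" rule: linorder_cases)
  case less
  have "((\<lambda>z::real. 0) has_real_derivative real (Suc (Suc n)) * max 0 z ^ Suc n) (at z)"
    using less by simp
  then show ?thesis
    by (rule has_field_derivative_transform_within_open[where S="{..<0}"]) (use less in auto)
next
  case greater
  have "((\<lambda>z::real. z ^ Suc (Suc n)) has_real_derivative real (Suc (Suc n)) * max 0 z ^ Suc n) (at z)"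
    using greater DERIV_pow[of "Suc (Suc n)" z UNIV] by simp
  then show ?thesis
    by (rule has_field_derivative_transform_within_open[where S="{0<..}"]) (use greater in auto)
next
  case equal
  have "((\<lambda>h::real. \<bar>h\<bar> ^ Suc n) \<longlongrightarrow> 0) (at 0)" by (auto intro!: tendsto_eq_intros)
  then have "((\<lambda>h::real. (max 0 (0 + h) ^ Suc (Suc n) - max 0 0 ^ Suc (Suc n)) / h) \<longlongrightarrow> 0) (at 0)"
  proof (rule Lim_null_comparison[rotated], intro always_eventually allI)
    fix h :: real
    show "norm ((max 0 (0 + h) ^ Suc (Suc n) - max 0 0 ^ Suc (Suc n)) / h) \<le> \<bar>h\<bar> ^ Suc n"
      by (cases "h \<le> 0") (auto simp: max_def mult_nonpos_nonneg)
  qed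
  then show ?thesis using equal by (simp add: DERIV_def)
qed

text \<open>Two integrations by parts move the second derivative onto \<open>\<psi>\<close>, with no
  boundary terms by \<open>bd\<close>; the weighted integral then satisfies a linear differential
  inequality. Initial data enter only through the limit of \<open>g\<close>, which suits convergence
  in \<open>L\<^sup>1\<close>. The slack \<open>\<omega>\<close> admits truncated weights, both
  exponential and polynomial.\<close>

lemma weighted_integral_bound:
  fixes y yt yx yxx :: "real \<Rightarrow> real \<Rightarrow> real"
  assumes ab: "\<alpha> \<le> \<beta>" and K: "K \<ge> 0" and \<omega>: "\<omega> \<ge> 0"
    and y_t: "\<And>x t. t > 0 \<Longrightarrow> ((\<lambda>s. y x s) has_real_derivative yt x t) (at t)"
    and y_x: "\<And>x t. t > 0 \<Longrightarrow> ((\<lambda>z. y z t) has_real_derivative yx x t) (at x)"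
    and y_xx: "\<And>x t. t > 0 \<Longrightarrow> ((\<lambda>z. yx z t) has_real_derivative yxx x t) (at x)"
    and yt_cont: "continuous_on (UNIV \<times> {0<..}) (\<lambda>(x, t). yt x t)"
    and y_bd: "\<And>x t. \<alpha> \<le> x \<Longrightarrow> x \<le> \<beta> \<Longrightarrow> t > 0 \<Longrightarrow> 0 \<le> y x t \<and> y x t \<le> M"
    and y_ineq: "\<And>x t. \<alpha> \<le> x \<Longrightarrow> x \<le> \<beta> \<Longrightarrow> t > 0 \<Longrightarrow> yt x t \<le> yxx x t + K * y x t"
    and \<psi>: "\<And>x. (\<psi> has_real_derivative \<psi>' x) (at x)" "\<And>x. (\<psi>' has_real_derivative \<psi>'' x) (at x)"
    and \<psi>_nonneg: "\<And>x. \<alpha> \<le> x \<Longrightarrow> x \<le> \<beta> \<Longrightarrow> 0 \<le> \<psi> x"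
    and \<psi>''_le: "\<And>x. \<alpha> \<le> x \<Longrightarrow> x \<le> \<beta> \<Longrightarrow> \<psi>'' x \<le> \<psi> x + \<omega>"
    and bd: "\<And>t. t > 0 \<Longrightarrow> yx \<alpha> t * \<psi> \<alpha> - y \<alpha> t * \<psi>' \<alpha> = 0" "\<And>t. t > 0 \<Longrightarrow> yx \<beta> t * \<psi> \<beta> - y \<beta> t * \<psi>' \<beta> = 0"
    and init: "(g \<longlongrightarrow> e) (at_right 0)" "\<And>t. t > 0 \<Longrightarrow> integral {\<alpha>..\<beta>} (\<lambda>x. y x t * \<psi> x) \<le> g t"
    and t: "t > 0"
  shows "integral {\<alpha>..\<beta>} (\<lambda>x. y x t * \<psi> x) \<le> exp ((1 + K) * t) * (e + \<omega> * M * (\<beta> - \<alpha>))"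
proof -
  define E where "E t = integral {\<alpha>..\<beta>} (\<lambda>x. y x t * \<psi> x)" for t
  define E' where "E' t = integral {\<alpha>..\<beta>} (\<lambda>x. yt x t * \<psi> x)" for t
  define c where "c = \<omega> * M * (\<beta> - \<alpha>)"
  have \<psi>c: "continuous_on S \<psi>" for S using \<psi>(1) by (rule continuous_on_of_DERIV)
  have yc: "continuous_on S (\<lambda>x. y x t)" if "t > 0" for S t
    using y_x[OF that] by (rule continuous_on_of_DERIV)
  have ytc: "continuous_on S (\<lambda>x. yt x t)" if "t > 0" for S t
  proof -
    have "continuous_on S ((\<lambda>(x, t). yt x t) \<circ> (\<lambda>x. (x, t)))"
      by (intro continuous_on_compose continuous_intros continuous_on_subset[OF yt_cont]) (use that in auto)
    then show ?thesis by (simp add: o_def)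
  qed
  have M: "M \<ge> 0" using y_bd[of \<alpha> 1] ab by auto
  have c0: "c \<ge> 0" using \<omega> M ab by (simp add: c_def)
  have E_deriv: "(E has_real_derivative E' t) (at t)" if "t > 0" for t
  proof -
    have "((\<lambda>t. integral (cbox \<alpha> \<beta>) (\<lambda>x. y x t * \<psi> x)) has_real_derivative integral (cbox \<alpha> \<beta>) (\<lambda>x. yt x t * \<psi> x)) (at t within {0<..})"
    proof (rule leibniz_rule_field_derivative[where f="\<lambda>t x. y x t * \<psi> x" and fx="\<lambda>t x. yt x t * \<psi> x"])
      show "((\<lambda>t. y x t * \<psi> x) has_real_derivative yt x s * \<psi> x) (at s within {0<..})" if "s \<in> {0<..}" for s x
        by (intro DERIV_cmult_right has_field_derivative_at_within[OF y_t]) (use that in simp)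
      show "(\<lambda>x. y x s * \<psi> x) integrable_on cbox \<alpha> \<beta>" if "s \<in> {0<..}" for s
        by (intro integrable_continuous continuous_intros yc \<psi>c) (use that in auto)
      have "continuous_on ({0<..} \<times> cbox \<alpha> \<beta>) ((\<lambda>(x, t). yt x t) \<circ> (\<lambda>(t, x). (x, t)))"
        by (intro continuous_on_compose continuous_on_subset[OF yt_cont])
           (auto intro!: continuous_intros simp: case_prod_unfold)
      moreover have "continuous_on ({0<..} \<times> cbox \<alpha> \<beta>) (\<lambda>z. \<psi> (snd z))"
        by (intro continuous_on_compose2[OF \<psi>c[of UNIV]] continuous_intros) auto
      ultimately show "continuous_on ({0<..} \<times> cbox \<alpha> \<beta>) (\<lambda>(t, x). yt x t * \<psi> x)"
        by (auto simp: case_prod_unfold o_def intro: continuous_on_mult)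
    qed (use that in auto)
    then have "(E has_real_derivative E' t) (at t within {0<..})"
      by (simp add: E_def[abs_def] E'_def)
    then show ?thesis using that at_within_open[of t "{0<..}"] by simp
  qed
  have E'_le: "E' t \<le> (1 + K) * E t + c" if "t > 0" for t
  proof -
    have "((\<lambda>x. yxx x t * \<psi> x - y x t * \<psi>'' x) has_integral
       (yx \<beta> t * \<psi> \<beta> - y \<beta> t * \<psi>' \<beta>) - (yx \<alpha> t * \<psi> \<alpha> - y \<alpha> t * \<psi>' \<alpha>)) {\<alpha>..\<beta>}"
    proof (rule fundamental_theorem_of_calculus[OF ab])
      fix x
      have "((\<lambda>x. yx x t * \<psi> x - y x t * \<psi>' x) has_real_derivative yxx x t * \<psi> x - y x t * \<psi>'' x) (at x)"
        using y_x[OF that, of x] y_xx[OF that, of x] \<psi>(1)[of x] \<psi>(2)[of x]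
        by (auto intro!: derivative_eq_intros simp: algebra_simps)
      then show "((\<lambda>x. yx x t * \<psi> x - y x t * \<psi>' x) has_vector_derivative yxx x t * \<psi> x - y x t * \<psi>'' x) (at x within {\<alpha>..\<beta>})"
        by (simp add: has_real_derivative_iff_has_vector_derivative has_vector_derivative_at_within)
    qed
    then have i1: "((\<lambda>x. yxx x t * \<psi> x - y x t * \<psi>'' x) has_integral 0) {\<alpha>..\<beta>}" using bd[OF that] by simp
    have i2: "((\<lambda>x. yt x t * \<psi> x) has_integral E' t) {\<alpha>..\<beta>}" unfolding E'_def
      by (intro integrable_integral integrable_continuous_real continuous_intros ytc \<psi>c that)
    have i3: "((\<lambda>x. y x t * \<psi> x) has_integral E t) {\<alpha>..\<beta>}" unfolding E_def
      by (intro integrable_integral integrable_continuous_real continuous_intros yc \<psi>c that)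
    have i4: "((\<lambda>x. \<omega> * M) has_integral c) {\<alpha>..\<beta>}"
      using has_integral_const_real[of "\<omega> * M" \<alpha> \<beta>] ab by (simp add: c_def mult.commute)
    have "E' t - 0 \<le> (1 + K) * E t + c"
    proof (rule has_integral_le[OF has_integral_diff[OF i2 i1] has_integral_add[OF has_integral_mult_right[OF i3] i4]])
      fix x assume x: "x \<in> {\<alpha>..\<beta>}"
      note b = y_bd[of x t] y_ineq[of x t] \<psi>_nonneg[of x] \<psi>''_le[of x]
      have "(yt x t - yxx x t) * \<psi> x \<le> (K * y x t) * \<psi> x" using b x that by (intro mult_right_mono) auto
      moreover have "y x t * \<psi>'' x \<le> y x t * (\<psi> x + \<omega>)" using b x that by (intro mult_left_mono) auto
      moreover have "y x t * \<omega> \<le> M * \<omega>" using b x that \<omega> by (intro mult_right_mono) auto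
      ultimately show "yt x t * \<psi> x - (yxx x t * \<psi> x - y x t * \<psi>'' x) \<le> (1 + K) * (y x t * \<psi> x) + \<omega> * M"
        by (simp add: algebra_simps)
    qed
    then show ?thesis by simp
  qed
  \<comment> \<open>Adding the constant \<open>c\<close> makes the inequality homogeneous, since
    \<open>K\<close> and \<open>c\<close> are nonnegative.\<close>
  define Q where "Q t = (E t + c) * exp (- (1 + K) * t)" for t
  have Q_mono: "Q t \<le> Q s" if "0 < s" "s \<le> t" for s
  proof (rule DERIV_nonpos_imp_nonincreasing[OF that(2)])
    fix r assume "s \<le> r" "r \<le> t"
    then have r: "r > 0" using that by simp
    have "(Q has_real_derivative (E' r - (1 + K) * (E r + c)) * exp (- (1 + K) * r)) (at r)"
      unfolding Q_def using E_deriv[OF r] by (auto intro!: derivative_eq_intros simp: algebra_simps)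
    moreover have "E' r - (1 + K) * (E r + c) \<le> 0"
      using E'_le[OF r] mult_nonneg_nonneg[OF K c0] by (simp add: algebra_simps)
    then have "(E' r - (1 + K) * (E r + c)) * exp (- (1 + K) * r) \<le> 0" by (simp add: mult_nonpos_nonneg)
    ultimately show "\<exists>d. (Q has_real_derivative d) (at r) \<and> d \<le> 0" by blast
  qed
  have "Q t \<le> (e + c) * exp (- (1 + K) * 0)"
  proof (rule tendsto_lowerbound)
    show "((\<lambda>s. (g s + c) * exp (- (1 + K) * s)) \<longlongrightarrow> (e + c) * exp (- (1 + K) * 0)) (at_right 0)"
      by (intro tendsto_intros init)
    have "\<forall>\<^sub>F s in at_right 0. 0 < s \<and> s < t" using t by (auto intro: eventually_at_rightI[of 0 t])
    then show "\<forall>\<^sub>F s in at_right 0. Q t \<le> (g s + c) * exp (- (1 + K) * s)"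
    proof eventually_elim
      case (elim s)
      have "Q t \<le> Q s" using Q_mono elim by simp
      also have "\<dots> \<le> (g s + c) * exp (- (1 + K) * s)"
        unfolding Q_def using init(2)[of s] elim by (intro mult_right_mono) (auto simp: E_def)
      finally show ?case .
    qed
  qed auto
  then have "(E t + c) * exp (- (1 + K) * t) \<le> e + c" by (simp add: Q_def)
  then have "(E t + c) * exp (- (1 + K) * t) * exp ((1 + K) * t) \<le> (e + c) * exp ((1 + K) * t)"
    by (rule mult_right_mono) simp
  moreover have "(E t + c) * exp (- (1 + K) * t) * exp ((1 + K) * t) = E t + c"
  proof -
    have "exp (- (1 + K) * t) * exp ((1 + K) * t) = exp (- (1 + K) * t + (1 + K) * t)" by (rule exp_add[symmetric])
    also have "- (1 + K) * t + (1 + K) * t = 0" by (simp add: algebra_simps)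
    finally show ?thesis by (simp add: mult.assoc)
  qed
  ultimately have "E t + c \<le> (e + c) * exp ((1 + K) * t)" by (simp only:)
  then have "E t \<le> exp ((1 + K) * t) * (e + c)" using c0 by (subst mult.commute) linarith
  then show ?thesis unfolding E_def c_def .
qed

section \<open>Solutions with compactly supported initial values: monotonicity outside the support
  and decay\<close>

locale compact_cauchy =
  fixes f :: "real \<Rightarrow> real \<Rightarrow> real" and u0 :: "real \<Rightarrow> real" and u :: "real \<Rightarrow> real \<Rightarrow> real"
    and R M L B :: real
  assumes sol: "classical_sol_on f {0<..} u"
    and u_nonneg: "t > 0 \<Longrightarrow> 0 \<le> u x t" and u_le: "t > 0 \<Longrightarrow> u x t \<le> M"
    and init: "((\<lambda>t. integral {a..b} (\<lambda>x. \<bar>u x t - u0 x\<bar>)) \<longlongrightarrow> 0) (at_right 0)"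
    and f_zero: "f t 0 = 0"
    and f_lip: "0 \<le> a \<Longrightarrow> a \<le> M \<Longrightarrow> 0 \<le> b \<Longrightarrow> b \<le> M \<Longrightarrow> \<bar>f t a - f t b\<bar> \<le> L * \<bar>a - b\<bar>"
    and L_nonneg: "L \<ge> 0" and R_nonneg: "R \<ge> 0"
    and u0_meas: "u0 \<in> borel_measurable lborel"
    and u0_nonneg: "0 \<le> u0 x" and u0_le: "u0 x \<le> B"
    and u0_supp: "R < \<bar>x\<bar> \<Longrightarrow> u0 x = 0"
begin

lemma sol_derivs:
  obtains ut ux uxx where "continuous_on (UNIV \<times> {0<..}) (\<lambda>(x, t). u x t)"
    "continuous_on (UNIV \<times> {0<..}) (\<lambda>(x, t). ut x t)"
    "\<And>x t. t > 0 \<Longrightarrow> ((\<lambda>s. u x s) has_real_derivative ut x t) (at t)"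
    "\<And>x t. t > 0 \<Longrightarrow> ((\<lambda>y. u y t) has_real_derivative ux x t) (at x)"
    "\<And>x t. t > 0 \<Longrightarrow> ((\<lambda>y. ux y t) has_real_derivative uxx x t) (at x)"
    "\<And>x t. t > 0 \<Longrightarrow> ut x t = uxx x t + f t (u x t)"
proof -
  obtain ut ux uxx where c: "continuous_on (UNIV \<times> {0<..}) (\<lambda>(x, t). u x t)"
    "continuous_on (UNIV \<times> {0<..}) (\<lambda>(x, t). ut x t)"
    and *: "\<forall>x. \<forall>t\<in>{0<..}. ((\<lambda>s. u x s) has_real_derivative ut x t) (at t) \<and>
           ((\<lambda>y. u y t) has_real_derivative ux x t) (at x) \<and>
           ((\<lambda>y. ux y t) has_real_derivative uxx x t) (at x) \<and>
           ut x t = uxx x t + f t (u x t)"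
    using sol unfolding classical_sol_on_def by blast
  show thesis by (rule that[OF c, of ux uxx]) (use * in \<open>metis greaterThan_iff\<close>)+
qed

lemma u_cont_x: "t > 0 \<Longrightarrow> continuous_on S (\<lambda>x. u x t)"
  by (rule sol_derivs) (rule continuous_on_of_DERIV)

lemma u0_integrable: "u0 integrable_on {a..b}"
proof (rule measurable_bounded_by_integrable_imp_integrable[where g="\<lambda>_. B"])
  show "u0 \<in> borel_measurable (lebesgue_on {a..b})"
    using u0_meas by (simp add: measurable_completion measurable_restrict_space1)
qed (use u0_nonneg u0_le in auto)

lemma diff_integrable:
  assumes "t > 0" shows "(\<lambda>x. \<bar>u x t - u0 x\<bar>) integrable_on {a..b}"
proof (rule measurable_bounded_by_integrable_imp_integrable[where g="\<lambda>_. M + B"])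
  have "(\<lambda>x. u x t) \<in> borel_measurable borel" using u_cont_x[OF assms] by (rule borel_measurable_continuous_onI)
  then have "(\<lambda>x. u x t) \<in> borel_measurable lborel" by simp
  then have "(\<lambda>x. \<bar>u x t - u0 x\<bar>) \<in> borel_measurable lborel" using u0_meas by measurable
  then show "(\<lambda>x. \<bar>u x t - u0 x\<bar>) \<in> borel_measurable (lebesgue_on {a..b})"
    by (simp add: measurable_completion measurable_restrict_space1)
  show "norm \<bar>u x t - u0 x\<bar> \<le> M + B" if "x \<in> {a..b}" for x
    using u_nonneg[OF assms, of x] u_le[OF assms, of x] u0_nonneg[of x] u0_le[of x] by auto
qed auto

text \<open>Initial values are only attained in \<open>L\<^sup>1\<close>, which suits a weighted integral estimate for the
  cube of the negative part of \<open>u x t - u (2 a - x) t\<close>: the cube is \<open>C\<^sup>2\<close> and vanishes to second order at \<open>x = a\<close>.\<close>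

lemma reflection:
  assumes a: "a > R" and x0: "x0 \<le> a" and t0: "t0 > 0"
  shows "u (2 * a - x0) t0 \<le> u x0 t0"
proof (rule ccontr)
  assume neg: "\<not> ?thesis"
  have M: "M \<ge> 0" using u_nonneg[of 1 0] u_le[of 1 0] by simp
  have a0: "a > 0" using a R_nonneg by simp
  have x0a: "x0 < a" using neg x0 by (cases "x0 = a") auto
  obtain ut ux uxx where uc: "continuous_on (UNIV \<times> {0<..}) (\<lambda>(x, t). u x t)"
    and utc: "continuous_on (UNIV \<times> {0<..}) (\<lambda>(x, t). ut x t)"
    and u_t: "\<And>x t. t > 0 \<Longrightarrow> ((\<lambda>s. u x s) has_real_derivative ut x t) (at t)"
    and u_x: "\<And>x t. t > 0 \<Longrightarrow> ((\<lambda>y. u y t) has_real_derivative ux x t) (at x)"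
    and u_xx: "\<And>x t. t > 0 \<Longrightarrow> ((\<lambda>y. ux y t) has_real_derivative uxx x t) (at x)"
    and u_eq: "\<And>x t. t > 0 \<Longrightarrow> ut x t = uxx x t + f t (u x t)"
    by (rule sol_derivs) blast
  define d where "d x t = u (2 * a - x) t - u x t" for x t
  define dt where "dt x t = ut (2 * a - x) t - ut x t" for x t
  define dx where "dx x t = - ux (2 * a - x) t - ux x t" for x t
  define dxx where "dxx x t = uxx (2 * a - x) t - uxx x t" for x t
  define m where "m x t = max 0 (d x t)" for x t
  have d_t: "((\<lambda>s. d x s) has_real_derivative dt x t) (at t)" if "t > 0" for x t
    unfolding d_def dt_def using u_t[OF that] by (intro DERIV_diff)
  have d_x: "((\<lambda>y. d y t) has_real_derivative dx x t) (at x)" if "t > 0" for x t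
  proof -
    have "((\<lambda>y. u (2 * a - y) t) has_real_derivative ux (2 * a - x) t * (- 1)) (at x)"
      by (rule DERIV_chain'[of "\<lambda>y. 2 * a - y" "- 1" x UNIV "\<lambda>y. u y t"]) (use u_x[OF that] in \<open>auto intro!: derivative_eq_intros\<close>)
    from DERIV_diff[OF this u_x[OF that, of x]] show ?thesis by (simp add: d_def dx_def)
  qed
  have d_xx: "((\<lambda>y. dx y t) has_real_derivative dxx x t) (at x)" if "t > 0" for x t
  proof -
    have "((\<lambda>y. ux (2 * a - y) t) has_real_derivative uxx (2 * a - x) t * (- 1)) (at x)"
      by (rule DERIV_chain'[of "\<lambda>y. 2 * a - y" "- 1" x UNIV "\<lambda>y. ux y t"]) (use u_xx[OF that] in \<open>auto intro!: derivative_eq_intros\<close>)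
    from DERIV_diff[OF DERIV_minus[OF this] u_xx[OF that, of x]] show ?thesis by (simp add: dx_def dxx_def)
  qed
  have m_bd: "0 \<le> m x t" "m x t \<le> M" if "t > 0" for x t
    using u_nonneg[OF that, of x] u_le[OF that, of "2 * a - x"] M by (auto simp: m_def d_def)
  have cube: "((\<lambda>z::real. max 0 z ^ 3) has_real_derivative 3 * max 0 z ^ 2) (at z)" for z
    using max_zero_power_deriv[of 1 z] by (simp add: numeral_2_eq_2 numeral_3_eq_3)
  have square: "((\<lambda>z::real. max 0 z ^ 2) has_real_derivative 2 * max 0 z) (at z)" for z
    using max_zero_power_deriv[of 0 z] by (simp add: numeral_2_eq_2)
  have reflc: "continuous_on (UNIV \<times> {0<..}) (\<lambda>(x, t). v (2 * a - x) t)"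
    if "continuous_on (UNIV \<times> {0<..}) (\<lambda>(x, t). v x t)" for v :: "real \<Rightarrow> real \<Rightarrow> real"
  proof -
    have "continuous_on (UNIV \<times> {0<..}) ((\<lambda>(x, t). v x t) \<circ> (\<lambda>(x, t). (2 * a - x, t)))"
      by (intro continuous_on_compose continuous_on_subset[OF that])
         (auto intro!: continuous_intros simp: case_prod_unfold)
    then show ?thesis by (simp add: o_def case_prod_unfold)
  qed
  have dc: "continuous_on (UNIV \<times> {0<..}) (\<lambda>(x, t). d x t)" "continuous_on (UNIV \<times> {0<..}) (\<lambda>(x, t). dt x t)"
    using continuous_on_diff[OF reflc[OF uc] uc] continuous_on_diff[OF reflc[OF utc] utc]
    by (simp_all add: d_def dt_def case_prod_unfold)
  define y where "y x t = m x t ^ 3" for x t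
  have E_le: "integral {- N..a} (\<lambda>x. y x t0 * (exp x - 2 * exp (- N) + exp (- 2 * N - x)))
      \<le> exp ((1 + 3 * L) * t0) * (2 * exp (- N) * M ^ 3 * (a + N))" if N: "N \<ge> 0" for N
  proof -
    define \<psi> where "\<psi> x = exp x - 2 * exp (- N) + exp (- 2 * N - x)" for x :: real
    define G where "G t = M\<^sup>2 * (exp a + 1) * (integral {- N..a} (\<lambda>x. \<bar>u x t - u0 x\<bar>) + integral {a..2 * a + N} (\<lambda>x. \<bar>u x t - u0 x\<bar>))" for t
    have \<psi>_sq: "\<psi> x = exp x * (1 - exp (- (x + N)))\<^sup>2" for x
      unfolding \<psi>_def by (rule exp_weight_eq)
    have "integral {- N..a} (\<lambda>x. y x t0 * \<psi> x) \<le> exp ((1 + 3 * L) * t0) * (0 + 2 * exp (- N) * M ^ 3 * (a - (- N)))"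
    proof (rule weighted_integral_bound[where yt="\<lambda>x t. 3 * (m x t)\<^sup>2 * dt x t" and yx="\<lambda>x t. 3 * (m x t)\<^sup>2 * dx x t"
          and yxx="\<lambda>x t. 6 * m x t * (dx x t)\<^sup>2 + 3 * (m x t)\<^sup>2 * dxx x t"
          and \<psi>'="\<lambda>x. exp x - exp (- 2 * N - x)" and \<psi>''="\<lambda>x. exp x + exp (- 2 * N - x)" and g=G])
      show "- N \<le> a" "0 \<le> 3 * L" "0 \<le> 2 * exp (- N)" "0 < t0" using N a0 L_nonneg t0 by auto
      show "((\<lambda>s. y x s) has_real_derivative 3 * (m x t)\<^sup>2 * dt x t) (at t)" if "t > 0" for x t
        unfolding y_def m_def by (rule DERIV_chain'[OF d_t[OF that] cube])
      show "((\<lambda>z. y z t) has_real_derivative 3 * (m x t)\<^sup>2 * dx x t) (at x)" if "t > 0" for x t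
        unfolding y_def m_def by (rule DERIV_chain'[OF d_x[OF that] cube])
      show "((\<lambda>z. 3 * (m z t)\<^sup>2 * dx z t) has_real_derivative 6 * m x t * (dx x t)\<^sup>2 + 3 * (m x t)\<^sup>2 * dxx x t) (at x)" if "t > 0" for x t
      proof -
        have "((\<lambda>z. (m z t)\<^sup>2) has_real_derivative 2 * m x t * dx x t) (at x)"
          unfolding m_def by (rule DERIV_chain'[OF d_x[OF that] square])
        from DERIV_mult[OF DERIV_cmult[OF this, of 3] d_xx[OF that, of x]] show ?thesis
          by (rule DERIV_cong) (simp add: power2_eq_square algebra_simps)
      qed
      show "continuous_on (UNIV \<times> {0<..}) (\<lambda>(x, t). 3 * (m x t)\<^sup>2 * dt x t)"
        unfolding m_def case_prod_unfold
        by (intro continuous_intros) (use dc in \<open>simp_all add: case_prod_unfold\<close>)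
      show "0 \<le> y x t \<and> y x t \<le> M ^ 3" if "t > 0" for x t
        unfolding y_def using m_bd[OF that, of x] by (auto intro: power_mono)
      show "3 * (m x t)\<^sup>2 * dt x t \<le> 6 * m x t * (dx x t)\<^sup>2 + 3 * (m x t)\<^sup>2 * dxx x t + 3 * L * y x t" if "t > 0" for x t
      proof -
        define \<Delta> where "\<Delta> = f t (u (2 * a - x) t) - f t (u x t)"
        have "dt x t = dxx x t + \<Delta>"
          unfolding dt_def dxx_def \<Delta>_def using u_eq[OF that] by simp
        then have "3 * (m x t)\<^sup>2 * dt x t = 3 * (m x t)\<^sup>2 * dxx x t + 3 * ((m x t)\<^sup>2 * \<Delta>)" by (simp add: algebra_simps)
        moreover have "(m x t)\<^sup>2 * \<Delta> \<le> (m x t)\<^sup>2 * (L * m x t)"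
        proof (cases "d x t \<le> 0")
          case True then show ?thesis by (simp add: m_def)
        next
          case False
          then have "\<Delta> \<le> L * m x t"
            using f_lip[of "u (2 * a - x) t" "u x t" t] u_nonneg[OF that] u_le[OF that] by (auto simp: m_def d_def \<Delta>_def)
          then show ?thesis by (rule mult_left_mono) simp
        qed
        moreover have "(m x t)\<^sup>2 * (L * m x t) = L * y x t" by (simp add: y_def power2_eq_square power3_eq_cube)
        moreover have "0 \<le> 6 * m x t * (dx x t)\<^sup>2" using m_bd[OF that] by simp
        ultimately show ?thesis by linarith
      qed
      show "(\<psi> has_real_derivative exp x - exp (- 2 * N - x)) (at x)" for x
        unfolding \<psi>_def by (auto intro!: derivative_eq_intros)
      show "((\<lambda>x. exp x - exp (- 2 * N - x)) has_real_derivative exp x + exp (- 2 * N - x)) (at x)" for x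
        by (auto intro!: derivative_eq_intros)
      show "0 \<le> \<psi> x" for x by (simp add: \<psi>_sq)
      show "exp x + exp (- 2 * N - x) \<le> \<psi> x + 2 * exp (- N)" for x by (simp add: \<psi>_def)
      show "3 * (m (- N) t)\<^sup>2 * dx (- N) t * \<psi> (- N) - y (- N) t * (exp (- N) - exp (- 2 * N - - N)) = 0" for t
        by (simp add: \<psi>_sq)
      show "3 * (m a t)\<^sup>2 * dx a t * \<psi> a - y a t * (exp a - exp (- 2 * N - a)) = 0" for t
        by (simp add: y_def m_def d_def)
      have "(G \<longlongrightarrow> M\<^sup>2 * (exp a + 1) * (0 + 0)) (at_right 0)"
        unfolding G_def by (intro tendsto_intros init)
      then show "(G \<longlongrightarrow> 0) (at_right 0)" by simp
      show "integral {- N..a} (\<lambda>x. y x t * \<psi> x) \<le> G t" if "t > 0" for t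
      proof -
        have i1: "((\<lambda>x. \<bar>u x t - u0 x\<bar>) has_integral integral {- N..a} (\<lambda>x. \<bar>u x t - u0 x\<bar>)) {- N..a}"
          by (intro integrable_integral diff_integrable that)
        have i2: "((\<lambda>x. \<bar>u (2 * a - x) t - u0 (2 * a - x)\<bar>) has_integral integral {a..2 * a + N} (\<lambda>x. \<bar>u x t - u0 x\<bar>)) {- N..a}"
          by (rule has_integral_point_reflect) (intro integrable_integral diff_integrable that)
        have i3: "((\<lambda>x. M\<^sup>2 * (exp a + 1) * (\<bar>u x t - u0 x\<bar> + \<bar>u (2 * a - x) t - u0 (2 * a - x)\<bar>)) has_integral G t) {- N..a}"
          unfolding G_def by (rule has_integral_mult_right[OF has_integral_add[OF i1 i2]])
        have "continuous_on {- N..a} (\<lambda>x. m x t)"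
          unfolding m_def by (intro continuous_intros continuous_on_of_DERIV[OF d_x[OF that]])
        then have "(\<lambda>x. y x t * \<psi> x) integrable_on {- N..a}"
          unfolding y_def \<psi>_def by (intro integrable_continuous_real continuous_intros) auto
        then have "((\<lambda>x. y x t * \<psi> x) has_integral integral {- N..a} (\<lambda>x. y x t * \<psi> x)) {- N..a}"
          by (rule integrable_integral)
        then show ?thesis
        proof (rule has_integral_le[OF _ i3])
          fix x assume x: "x \<in> {- N..a}"
          have "exp (- 2 * N - x) \<le> 1" "exp x \<le> exp a" "exp (- N) \<ge> 0" using x N by auto
          then have p1: "\<psi> x \<le> exp a + 1" unfolding \<psi>_def by linarith
          have p2: "0 \<le> \<psi> x" by (simp add: \<psi>_sq)
          have "u0 (2 * a - x) = 0" using x a a0 by (intro u0_supp) auto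
          then have m1: "m x t \<le> \<bar>u x t - u0 x\<bar> + \<bar>u (2 * a - x) t - u0 (2 * a - x)\<bar>"
            using u0_nonneg[of x] unfolding m_def d_def by linarith
          have "y x t * \<psi> x = (m x t)\<^sup>2 * m x t * \<psi> x" by (simp add: y_def power2_eq_square power3_eq_cube)
          also have "\<dots> \<le> M\<^sup>2 * (\<bar>u x t - u0 x\<bar> + \<bar>u (2 * a - x) t - u0 (2 * a - x)\<bar>) * (exp a + 1)"
            by (intro mult_mono power_mono m1 p1 p2 m_bd[OF that] mult_nonneg_nonneg add_nonneg_nonneg) auto
          also have "\<dots> = M\<^sup>2 * (exp a + 1) * (\<bar>u x t - u0 x\<bar> + \<bar>u (2 * a - x) t - u0 (2 * a - x)\<bar>)" by simp
          finally show "y x t * \<psi> x \<le> M\<^sup>2 * (exp a + 1) * (\<bar>u x t - u0 x\<bar> + \<bar>u (2 * a - x) t - u0 (2 * a - x)\<bar>)" .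
        qed
      qed
    qed
    then show ?thesis by (simp add: \<psi>_def add.commute)
  qed
  have dxc: "isCont (\<lambda>x. d x t0) x0" using DERIV_isCont[OF d_x[OF t0]] .
  define q where "q = d x0 t0 / 2"
  have q: "q > 0" using neg by (simp add: q_def d_def)
  have "\<forall>\<^sub>F x in nhds x0. d x t0 > q"
    by (rule order_tendstoD(1)[OF tendsto_at_iff_tendsto_nhds[THEN iffD1, OF dxc[unfolded isCont_def]]])
      (use q in \<open>simp add: q_def\<close>)
  then obtain \<delta> where \<delta>: "\<delta> > 0" "\<And>x. \<bar>x - x0\<bar> < \<delta> \<Longrightarrow> d x t0 > q"
    by (auto simp: eventually_nhds_metric dist_real_def)
  define \<kappa> where "\<kappa> = min (\<delta> / 2) (a - x0)"
  have \<kappa>: "\<kappa> > 0" "\<kappa> < \<delta>" "x0 + \<kappa> \<le> a" using \<delta>(1) x0a by (auto simp: \<kappa>_def min_def)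
  \<comment> \<open>A violation at \<open>(x0, t0)\<close> keeps the weighted integral above a
    positive constant that does not depend on \<open>N\<close>, while the upper bound
    \<open>E_le\<close> is of order \<open>N * exp (- N)\<close>.\<close>
  have low: "\<kappa> * (q ^ 3 * (exp x0 / 4)) \<le> exp ((1 + 3 * L) * t0) * (2 * exp (- N) * M ^ 3 * (a + N))"
    if N: "N \<ge> 0" "N \<ge> 1 - x0" for N
  proof -
    define \<psi> where "\<psi> x = exp x - 2 * exp (- N) + exp (- 2 * N - x)" for x :: real
    have \<psi>_sq: "\<psi> x = exp x * (1 - exp (- (x + N)))\<^sup>2" for x
      unfolding \<psi>_def by (rule exp_weight_eq)
    have mc: "continuous_on S (\<lambda>x. m x t0)" for S
      unfolding m_def by (intro continuous_intros continuous_on_of_DERIV[OF d_x[OF t0]])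
    then have int: "(\<lambda>x. y x t0 * \<psi> x) integrable_on {b..c}" for b c
      unfolding y_def \<psi>_def by (intro integrable_continuous_real continuous_intros) auto
    have "\<kappa> * (q ^ 3 * (exp x0 / 4)) = integral {x0..x0 + \<kappa>} (\<lambda>x. q ^ 3 * (exp x0 / 4))" using \<kappa> by simp
    also have "\<dots> \<le> integral {x0..x0 + \<kappa>} (\<lambda>x. y x t0 * \<psi> x)"
    proof (rule integral_le)
      fix x assume x: "x \<in> {x0..x0 + \<kappa>}"
      have "d x t0 > q" using \<delta>(2)[of x] x \<kappa> by auto
      then have "q ^ 3 \<le> y x t0" unfolding y_def m_def using q by (intro power_mono) auto
      moreover have "exp x0 / 4 \<le> \<psi> x"
      proof -
        have "exp (- (x + N)) \<le> exp (- 1)" using x N by simp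
        also have "\<dots> \<le> 1 / (2::real)" using exp_ge_add_one_self[of 1] by (simp add: exp_minus field_simps)
        finally have "(1 / 2)\<^sup>2 \<le> (1 - exp (- (x + N)))\<^sup>2" by (intro power_mono) auto
        then have "exp x0 * (1 / 2)\<^sup>2 \<le> exp x * (1 - exp (- (x + N)))\<^sup>2" using x by (intro mult_mono) auto
        then show ?thesis by (simp add: \<psi>_sq power2_eq_square)
      qed
      ultimately show "q ^ 3 * (exp x0 / 4) \<le> y x t0 * \<psi> x" by (intro mult_mono) (auto simp: y_def m_bd(1)[OF t0])
    qed (use int in auto)
    also have "\<dots> \<le> integral {- N..a} (\<lambda>x. y x t0 * \<psi> x)"
    proof (rule integral_subset_le)
      show "{x0..x0 + \<kappa>} \<subseteq> {- N..a}" using \<kappa> N by auto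
      show "\<forall>x\<in>{- N..a}. 0 \<le> y x t0 * \<psi> x" using m_bd[OF t0] by (simp add: y_def \<psi>_sq)
    qed (use int in auto)
    also have "\<dots> \<le> exp ((1 + 3 * L) * t0) * (2 * exp (- N) * M ^ 3 * (a + N))"
      using E_le[OF N(1)] by (simp add: \<psi>_def)
    finally show ?thesis .
  qed
  have "((\<lambda>N. exp ((1 + 3 * L) * t0) * (2 * M ^ 3 * (a * exp (- N) + N * exp (- N)))) \<longlongrightarrow>
      exp ((1 + 3 * L) * t0) * (2 * M ^ 3 * (a * 0 + 0))) at_top"
  proof (intro tendsto_intros)
    show e: "((\<lambda>N::real. exp (- N)) \<longlongrightarrow> 0) at_top"
      by (rule filterlim_compose[OF exp_at_bot filterlim_uminus_at_bot_at_top])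
    show "((\<lambda>N::real. N * exp (- N)) \<longlongrightarrow> 0) at_top"
      using tendsto_power_div_exp_0[of 1] by (simp add: exp_minus field_simps)
  qed
  then have lim: "((\<lambda>N. exp ((1 + 3 * L) * t0) * (2 * exp (- N) * M ^ 3 * (a + N))) \<longlongrightarrow> 0) at_top"
    by (simp add: algebra_simps)
  have "\<kappa> * (q ^ 3 * (exp x0 / 4)) \<le> 0"
  proof (rule tendsto_lowerbound[OF lim])
    have "\<forall>\<^sub>F N in at_top. N \<ge> max 0 (1 - x0)" by (rule eventually_ge_at_top)
    then show "\<forall>\<^sub>F N in at_top. \<kappa> * (q ^ 3 * (exp x0 / 4)) \<le> exp ((1 + 3 * L) * t0) * (2 * exp (- N) * M ^ 3 * (a + N))"
      by eventually_elim (rule low, auto)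
  qed simp
  moreover have "\<kappa> * (q ^ 3 * (exp x0 / 4)) > 0" using \<kappa> q by simp
  ultimately show False by simp
qed

lemma u_antimono:
  assumes "R < x" "x \<le> y" "t > 0" shows "u y t \<le> u x t"
proof -
  have "2 * ((x + y) / 2) - x = y" by (simp add: field_simps)
  then show ?thesis using reflection[of "(x + y) / 2" x t] assms by auto
qed

text \<open>Monotonicity turns an integral bound into a pointwise one: \<open>u x t\<close> is a
  lower bound for \<open>u\<close> between \<open>R\<close> and \<open>x\<close>, so
  \<open>(x - R) * u x t\<close> is at most a constant depending on \<open>\<tau>\<close>.\<close>

lemma u_decay:
  assumes "\<delta> > 0"
  obtains X where "\<And>x t. x \<ge> X \<Longrightarrow> 0 < t \<Longrightarrow> t \<le> \<tau> \<Longrightarrow> u x t \<le> \<delta>"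
proof -
  have M: "M \<ge> 0" using u_nonneg[of 1 0] u_le[of 1 0] by simp
  define e where "e = integral {- R..R} u0"
  define C where "C = exp ((1 + L) * \<tau>) * (e + 16 * M)"
  have bound: "(x - R) * (u x t * (9 / 16)) \<le> C" if x: "x > R" "x \<ge> 1" and t: "0 < t" "t \<le> \<tau>" for x t
  proof -
    \<comment> \<open>With this width the weight below is at least 9/16 up to
      \<open>x\<close>.\<close>
    define N where "N = 2 * x"
    have N: "N > 0" "N \<ge> R" "N \<ge> 1" "\<not> N = 0" using x R_nonneg by (simp_all add: N_def)
    obtain ut ux uxx where uc: "continuous_on (UNIV \<times> {0<..}) (\<lambda>(x, t). u x t)"
      and utc: "continuous_on (UNIV \<times> {0<..}) (\<lambda>(x, t). ut x t)"
      and u_t: "\<And>x t. t > 0 \<Longrightarrow> ((\<lambda>s. u x s) has_real_derivative ut x t) (at t)"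
      and u_x: "\<And>x t. t > 0 \<Longrightarrow> ((\<lambda>y. u y t) has_real_derivative ux x t) (at x)"
      and u_xx: "\<And>x t. t > 0 \<Longrightarrow> ((\<lambda>y. ux y t) has_real_derivative uxx x t) (at x)"
      and u_eq: "\<And>x t. t > 0 \<Longrightarrow> ut x t = uxx x t + f t (u x t)"
      by (rule sol_derivs) blast
    define c where "c = 1 / N\<^sup>2"
    have c: "c > 0" "c * N\<^sup>2 = 1" using N by (simp_all add: c_def)
    \<comment> \<open>This weight vanishes with its derivative at both ends, and its second
      derivative is at most \<open>8 * c\<close>. Over length \<open>2 * N\<close> the resulting
      error is \<open>16 * M / N\<close>, bounded although the interval grows with
      \<open>x\<close>.\<close>
    define \<psi> where "\<psi> z = (1 - c * z\<^sup>2)\<^sup>2" for z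
    define \<psi>' where "\<psi>' z = - (4 * c * z * (1 - c * z\<^sup>2))" for z
    define \<psi>'' where "\<psi>'' z = 12 * c * (c * z\<^sup>2) - 4 * c" for z
    have zN: "0 \<le> c * z\<^sup>2" "c * z\<^sup>2 \<le> 1" if "- N \<le> z" "z \<le> N" for z
    proof -
      have "\<bar>z\<bar> \<le> \<bar>N\<bar>" using that N by simp
      then have "z\<^sup>2 \<le> N\<^sup>2" by (simp only: abs_le_square_iff)
      then have "c * z\<^sup>2 \<le> c * N\<^sup>2" using c by (intro mult_left_mono) auto
      then show "0 \<le> c * z\<^sup>2" "c * z\<^sup>2 \<le> 1" using c by simp_all
    qed
    have "integral {- N..N} (\<lambda>z. u z t * \<psi> z) \<le> exp ((1 + L) * t) * (e + 8 * c * M * (N - (- N)))"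
    proof (rule weighted_integral_bound[where yt=ut and yx=ux and yxx=uxx and \<psi>'=\<psi>' and \<psi>''=\<psi>''
          and g="\<lambda>t. integral {- N..N} (\<lambda>x. \<bar>u x t - u0 x\<bar>) + e"])
      show "ut x t \<le> uxx x t + L * u x t" if "t > 0" for x t
        using f_lip[of "u x t" 0 t] u_nonneg[OF that] u_le[OF that] M by (simp add: u_eq[OF that] f_zero abs_le_iff)
      show "(\<psi> has_real_derivative \<psi>' z) (at z)" for z
        unfolding \<psi>_def \<psi>'_def by (auto intro!: derivative_eq_intros simp: algebra_simps power2_eq_square)
      show "(\<psi>' has_real_derivative \<psi>'' z) (at z)" for z
        unfolding \<psi>''_def \<psi>'_def by (auto intro!: derivative_eq_intros simp: algebra_simps power2_eq_square)
      show "0 \<le> \<psi> z" for z by (simp add: \<psi>_def)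
      show "\<psi>'' z \<le> \<psi> z + 8 * c" if "- N \<le> z" "z \<le> N" for z
      proof -
        have "12 * c * (c * z\<^sup>2) \<le> 12 * c * 1" using zN[OF that] c by (intro mult_left_mono) auto
        then have "\<psi>'' z \<le> 8 * c" by (simp add: \<psi>''_def)
        then show ?thesis by (simp add: \<psi>_def add_increasing)
      qed
      show "ux (- N) t * \<psi> (- N) - u (- N) t * \<psi>' (- N) = 0" "ux N t * \<psi> N - u N t * \<psi>' N = 0" for t
        by (simp_all add: \<psi>_def \<psi>'_def c)
      have "((\<lambda>t. integral {- N..N} (\<lambda>x. \<bar>u x t - u0 x\<bar>) + e) \<longlongrightarrow> 0 + e) (at_right 0)"
        by (intro tendsto_intros init)
      then show "((\<lambda>t. integral {- N..N} (\<lambda>x. \<bar>u x t - u0 x\<bar>) + e) \<longlongrightarrow> e) (at_right 0)" by simp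
      show "integral {- N..N} (\<lambda>z. u z t * \<psi> z) \<le> integral {- N..N} (\<lambda>x. \<bar>u x t - u0 x\<bar>) + e" if "t > 0" for t
      proof -
        have "integral {- N..N} (\<lambda>z. u z t * \<psi> z) \<le> integral {- N..N} (\<lambda>z. \<bar>u z t - u0 z\<bar> + u0 z)"
        proof (rule integral_le)
          show "(\<lambda>z. u z t * \<psi> z) integrable_on {- N..N}"
            unfolding \<psi>_def by (intro integrable_continuous_real continuous_intros u_cont_x that)
          show "(\<lambda>z. \<bar>u z t - u0 z\<bar> + u0 z) integrable_on {- N..N}"
            by (intro integrable_add diff_integrable u0_integrable that)
          fix z assume z: "z \<in> {- N..N}"
          have "\<psi> z \<le> 1" unfolding \<psi>_def using zN[of z] z by (simp add: power_le_one)
          then have "u z t * \<psi> z \<le> u z t * 1" using u_nonneg[OF that] by (intro mult_left_mono) auto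
          then show "u z t * \<psi> z \<le> \<bar>u z t - u0 z\<bar> + u0 z" by linarith
        qed
        also have "\<dots> = integral {- N..N} (\<lambda>z. \<bar>u z t - u0 z\<bar>) + integral {- N..N} u0"
          by (rule integral_add[OF diff_integrable[OF that] u0_integrable])
        also have "integral {- N..N} u0 = e"
        proof -
          have "integral {- N..N} u0 = integral {- N..N} (\<lambda>z. if z \<in> {- R..R} then u0 z else 0)"
            by (rule integral_cong) (use u0_supp in \<open>auto simp: abs_if split: if_splits\<close>)
          also have "\<dots> = integral ({- R..R} \<inter> {- N..N}) u0" by (rule Henstock_Kurzweil_Integration.integral_restrict_Int)
          also have "{- R..R} \<inter> {- N..N} = {- R..R}" using N by auto
          finally show ?thesis by (simp add: e_def)
        qed
        finally show ?thesis .
      qed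
    qed (use N c L_nonneg u_nonneg u_le u_t u_x u_xx utc t in auto)
    also have "\<dots> \<le> C"
    proof -
      have "0 \<le> e" unfolding e_def by (intro integral_nonneg u0_integrable) (use u0_nonneg in auto)
      moreover have "8 * c * M * (N - (- N)) = 16 * M / N" using N by (simp add: c_def power2_eq_square)
      moreover have "16 * M / N \<le> 16 * M / 1" using N M by (intro divide_left_mono) auto
      moreover have "exp ((1 + L) * t) \<le> exp ((1 + L) * \<tau>)" using t L_nonneg by simp
      ultimately show ?thesis unfolding C_def using M N by (intro mult_mono) auto
    qed
    finally have le: "integral {- N..N} (\<lambda>z. u z t * \<psi> z) \<le> C" .
    have int: "(\<lambda>z. u z t * \<psi> z) integrable_on {b..c}" for b c
      unfolding \<psi>_def by (intro integrable_continuous_real continuous_intros u_cont_x t)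
    have "(x - R) * (u x t * (9 / 16)) = integral {R..x} (\<lambda>z. u x t * (9 / 16))" using x by simp
    \<comment> \<open>The open interval is taken because \<open>u_antimono\<close> excludes the
      point \<open>R\<close> itself.\<close>
    also have "\<dots> = integral {R<..<x} (\<lambda>z. u x t * (9 / 16))" by (rule integral_open_interval_real)
    also have "\<dots> \<le> integral {R<..<x} (\<lambda>z. u z t * \<psi> z)"
    proof (rule integral_le)
      show "(\<lambda>z. u z t * \<psi> z) integrable_on {R<..<x}" by (rule integrable_on_Icc_iff_Ioo[THEN iffD1, OF int])
      fix z assume z: "z \<in> {R<..<x}"
      have "z\<^sup>2 \<le> x\<^sup>2" using z R_nonneg by (intro power_mono) auto
      then have "c * z\<^sup>2 \<le> 1 / 4" using x by (simp add: c_def N_def power_mult_distrib divide_le_eq)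
      then have "(3 / 4)\<^sup>2 \<le> \<psi> z" unfolding \<psi>_def by (intro power_mono) auto
      then have "9 / 16 \<le> \<psi> z" by (simp add: power2_eq_square)
      then show "u x t * (9 / 16) \<le> u z t * \<psi> z"
        using u_antimono[of z x t] z t u_nonneg[of t] by (intro mult_mono) auto
    qed (rule integrable_on_Icc_iff_Ioo[THEN iffD1, OF integrable_const_ivl])
    also have "\<dots> = integral {R..x} (\<lambda>z. u z t * \<psi> z)" by (rule integral_open_interval_real[symmetric])
    also have "\<dots> \<le> integral {- N..N} (\<lambda>z. u z t * \<psi> z)"
    proof (rule integral_subset_le)
      show "{R..x} \<subseteq> {- N..N}" using x R_nonneg by (auto simp: N_def)
      show "\<forall>z\<in>{- N..N}. 0 \<le> u z t * \<psi> z" using u_nonneg t by (simp add: \<psi>_def)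
    qed (use int in auto)
    finally show ?thesis using le by linarith
  qed
  show thesis
  proof (rule that[of "max 1 (R + 1 + 2 * \<bar>C\<bar> / \<delta>)"])
    fix x t assume x: "x \<ge> max 1 (R + 1 + 2 * \<bar>C\<bar> / \<delta>)" and t: "0 < t" "t \<le> \<tau>"
    have xR: "x - R \<ge> 1 + 2 * \<bar>C\<bar> / \<delta>" using x by simp
    have C0: "2 * \<bar>C\<bar> / \<delta> \<ge> 0" using assms by simp
    have "x > R" "x \<ge> 1" using x xR C0 by linarith+
    from bound[OF this t] have b: "(x - R) * u x t \<le> 16 / 9 * C" by (simp add: algebra_simps)
    show "u x t \<le> \<delta>"
    proof (rule ccontr)
      assume "\<not> u x t \<le> \<delta>"
      then have "(1 + 2 * \<bar>C\<bar> / \<delta>) * \<delta> \<le> (x - R) * u x t"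
        using xR C0 assms \<open>x > R\<close> by (intro mult_mono) auto
      moreover have "(1 + 2 * \<bar>C\<bar> / \<delta>) * \<delta> = \<delta> + 2 * \<bar>C\<bar>" using assms by (simp add: field_simps)
      ultimately show False using b assms by linarith
    qed
  qed
qed

lemma mirror: "compact_cauchy f (\<lambda>x. u0 (- x)) (\<lambda>x t. u (- x) t) R M L B"
proof
  obtain ut ux uxx where c: "continuous_on (UNIV \<times> {0<..}) (\<lambda>(x, t). u x t)"
    "continuous_on (UNIV \<times> {0<..}) (\<lambda>(x, t). ut x t)" "continuous_on (UNIV \<times> {0<..}) (\<lambda>(x, t). ux x t)"
    "continuous_on (UNIV \<times> {0<..}) (\<lambda>(x, t). uxx x t)"
    and *: "\<forall>x. \<forall>t\<in>{0<..}. ((\<lambda>s. u x s) has_real_derivative ut x t) (at t) \<and>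
           ((\<lambda>y. u y t) has_real_derivative ux x t) (at x) \<and>
           ((\<lambda>y. ux y t) has_real_derivative uxx x t) (at x) \<and>
           ut x t = uxx x t + f t (u x t)"
    using sol unfolding classical_sol_on_def by blast
  have refl: "continuous_on (UNIV \<times> {0<..}) (\<lambda>(x, t). v (- x) t)"
    if "continuous_on (UNIV \<times> {0<..}) (\<lambda>(x, t). v x t)" for v :: "real \<Rightarrow> real \<Rightarrow> real"
  proof -
    have "continuous_on (UNIV \<times> {0<..}) ((\<lambda>(x, t). v x t) \<circ> (\<lambda>(x, t). (- x, t)))"
      by (intro continuous_on_compose continuous_on_subset[OF that])
         (auto intro!: continuous_intros simp: case_prod_unfold)
    then show ?thesis by (simp add: o_def case_prod_unfold)
  qed
  have chain: "((\<lambda>y. v (- y)) has_real_derivative - v') (at x)"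
    if "(v has_real_derivative v') (at (- x))" for v v' and x :: real
    using that DERIV_mirror by blast
  show "classical_sol_on f {0<..} (\<lambda>x t. u (- x) t)"
    unfolding classical_sol_on_def
  proof (rule exI[of _ "\<lambda>x t. ut (- x) t"], rule exI[of _ "\<lambda>x t. - ux (- x) t"], rule exI[of _ "\<lambda>x t. uxx (- x) t"],
      intro conjI allI ballI)
    show "continuous_on (UNIV \<times> {0<..}) (\<lambda>(x, t). - ux (- x) t)"
      using continuous_on_minus[OF refl[OF c(3)]] by (simp add: case_prod_unfold)
    fix x t :: real assume "t \<in> {0<..}"
    then have "((\<lambda>s. u (- x) s) has_real_derivative ut (- x) t) (at t)"
      "((\<lambda>y. u y t) has_real_derivative ux (- x) t) (at (- x))"
      "((\<lambda>y. ux y t) has_real_derivative uxx (- x) t) (at (- x))"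
      and e: "ut (- x) t = uxx (- x) t + f t (u (- x) t)" using * by blast+
    then show "((\<lambda>s. u (- x) s) has_real_derivative ut (- x) t) (at t)"
      "((\<lambda>y. u (- y) t) has_real_derivative - ux (- x) t) (at x)"
      "((\<lambda>y. - ux (- y) t) has_real_derivative uxx (- x) t) (at x)"
      using chain[of "\<lambda>y. u y t"] DERIV_minus[OF chain[of "\<lambda>y. ux y t"]] by fastforce+
    show "ut (- x) t = uxx (- x) t + f t (u (- x) t)" by (rule e)
  qed (use refl[OF c(1)] refl[OF c(2)] refl[OF c(4)] in auto)
  show "((\<lambda>t. integral {a..b} (\<lambda>x. \<bar>u (- x) t - u0 (- x)\<bar>)) \<longlongrightarrow> 0) (at_right 0)" for a b
    using init[of "- b" "- a"]
      Henstock_Kurzweil_Integration.integral_reflect_real[of "- a" "- b" "\<lambda>x. \<bar>u x t - u0 x\<bar>" for t] by simp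
  show "(\<lambda>x. u0 (- x)) \<in> borel_measurable lborel" using u0_meas by simp
qed (use u_nonneg u_le f_zero f_lip L_nonneg R_nonneg u0_nonneg u0_le u0_supp in auto)

text \<open>Monotonicity on both sides of the support, in a form that extends an upper bound from a
  bounded interval to the whole line.\<close>

lemma u_le_off_centre:
  assumes r: "R < r" and t: "t > 0" and x: "r \<le> \<bar>x\<bar>"
  shows "u x t \<le> u r t \<or> u x t \<le> u (- r) t"
proof -
  interpret m: compact_cauchy f "\<lambda>x. u0 (- x)" "\<lambda>x t. u (- x) t" R M L B by (rule mirror)
  show ?thesis using u_antimono[OF r _ t, of x] m.u_antimono[OF r _ t, of "- x"] x by (cases "x \<ge> 0") auto
qed

lemma u_decay_abs:
  assumes "\<delta> > 0"
  obtains X where "\<And>x t. \<bar>x\<bar> \<ge> X \<Longrightarrow> 0 < t \<Longrightarrow> t \<le> \<tau> \<Longrightarrow> u x t \<le> \<delta>"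
proof -
  interpret m: compact_cauchy f "\<lambda>x. u0 (- x)" "\<lambda>x t. u (- x) t" R M L B by (rule mirror)
  obtain X where X: "\<And>x t. x \<ge> X \<Longrightarrow> 0 < t \<Longrightarrow> t \<le> \<tau> \<Longrightarrow> u x t \<le> \<delta>" using u_decay[OF assms] by blast
  obtain Y where Y: "\<And>x t. x \<ge> Y \<Longrightarrow> 0 < t \<Longrightarrow> t \<le> \<tau> \<Longrightarrow> u (- x) t \<le> \<delta>" using m.u_decay[OF assms] by blast
  show thesis
  proof (rule that[of "max X Y"])
    fix x t assume "max X Y \<le> \<bar>x\<bar>" "0 < t" "t \<le> \<tau>"
    then show "u x t \<le> \<delta>" using X[of x t] Y[of "- x" t] by (cases "x \<ge> 0") auto
  qed
qed

end

section \<open>Solutions that return to zero\<close>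

context c11_field
begin

text \<open>If \<open>w\<close> solves the equation of \<open>F\<close>, then \<open>- w\<close>
  solves that of the reflected field; results below 0 thereby become results above 0.\<close>

lemma reflected_field: "c11_field (\<lambda>t w. - F t (- w)) (\<lambda>t w. Fw t (- w)) L L2 T"
proof
  show "continuous_on UNIV (\<lambda>t. - F t (- w))" for w using F_cont by (rule continuous_on_minus)
  show "((\<lambda>w. - F t (- w)) has_real_derivative Fw t (- w)) (at w)" for t w
  proof -
    have "((\<lambda>w. F t (- w)) has_real_derivative - Fw t (- w)) (at w)"
      using F_deriv[of t "- w"] DERIV_mirror by blast
    from DERIV_minus[OF this] show ?thesis by simp
  qed
  show "\<bar>Fw t (- a) - Fw t (- b)\<bar> \<le> L2 * \<bar>a - b\<bar>" for t a b using Fw_lip[of t "- a" "- b"] by (simp add: abs_minus_commute)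
qed (use T_pos L_pos L2_nonneg F_zero F_per Fw_cont Fw_bound in auto)

lemma reflected_flow:
  assumes "t \<ge> 0" shows "c11_field.flow (\<lambda>t w. - F t (- w)) t a = - flow t (- a)"
proof -
  interpret m: c11_field "\<lambda>t w. - F t (- w)" "\<lambda>t w. Fw t (- w)" L L2 T by (rule reflected_field)
  show ?thesis
    using m.flow_unique[of "\<lambda>t. - flow t (- a)" t] DERIV_minus[OF flow_deriv_within[of _ "- a"]] assms by simp
qed

lemma reflected_sol:
  assumes "classical_sol_on F S w" shows "classical_sol_on (\<lambda>t w. - F t (- w)) S (\<lambda>x t. - w x t)"
proof -
  obtain wt wx wxx where c: "continuous_on (UNIV \<times> S) (\<lambda>(x, t). w x t)"
    "continuous_on (UNIV \<times> S) (\<lambda>(x, t). wt x t)" "continuous_on (UNIV \<times> S) (\<lambda>(x, t). wx x t)"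
    "continuous_on (UNIV \<times> S) (\<lambda>(x, t). wxx x t)"
    and *: "\<forall>x. \<forall>t\<in>S. ((\<lambda>s. w x s) has_real_derivative wt x t) (at t) \<and>
           ((\<lambda>y. w y t) has_real_derivative wx x t) (at x) \<and>
           ((\<lambda>y. wx y t) has_real_derivative wxx x t) (at x) \<and>
           wt x t = wxx x t + F t (w x t)"
    using assms unfolding classical_sol_on_def by blast
  show ?thesis
    unfolding classical_sol_on_def
  proof (rule exI[of _ "\<lambda>x t. - wt x t"], rule exI[of _ "\<lambda>x t. - wx x t"], rule exI[of _ "\<lambda>x t. - wxx x t"],
      intro conjI allI ballI)
    fix x t assume "t \<in> S"
    then have "((\<lambda>s. w x s) has_real_derivative wt x t) (at t)"
      "((\<lambda>y. w y t) has_real_derivative wx x t) (at x)"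
      "((\<lambda>y. wx y t) has_real_derivative wxx x t) (at x)" "wt x t = wxx x t + F t (w x t)"
      using * by blast+
    from DERIV_minus[OF this(1)] DERIV_minus[OF this(2)] DERIV_minus[OF this(3)] this(4)
    show "((\<lambda>s. - w x s) has_real_derivative - wt x t) (at t)"
      "((\<lambda>y. - w y t) has_real_derivative - wx x t) (at x)"
      "((\<lambda>y. - wx y t) has_real_derivative - wxx x t) (at x)"
      "- wt x t = - wxx x t + - F t (- (- w x t))"
      by simp_all
  qed (use c[THEN continuous_on_minus] in \<open>simp_all add: case_prod_unfold\<close>)
qed

end

text \<open>The properties of \<open>u - p\<close> from which the contradictions are drawn. In
  \<open>w_far\<close> the radius may grow with \<open>\<tau>\<close>; \<open>w_zero\<close> covers
  a window of times around each \<open>real (k j) * T\<close>, which \<open>not_unstable\<close>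
  needs.\<close>

locale zero_limit = c11_field +
  fixes w :: "real \<Rightarrow> real \<Rightarrow> real" and M R \<theta> :: real and k :: "nat \<Rightarrow> nat"
  assumes w_sol: "classical_sol_on F {0<..} w"
    and w_abs: "t > 0 \<Longrightarrow> \<bar>w x t\<bar> \<le> M"
    and w_antimono: "R < x \<Longrightarrow> x \<le> y \<Longrightarrow> t > 0 \<Longrightarrow> w y t \<le> w x t"
    and w_off_centre: "R < r \<Longrightarrow> t > 0 \<Longrightarrow> r \<le> \<bar>x\<bar> \<Longrightarrow> w x t \<le> w r t \<or> w x t \<le> w (- r) t"
    and \<theta>_pos: "\<theta> > 0"
    and w_far: "\<exists>X. \<forall>x t. X \<le> \<bar>x\<bar> \<and> 0 < t \<and> t \<le> \<tau> \<longrightarrow> w x t \<le> - \<theta>"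
    and k_top: "filterlim k at_top sequentially"
    and w_zero: "e > 0 \<Longrightarrow> \<forall>\<^sub>F j in sequentially. \<forall>x t. \<bar>x\<bar> \<le> A \<and> \<bar>t\<bar> \<le> A \<longrightarrow> \<bar>w x (t + real (k j) * T)\<bar> < e"
begin

lemma w_far_obtain:
  obtains X where "X \<ge> B" "\<And>x t. X \<le> \<bar>x\<bar> \<Longrightarrow> 0 < t \<Longrightarrow> t \<le> \<tau> \<Longrightarrow> w x t \<le> - \<theta>"
proof -
  obtain X where X: "\<forall>x t. X \<le> \<bar>x\<bar> \<and> 0 < t \<and> t \<le> \<tau> \<longrightarrow> w x t \<le> - \<theta>" using w_far by blast
  show thesis by (rule that[of "max B X"]) (use X in auto)
qed

lemma w_zero_obtain:
  assumes "e > 0"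
  obtains n where "n \<ge> n0" "n > 0" "\<And>x t. \<bar>x\<bar> \<le> A \<Longrightarrow> \<bar>t\<bar> \<le> A \<Longrightarrow> \<bar>w x (t + real n * T)\<bar> < e"
proof -
  have "\<forall>\<^sub>F j in sequentially. k j \<ge> max n0 1" using k_top unfolding filterlim_at_top by blast
  with w_zero[OF assms, of A] have "\<forall>\<^sub>F j in sequentially. (\<forall>x t. \<bar>x\<bar> \<le> A \<and> \<bar>t\<bar> \<le> A \<longrightarrow> \<bar>w x (t + real (k j) * T)\<bar> < e) \<and> k j \<ge> max n0 1"
    by (rule eventually_conj)
  then obtain j where j: "\<forall>x t. \<bar>x\<bar> \<le> A \<and> \<bar>t\<bar> \<le> A \<longrightarrow> \<bar>w x (t + real (k j) * T)\<bar> < e" "k j \<ge> max n0 1"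
    using eventually_happens'[OF sequentially_bot] by blast
  show thesis by (rule that[of "k j"]) (use j in auto)
qed

text \<open>Locally uniform convergence gives the bound up to \<open>\<bar>R\<bar> + 1\<close>, and
  \<open>w_off_centre\<close> carries it from the two end points to the rest of the line.\<close>

lemma w_le_everywhere:
  assumes "e > 0"
  obtains n where "n \<ge> n0" "n > 0" "\<And>x. w x (real n * T) \<le> e"
proof -
  obtain n where n: "n \<ge> n0" "n > 0" and le: "\<And>x t. \<bar>x\<bar> \<le> \<bar>R\<bar> + 1 \<Longrightarrow> \<bar>t\<bar> \<le> \<bar>R\<bar> + 1 \<Longrightarrow> \<bar>w x (t + real n * T)\<bar> < e"
    using w_zero_obtain[OF assms] by blast
  have nT: "real n * T > 0" using n T_pos by simp
  have in_centre: "w x (real n * T) \<le> e" if "\<bar>x\<bar> \<le> \<bar>R\<bar> + 1" for x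
    using le[OF that, of 0] by simp
  have "w x (real n * T) \<le> e" for x
  proof (cases "\<bar>x\<bar> \<le> \<bar>R\<bar> + 1")
    case False
    then have "w x (real n * T) \<le> w (\<bar>R\<bar> + 1) (real n * T) \<or> w x (real n * T) \<le> w (- (\<bar>R\<bar> + 1)) (real n * T)"
      by (intro w_off_centre nT) auto
    then show ?thesis using in_centre[of "\<bar>R\<bar> + 1"] in_centre[of "- (\<bar>R\<bar> + 1)"] by auto
  qed (rule in_centre)
  then show thesis using n that by blast
qed

text \<open>If one period never increases values near \<open>0\<close>, then the flow applied to the spreading Gaussian below,
  which satisfies \<open>D\<^sub>t = D\<^sub>x\<^sub>x + D\<^sub>x\<^sup>2 / D\<close>, pushes \<open>w\<close> below \<open>0\<close>.\<close>

lemma not_nonincreasing: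
  assumes r: "r > 0" and P: "\<And>a. \<bar>a\<bar> < r \<Longrightarrow> flow T a \<le> a"
  shows False
proof -
  define \<Lambda> where "\<Lambda> = exp (L * T)"
  have Lam: "\<Lambda> > 1" using L_pos T_pos by (simp add: \<Lambda>_def)
  \<comment> \<open>The barrier will take values between \<open>- \<delta>\<close> and
    \<open>3 * \<delta>\<close>. The bounds keep its flow above the far level
    \<open>- \<theta>\<close>, keep its values in the range of \<open>P\<close>, and give
    \<open>Cq * \<beta> <= 1\<close> for \<open>\<beta> = 4 * \<delta>\<close>.\<close>
  define \<delta> where "\<delta> = min (\<theta> / \<Lambda>) (min (r / 4) (1 / (4 * (Cq + 1))))"
  have de: "\<delta> > 0" using \<theta>_pos r Lam Cq_nonneg by (simp add: \<delta>_def)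
  have "\<delta> \<le> \<theta> / \<Lambda>" by (simp add: \<delta>_def)
  then have de_th: "\<Lambda> * \<delta> \<le> \<theta>" using Lam by (simp add: field_simps)
  have de_r: "3 * \<delta> < r" using r by (auto simp: \<delta>_def min_def)
  define \<beta> where "\<beta> = 4 * \<delta>"
  have be: "\<beta> > 0" using de by (simp add: \<beta>_def)
  have be_C: "Cq * \<beta> \<le> 1"
  proof -
    have "\<delta> \<le> 1 / (4 * (Cq + 1))" by (simp add: \<delta>_def)
    then have "Cq * (4 * \<delta>) \<le> (Cq + 1) * (4 * (1 / (4 * (Cq + 1))))"
      using Cq_nonneg de by (intro mult_mono) auto
    also have "\<dots> = 1" using Cq_nonneg by simp
    finally show ?thesis by (simp add: \<beta>_def)
  qed
  obtain m where m: "m > 0" and init: "\<And>x. w x (real m * T) \<le> \<delta>"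
    by (rule w_le_everywhere[OF de]) (rule that; assumption)
  obtain X where X: "X \<ge> 1" "\<And>x t. X \<le> \<bar>x\<bar> \<Longrightarrow> 0 < t \<Longrightarrow> t \<le> real m * T \<Longrightarrow> w x t \<le> - \<theta>"
    by (rule w_far_obtain[of 1 "real m * T"]) (rule that; assumption)
  define \<sigma> where "\<sigma> = X\<^sup>2"
  have \<sigma>: "\<sigma> > 0" using X by (simp add: \<sigma>_def)
  \<comment> \<open>The square of \<open>D\<close> is a multiple of the heat kernel at time
    \<open>\<sigma> + t\<close>, which is where its equation comes from. As
    \<open>D <= \<beta>\<close>, the term \<open>Cq * D\<^sub>x\<^sup>2\<close> is dominated by
    \<open>D\<^sub>x\<^sup>2 / D\<close>. The choice of \<open>\<sigma>\<close> makes the Gaussian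
    factor at least 1/2 for \<open>\<bar>x\<bar> <= X\<close> initially.\<close>
  define D where "D x t = \<beta> * exp (- ln ((\<sigma> + t) / \<sigma>) / 4 - x\<^sup>2 / (8 * (\<sigma> + t)))" for x t
  have D_pos: "D x t > 0" for x t using be by (simp add: D_def)
  have D_le: "D x t \<le> \<beta> * exp (- ln ((\<sigma> + t) / \<sigma>) / 4)" if "t \<ge> 0" for x t
    unfolding D_def using be that \<sigma> by (intro mult_left_mono) auto
  have D_be: "D x t \<le> \<beta>" if "t \<ge> 0" for x t
  proof -
    have "ln ((\<sigma> + t) / \<sigma>) \<ge> 0" using that \<sigma> by simp
    then have "\<beta> * exp (- ln ((\<sigma> + t) / \<sigma>) / 4) \<le> \<beta> * 1" using be by (intro mult_left_mono) auto
    then show ?thesis using D_le[OF that, of x] by simp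
  qed
  define A where "A n x s = - \<delta> + D x (real n * T - real m * T + s)" for n x s
  have A_bounds: "- \<delta> < A n x s" "A n x s \<le> 3 * \<delta>" if "m \<le> n" "0 \<le> s" for n x s
  proof -
    have "real m * T \<le> real n * T" using that T_pos by simp
    then have "D x (real n * T - real m * T + s) \<le> \<beta>" using that by (intro D_be) simp
    then show "- \<delta> < A n x s" "A n x s \<le> 3 * \<delta>" using D_pos by (simp_all add: A_def \<beta>_def)
  qed
  have bar: "barrier_on (- N) N (A n)" if "m \<le> n" for N n
    unfolding barrier_on_def
  proof (intro conjI, goal_cases)
    case 1
    have "real m * T \<le> real n * T" using that T_pos by simp
    then show ?case
      unfolding A_def D_def case_prod_unfold using \<sigma> by (intro continuous_intros) auto
  next
    case 2
    define q where "q = real n * T - real m * T"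
    have q: "q \<ge> 0" using that T_pos by (simp add: q_def)
    show ?case
    proof (rule exI[of _ "\<lambda>x t. D x (q + t) * (- 1 / (4 * (\<sigma> + (q + t))) + x\<^sup>2 / (8 * (\<sigma> + (q + t))\<^sup>2))"],
        rule exI[of _ "\<lambda>x t. D x (q + t) * (- x / (4 * (\<sigma> + (q + t))))"],
        rule exI[of _ "\<lambda>x t. D x (q + t) * (- x / (4 * (\<sigma> + (q + t))))\<^sup>2 - D x (q + t) / (4 * (\<sigma> + (q + t)))"],
        intro ballI conjI)
      fix x t assume "t \<in> {0<..T}"
      then have t: "t > 0" by simp
      define S where "S = \<sigma> + (q + t)"
      have S: "S > 0" using t q \<sigma> by (simp add: S_def)
      have Dx: "((\<lambda>y. D y (q + t)) has_real_derivative D y (q + t) * (- y / (4 * S))) (at y)" for y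
        unfolding D_def S_def[symmetric] using S by (auto intro!: derivative_eq_intros simp: field_simps)
      have lnS: "((\<lambda>r. ln ((\<sigma> + (q + r)) / \<sigma>)) has_real_derivative 1 / S) (at t)"
        using S \<sigma> q t unfolding S_def by (auto intro!: derivative_eq_intros simp: field_simps)
      have inv: "((\<lambda>r. x\<^sup>2 / (8 * (\<sigma> + (q + r)))) has_real_derivative - (x\<^sup>2 / (8 * S\<^sup>2))) (at t)"
      proof -
        have "((\<lambda>r. inverse (\<sigma> + (q + r))) has_real_derivative - (inverse S)\<^sup>2) (at t)"
          using S by (auto intro!: derivative_eq_intros simp: S_def power2_eq_square)
        from DERIV_cmult[OF this, of "x\<^sup>2 / 8"] show ?thesis using S by (simp add: field_simps)
      qed
      have "((\<lambda>r. - ln ((\<sigma> + (q + r)) / \<sigma>) / 4 - x\<^sup>2 / (8 * (\<sigma> + (q + r)))) has_real_derivative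
          - (1 / S) / 4 - - (x\<^sup>2 / (8 * S\<^sup>2))) (at t)"
        by (intro DERIV_diff DERIV_cdivide DERIV_minus lnS inv)
      from DERIV_cmult[OF DERIV_chain2[OF DERIV_exp this], of \<beta>]
      have Dt: "((\<lambda>r. D x (q + r)) has_real_derivative D x (q + t) * (- (1 / S) / 4 - - (x\<^sup>2 / (8 * S\<^sup>2)))) (at t)"
        unfolding D_def by (simp add: mult.assoc)
      have A_eq: "A n x s = - \<delta> + D x (q + s)" for x s by (simp add: A_def q_def)
      show "((\<lambda>r. A n x r) has_real_derivative D x (q + t) * (- 1 / (4 * (\<sigma> + (q + t))) + x\<^sup>2 / (8 * (\<sigma> + (q + t))\<^sup>2))) (at t)"
        unfolding A_eq S_def[symmetric] 
        by (rule DERIV_cong[OF DERIV_add[OF DERIV_const Dt]]) (use S in \<open>simp add: field_simps\<close>)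
      show "((\<lambda>y. A n y t) has_real_derivative D x (q + t) * (- x / (4 * (\<sigma> + (q + t))))) (at x)"
        unfolding A_eq S_def[symmetric] 
        by (rule DERIV_cong[OF DERIV_add[OF DERIV_const Dx]]) simp
      have "((\<lambda>y. - y / (4 * S)) has_real_derivative - 1 / (4 * S)) (at x)"
        using S by (auto intro!: derivative_eq_intros)
      from DERIV_mult[OF Dx[of x] this]
      show "((\<lambda>y. D y (q + t) * (- y / (4 * (\<sigma> + (q + t))))) has_real_derivative
          D x (q + t) * (- x / (4 * (\<sigma> + (q + t))))\<^sup>2 - D x (q + t) / (4 * (\<sigma> + (q + t)))) (at x)"
        unfolding S_def[symmetric] by (rule DERIV_cong) (simp add: power2_eq_square algebra_simps)
      define d where "d = D x (q + t)"
      define g where "g = x\<^sup>2 / (16 * S\<^sup>2)"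
      have sq: "(- x / (4 * S))\<^sup>2 = g" by (simp add: g_def power_divide power_mult_distrib)
      have d: "d > 0" "d \<le> \<beta>" using D_pos D_be[of "q + t" x] q t by (simp_all add: d_def)
      have "Cq * d \<le> Cq * \<beta>" using d Cq_nonneg by (intro mult_left_mono) auto
      then have "Cq * d * (d * g) \<le> 1 * (d * g)"
        using be_C d by (intro mult_right_mono) (auto simp: g_def)
      then have "d * g - d / (4 * S) + Cq * (d\<^sup>2 * g) \<le> d * (- 1 / (4 * S) + 2 * g)"
        by (simp add: power2_eq_square algebra_simps)
      then show "D x (q + t) * (- x / (4 * (\<sigma> + (q + t))))\<^sup>2 - D x (q + t) / (4 * (\<sigma> + (q + t)))
          + Cq * (D x (q + t) * (- x / (4 * (\<sigma> + (q + t)))))\<^sup>2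
          \<le> D x (q + t) * (- 1 / (4 * (\<sigma> + (q + t))) + x\<^sup>2 / (8 * (\<sigma> + (q + t))\<^sup>2))"
        unfolding S_def[symmetric] d_def[symmetric] power_mult_distrib sq by (simp add: g_def)
    qed
  qed
  have step: "flow T (A n x T) \<le> A (Suc n) x 0" if "m \<le> n" for n x
  proof -
    have "flow T (A n x T) \<le> A n x T"
      using A_bounds[OF that, of T x] T_pos de de_r by (intro P) (auto simp: abs_less_iff)
    also have "A n x T = A (Suc n) x 0"
    proof -
      have "real n * T - real m * T + T = real (Suc n) * T - real m * T + 0" by (simp add: distrib_right)
      then show ?thesis unfolding A_def by (rule arg_cong)
    qed
    finally show ?thesis .
  qed
  \<comment> \<open>The lateral ends \<open>- N\<close> and \<open>N\<close> are chosen anew for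
    every final period, because the region where decay is known depends on the time; the barrier
    itself is defined on the whole line.\<close>
  have below: "w 0 (real n * T) \<le> A n 0 0" if n: "m \<le> n" for n
  proof -
    obtain N where N: "N \<ge> 1" "\<And>x t. N \<le> \<bar>x\<bar> \<Longrightarrow> 0 < t \<Longrightarrow> t \<le> real n * T \<Longrightarrow> w x t \<le> - \<theta>"
      by (rule w_far_obtain[of 1 "real n * T"]) (rule that; assumption)
    have mT: "real m * T > 0" using m T_pos by simp
    have mn: "real m * T \<le> real n * T" using n T_pos by simp
    have "w 0 (real n * T + 0) \<le> flow 0 (A n 0 0)"
    proof (rule barrier_chain[OF w_sol, where A=A and \<alpha>="- N" and \<beta>=N and k=m and s="real m * T" and \<tau>="real n * T"])
      fix x
      have "w x (real m * T) \<le> A m x 0"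
      proof (cases "\<bar>x\<bar> \<le> X")
        case True
        then have "x\<^sup>2 \<le> X\<^sup>2" using X(1) by (simp add: abs_le_square_iff[symmetric])
        then have "x\<^sup>2 / (8 * \<sigma>) \<le> \<sigma> / (8 * \<sigma>)" using \<sigma> by (intro divide_right_mono) (auto simp: \<sigma>_def)
        then have "x\<^sup>2 / (8 * \<sigma>) \<le> 1 / 8" using \<sigma> by simp
        then have "1 / 2 \<le> exp (- (x\<^sup>2 / (8 * \<sigma>)))" using exp_ge_add_one_self[of "- (x\<^sup>2 / (8 * \<sigma>))"] by linarith
        then have "\<beta> * (1 / 2) \<le> \<beta> * exp (- (x\<^sup>2 / (8 * \<sigma>)))" using be by (intro mult_left_mono) auto
        then have "\<delta> \<le> A m x 0" using \<sigma> by (simp add: A_def D_def \<beta>_def)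
        then show ?thesis using init[of x] by linarith
      next
        case False
        then have "w x (real m * T) \<le> - \<theta>" using mT by (intro X(2)) auto
        moreover have "1 * \<delta> \<le> \<Lambda> * \<delta>" using Lam de by (intro mult_right_mono) auto
        ultimately show ?thesis using A_bounds(1)[of m 0 x] de_th by simp
      qed
      then show "w x (real m * T) \<le> flow (real m * T - real m * T) (A m x (real m * T - real m * T))" by simp
    next
      fix l s assume l: "m \<le> l" "0 \<le> s" "s \<le> T" "real m * T \<le> real l * T + s" "real l * T + s \<le> real n * T"
      have "- \<theta> \<le> flow s (A l x s)" for x
      proof -
        have "- \<theta> \<le> exp (L * T) * (- \<delta>)" using de_th by (simp add: \<Lambda>_def)
        also have "\<dots> \<le> flow s (- \<delta>)" using flow_abs_bounds(4)[OF l(2,3), of "- \<delta>"] de by simp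
        also have "\<dots> \<le> flow s (A l x s)" using A_bounds(1)[OF l(1,2), of x] l by (intro flow_mono) auto
        finally show ?thesis .
      qed
      moreover have "w (- N) (real l * T + s) \<le> - \<theta>" "w N (real l * T + s) \<le> - \<theta>"
        using N l mT by (intro N(2); simp)+
      ultimately show "w (- N) (real l * T + s) \<le> flow s (A l (- N) s) \<and> w N (real l * T + s) \<le> flow s (A l N s)"
        by (meson order_trans)
    qed (use bar step n mn mT T_pos N in auto)
    then show ?thesis by simp
  qed
  have "filterlim (\<lambda>n. (real n * T - real m * T + \<sigma>) / \<sigma>) at_top sequentially"
  proof -
    have "filterlim (\<lambda>n. real n * T) at_top sequentially"
      using filterlim_tendsto_pos_mult_at_top[OF tendsto_const T_pos filterlim_real_sequentially] by (simp add: mult.commute)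
    from filterlim_tendsto_add_at_top[OF tendsto_const this, of "\<sigma> - real m * T"]
    have "filterlim (\<lambda>n. real n * T - real m * T + \<sigma>) at_top sequentially" by (simp add: algebra_simps)
    from filterlim_tendsto_pos_mult_at_top[OF tendsto_const _ this, of "1 / \<sigma>"] show ?thesis using \<sigma> by simp
  qed
  from filterlim_compose[OF ln_at_top this]
  have "filterlim (\<lambda>n. ln ((real n * T - real m * T + \<sigma>) / \<sigma>)) at_top sequentially" .
  \<comment> \<open>A decrease of \<open>D\<close> by the factor 8 brings it from
    \<open>4 * \<delta>\<close> to \<open>\<delta> / 2\<close>, so the barrier lies at
    \<open>- (\<delta> / 2)\<close> or below at \<open>x = 0\<close>, beyond the allowed deviation
    of \<open>w\<close> from 0.\<close>
  then have "\<forall>\<^sub>F n in sequentially. ln ((real n * T - real m * T + \<sigma>) / \<sigma>) \<ge> 4 * ln 8"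
    by (simp add: filterlim_at_top)
  then obtain n1 where n1: "\<And>n. n \<ge> n1 \<Longrightarrow> ln ((real n * T - real m * T + \<sigma>) / \<sigma>) \<ge> 4 * ln 8"
    by (auto simp: eventually_sequentially)
  obtain n where n: "n \<ge> max n1 m" and wn: "\<And>x t. \<bar>x\<bar> \<le> 0 \<Longrightarrow> \<bar>t\<bar> \<le> 0 \<Longrightarrow> \<bar>w x (t + real n * T)\<bar> < \<delta> / 2"
    by (rule w_zero_obtain[OF half_gt_zero[OF de], of "max n1 m" 0]) (rule that; assumption)
  have "real m * T \<le> real n * T" using n T_pos by simp
  then have "D 0 (real n * T - real m * T) \<le> \<beta> * exp (- ln ((\<sigma> + (real n * T - real m * T)) / \<sigma>) / 4)"
    by (intro D_le) simp
  also have "\<dots> \<le> \<beta> * exp (- ln 8)"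
    using n1[of n] n be by (intro mult_left_mono) (auto simp: add.commute)
  also have "\<dots> = \<delta> / 2" by (simp add: \<beta>_def exp_minus)
  finally have "A n 0 0 \<le> - (\<delta> / 2)" by (simp add: A_def)
  then show False using below[of n] n wn[of 0 0] by auto
qed

text \<open>The fixed barriers above \<open>0\<close> keep \<open>w\<close> so small that it stays trapped below \<open>0\<close> at some distant point.\<close>

lemma not_bounded_above:
  assumes r: "r > 0" and P: "\<And>a. - r < a \<Longrightarrow> a < 0 \<Longrightarrow> flow T a < a"
    and above: "\<And>s. s > 0 \<Longrightarrow> \<exists>a. 0 < a \<and> a < s \<and> flow T a \<le> a"
  shows False
proof -
  obtain l \<eta> \<theta>' where l: "l > 0" "\<eta> > 0" "\<theta>' > 0" and trap': "traps l \<eta> \<theta> \<theta>'"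
    by (rule trapping[of r \<theta>], rule r, rule P, assumption, assumption, rule \<theta>_pos, rule that)
  note trap = trap'[unfolded traps_def, rule_format]
  \<comment> \<open>With \<open>flow T a <= a\<close> the constant \<open>a\<close> is a barrier for
    every period, and its smallness keeps the flow below \<open>\<eta>\<close> inside each period as
    well.\<close>
  obtain a where a: "0 < a" "a < \<eta> / exp (L * T)" "flow T a \<le> a" using above[of "\<eta> / exp (L * T)"] l by auto
  have ea: "exp (L * T) * a \<le> \<eta>" using a(2) by (simp add: field_simps)
  obtain m where m: "m > 0" and init: "\<And>x. w x (real m * T) \<le> a"
    by (rule w_le_everywhere[OF a(1)]) (rule that; assumption)
  have mT: "real m * T > 0" using m T_pos by simp
  have le: "w x t \<le> \<eta>" if t: "real m * T \<le> t" for x t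
  proof -
    obtain n where n: "real n * T \<le> t" "t < real n * T + T" using period_decomposition[OF T_pos, of t] mT t by auto
    have "real m * T < (real n + 1) * T" using n t by (simp add: algebra_simps)
    then have mn: "m \<le> n" using T_pos by simp
    obtain N where N: "N \<ge> \<bar>x\<bar> + 1" "\<And>x s. N \<le> \<bar>x\<bar> \<Longrightarrow> 0 < s \<Longrightarrow> s \<le> t \<Longrightarrow> w x s \<le> - \<theta>"
      by (rule w_far_obtain[of "\<bar>x\<bar> + 1" t]) (rule that; assumption)
    have "w x (real n * T + (t - real n * T)) \<le> flow (t - real n * T) a"
    proof (rule barrier_chain[OF w_sol, where A="\<lambda>_ _ _. a" and \<alpha>="- N" and \<beta>=N and k=m and s="real m * T" and \<tau>=t])
      show "barrier_on (- N) N (\<lambda>_ _. a)"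
        unfolding barrier_on_def
        by (intro conjI continuous_on_const exI[of _ "\<lambda>_ _. 0"]) (auto simp: case_prod_unfold)
      fix i s assume s: "m \<le> i" "0 \<le> s" "s \<le> T" "real m * T \<le> real i * T + s" "real i * T + s \<le> t"
      have "w (- N) (real i * T + s) \<le> - \<theta>" "w N (real i * T + s) \<le> - \<theta>"
        using N s mT by (intro N(2); simp)+
      moreover have "0 \<le> flow s a" using flow_mono[of 0 a s] a s by simp
      ultimately show "w (- N) (real i * T + s) \<le> flow s a \<and> w N (real i * T + s) \<le> flow s a" using \<theta>_pos by linarith
    qed (use a init n mn mT T_pos t N in auto)
    also have "\<dots> \<le> exp (L * T) * a" using flow_abs_bounds(2)[of "t - real n * T" a] n a by simp
    finally show ?thesis using ea by simp
  qed
  obtain X where X: "X \<ge> 0" "\<And>x t. X \<le> \<bar>x\<bar> \<Longrightarrow> 0 < t \<Longrightarrow> t \<le> real m * T \<Longrightarrow> w x t \<le> - \<theta>"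
    by (rule w_far_obtain[of 0 "real m * T"]) (rule that; assumption)
  \<comment> \<open>With centre \<open>X + l\<close> the whole interval starts at \<open>X\<close>,
    so at the starting time it lies where \<open>w <= - \<theta>\<close>.\<close>
  have trapped: "w (X + l) t \<le> - \<theta>'" if t: "real m * T \<le> t" for t
  proof (rule trap[OF w_sol mT t])
    fix x assume "X + l - l \<le> x"
    then have "X \<le> \<bar>x\<bar>" by simp
    then show "w x (real m * T) \<le> - \<theta>" by (rule X(2)[OF _ mT order_refl])
  next
    fix q assume "real m * T \<le> q"
    then show "w (X + l - l) q \<le> \<eta> \<and> w (X + l + l) q \<le> \<eta>" using le by simp
  qed
  obtain n where n: "n \<ge> m" and wn: "\<And>x t. \<bar>x\<bar> \<le> X + l \<Longrightarrow> \<bar>t\<bar> \<le> X + l \<Longrightarrow> \<bar>w x (t + real n * T)\<bar> < \<theta>'"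
    by (rule w_zero_obtain[OF l(3), of m "X + l"]) (rule that; assumption)
  have "real m * T \<le> real n * T" using n T_pos by simp
  from trapped[OF this] wn[of "X + l" 0] show False using X l by simp
qed

text \<open>The remaining case is instability on both sides. At a distant point \<open>y\<close> let \<open>s\<close> be the last time with
  \<open>w y s \<ge> \<eta>'\<close>. By monotonicity in \<open>x\<close>, \<open>w\<close> is then positive on a long interval left of \<open>y\<close> and grows there. It can only
  return to \<open>0\<close> if it becomes negative in between; by monotonicity it is then negative on a long interval right of
  \<open>y\<close>, where it remains trapped because \<open>w y < \<eta>'\<close> after time \<open>s\<close>.\<close>

lemma not_unstable:
  assumes r: "r > 0" and P: "\<And>a. - r < a \<Longrightarrow> a < 0 \<Longrightarrow> flow T a < a"
    and P': "\<And>a. 0 < a \<Longrightarrow> a < r \<Longrightarrow> a < flow T a"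
  shows False
proof -
  interpret m: c11_field "\<lambda>t w. - F t (- w)" "\<lambda>t w. Fw t (- w)" L L2 T by (rule reflected_field)
  have mP: "m.flow T a < a" if "- r < a" "a < 0" for a
    using P'[of "- a"] that T_pos by (simp add: reflected_flow)
  have mw: "classical_sol_on (\<lambda>t w. - F t (- w)) {0<..} (\<lambda>x t. - w x t)" by (rule reflected_sol[OF w_sol])
  \<comment> \<open>The constants depend on each other in this order: the plateau height
    \<open>\<eta>\<close> fixes what trapping above 0 tolerates (\<open>\<theta>q\<close>); this
    fixes the depth \<open>\<theta>1\<close> for trapping below 0, hence its tolerance
    \<open>\<eta>'\<close>; and the growth from \<open>\<eta>'\<close> to \<open>\<eta>\<close>
    fixes \<open>K\<close> and \<open>N\<close>.\<close>
  define \<eta> where "\<eta> = r / 2"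
  have eta: "0 < \<eta>" "\<eta> < r" using r by (simp_all add: \<eta>_def)
  obtain b \<theta>q \<eta>q where b: "b > 0" "\<theta>q > 0" "\<eta>q > 0" and mtrap': "m.traps b \<theta>q \<eta> \<eta>q"
    by (rule m.trapping[of r \<eta>], rule r, rule mP, assumption, assumption, rule eta(1), rule that)
  note mtrap = mtrap'[unfolded m.traps_def, rule_format]
  define \<theta>1 where "\<theta>1 = min \<theta>q \<theta>"
  have th1: "\<theta>1 > 0" "\<theta>1 \<le> \<theta>q" "\<theta>1 \<le> \<theta>" using b \<theta>_pos by (simp_all add: \<theta>1_def)
  obtain l \<eta>' \<theta>' where l: "l > 0" "\<eta>' > 0" "\<theta>' > 0" and trap': "traps l \<eta>' \<theta>1 \<theta>'"
    by (rule trapping[of r \<theta>1], rule r, rule P, assumption, assumption, rule th1(1), rule that)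
  note trap = trap'[unfolded traps_def, rule_format]
  obtain K N where K: "K \<ge> b" "N \<ge> 0" and desc': "m.sinks M b \<eta>' \<eta> K N"
    by (rule m.descent[of r \<eta>' \<eta> b M], rule r, rule mP, assumption, assumption, rule l(2), rule eta(1), rule eta(2), rule less_imp_le[OF b(1)], rule that)
  define R' where "R' = \<bar>R\<bar> + 1"
  have R': "R < R'" "R' > 0" by (simp_all add: R'_def)
  \<comment> \<open>\<open>Y\<close> is the centre of the plateau. All points within
    \<open>K\<close> of it lie in the region of monotonicity and, by the choice of \<open>y\<close>,
    to the left of \<open>y\<close>.\<close>
  define Y where "Y = R' + K"
  obtain y where y: "y \<ge> Y + K" and far: "\<And>x t. y \<le> \<bar>x\<bar> \<Longrightarrow> 0 < t \<Longrightarrow> t \<le> T \<Longrightarrow> w x t \<le> - \<theta>"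
    by (rule w_far_obtain[of "Y + K" T]) (rule that; assumption)
  have yR: "R < y" "y > 0" "R < Y - b" "R < Y + b" "Y + b \<le> y" "Y > 0" using y R' K b by (simp_all add: Y_def)
  define e where "e = min \<eta>' (min \<theta>' \<eta>q)"
  have e: "e > 0" "e \<le> \<eta>'" "e \<le> \<theta>'" "e \<le> \<eta>q" using l b by (simp_all add: e_def)
  \<comment> \<open>In space the window of smallness contains the points at which contradictions are
    read off; in time it exceeds the waiting time \<open>N\<close>, so that growth started before
    the window is completed before \<open>\<tau>\<close>.\<close>
  define C where "C = y + 2 * l + N + 1"
  obtain n0 :: nat where n0: "(C + T) / T < real n0" using reals_Archimedean2 by blast
  obtain n where n: "n \<ge> n0" and wn: "\<And>x t. \<bar>x\<bar> \<le> C \<Longrightarrow> \<bar>t\<bar> \<le> C \<Longrightarrow> \<bar>w x (t + real n * T)\<bar> < e"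
    by (rule w_zero_obtain[OF e(1), of n0 C]) (rule that; assumption)
  define \<tau> where "\<tau> = real n * T"
  have \<tau>: "\<tau> > C + T"
  proof -
    have "(C + T) / T < real n" using n0 n by (meson less_le_trans of_nat_le_iff)
    then show ?thesis using T_pos by (simp add: \<tau>_def field_simps)
  qed
  have C: "C > 0" "C \<ge> y" "C \<ge> y + 2 * l" "C \<ge> N + 1" using yR l K by (simp_all add: C_def)
  have late: "\<bar>w x t\<bar> < e" if "\<bar>x\<bar> \<le> C" "\<tau> - C \<le> t" "t \<le> \<tau>" for x t
    using wn[of x "t - \<tau>"] that by (simp add: \<tau>_def abs_le_iff)
  define E where "E = {t \<in> {T..\<tau>}. w y t \<ge> \<eta>'}"
  \<comment> \<open>The interval to the right of \<open>y\<close> is \<open>{y..y + 2 * l}\<close>.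
    A bound at \<open>y\<close> alone suffices laterally, because \<open>w\<close> is nonincreasing
    in \<open>x\<close>.\<close>
  have trap_right: False if s: "T \<le> s" "s \<le> \<tau>" and init: "\<And>x. y \<le> x \<Longrightarrow> w x s \<le> - \<theta>1"
    and small: "\<And>t. s \<le> t \<Longrightarrow> t \<le> \<tau> \<Longrightarrow> w y t \<le> \<eta>'" for s
  proof -
    have "w (y + l) \<tau> \<le> - \<theta>'"
    proof (rule trap[OF w_sol])
      fix t assume t: "s \<le> t" "t \<le> \<tau>"
      have "w (y + l + l) t \<le> w y t" by (rule w_antimono) (use yR l t s T_pos in auto)
      then show "w (y + l - l) t \<le> \<eta>' \<and> w (y + l + l) t \<le> \<eta>'" using small[OF t] by simp
    qed (use s T_pos init in auto)
    moreover have "\<bar>w (y + l) \<tau>\<bar> < e" by (rule late) (use C l yR in auto)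
    ultimately show False using e by linarith
  qed
  \<comment> \<open>If \<open>w y\<close> never reached \<open>\<eta>'\<close>, trapping to the
    right of \<open>y\<close> could begin already at time \<open>T\<close>, when decay makes
    \<open>w\<close> negative there.\<close>
  have "E \<noteq> {}"
  proof
    assume "E = {}"
    have small: "w y t \<le> \<eta>'" if "T \<le> t" "t \<le> \<tau>" for t
    proof (rule ccontr)
      assume "\<not> w y t \<le> \<eta>'"
      then have "t \<in> E" using that by (simp add: E_def)
      then show False using \<open>E = {}\<close> by simp
    qed
    show False
    proof (rule trap_right[of T])
      fix x assume "y \<le> x"
      then have "w x T \<le> - \<theta>" using yR T_pos by (intro far) auto
      then show "w x T \<le> - \<theta>1" using th1 by simp
    qed (use \<tau> C small in auto)
  qed
  moreover have "compact E"
  proof -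
    have E_eq: "E = {T..\<tau>} \<inter> (\<lambda>t. w y t) -` {\<eta>'..}" by (auto simp: E_def)
    obtain wt where wt: "\<And>t. t > 0 \<Longrightarrow> ((\<lambda>s. w y s) has_real_derivative wt y t) (at t)"
      using w_sol unfolding classical_sol_on_def by (metis greaterThan_iff)
    then have "continuous_on {T..\<tau>} (\<lambda>t. w y t)"
      using T_pos by (intro continuous_at_imp_continuous_on ballI) (rule DERIV_isCont, rule wt, simp)
    then have "closed ({T..\<tau>} \<inter> (\<lambda>t. w y t) -` {\<eta>'..})"
      by (rule continuous_closed_preimage) auto
    moreover have "bounded ({T..\<tau>} \<inter> (\<lambda>t. w y t) -` {\<eta>'..})"
      by (rule bounded_subset[OF bounded_closed_interval[of T \<tau>]]) auto
    ultimately show ?thesis unfolding E_eq by (simp only: compact_eq_bounded_closed)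
  qed
  ultimately obtain s where s: "s \<in> E" "\<And>t. t \<in> E \<Longrightarrow> t \<le> s"
    using compact_attains_sup[of E] by blast
  have sT: "T \<le> s" "s \<le> \<tau>" "w y s \<ge> \<eta>'" using s(1) by (simp_all add: E_def)
  have after: "w y t \<le> \<eta>'" if "s < t" "t \<le> \<tau>" for t
  proof (rule ccontr)
    assume "\<not> w y t \<le> \<eta>'"
    then have "t \<in> E" using that sT by (simp add: E_def)
    then show False using s(2) that by force
  qed
  have s_early: "s < \<tau> - C"
  proof (rule ccontr)
    assume "\<not> s < \<tau> - C"
    then have "\<bar>w y s\<bar> < e" using sT C yR by (intro late) auto
    then show False using sT e by linarith
  qed
  obtain s' where s': "s \<le> s'" "s' \<le> s + N" and high: "\<And>x. Y - b \<le> x \<Longrightarrow> x \<le> Y + b \<Longrightarrow> w x s' \<ge> \<eta>"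
  proof -
    have "\<exists>s'. s \<le> s' \<and> s' \<le> s + N \<and> (\<forall>x. Y - b \<le> x \<and> x \<le> Y + b \<longrightarrow> - w x s' \<le> - \<eta>)"
    proof (rule desc'[unfolded m.sinks_def, THEN spec, THEN spec, THEN spec, THEN mp, THEN mp, THEN mp, THEN mp, OF mw];
        (intro allI impI)?)
      show "- w x t \<le> M" if "0 < t" for x t using w_abs[OF that, of x] by linarith
      fix x assume x: "Y - K \<le> x" "x \<le> Y + K"
      have "w y s \<le> w x s" by (rule w_antimono) (use x y R' sT T_pos in \<open>auto simp: Y_def\<close>)
      then show "- w x s \<le> - \<eta>'" using sT by simp
    qed (use sT T_pos in auto)
    then show thesis using that by auto
  qed
  have s'\<tau>: "s' \<le> \<tau>" "s' > 0" using s' s_early C sT T_pos K by linarith+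
  show False
  \<comment> \<open>Either the right end of the plateau never falls below
    \<open>- \<theta>1\<close>, and trapping above 0 keeps \<open>w Y \<tau>\<close> away from 0; or
    it does so at some time \<open>t\<close>, and monotonicity passes the bound to all points right
    of \<open>y\<close>.\<close>
  proof (cases "\<forall>t. s' \<le> t \<and> t \<le> \<tau> \<longrightarrow> w (Y + b) t \<ge> - \<theta>1")
    case True
    have "- w Y \<tau> \<le> - \<eta>q"
    proof (rule mtrap[OF mw])
      fix t assume t: "s' \<le> t" "t \<le> \<tau>"
      have "w (Y + b) t \<le> w (Y - b) t" by (rule w_antimono) (use yR b t s'\<tau> in auto)
      then show "- w (Y - b) t \<le> \<theta>q \<and> - w (Y + b) t \<le> \<theta>q" using True[rule_format, of t] t th1 by linarith
    qed (use s'\<tau> high in auto)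
    moreover have "\<bar>w Y \<tau>\<bar> < e" by (rule late) (use C yR b in auto)
    ultimately show False using e by linarith
  next
    case False
    then obtain t where t: "s' \<le> t" "t \<le> \<tau>" "w (Y + b) t < - \<theta>1" by auto
    have st: "s < t"
    proof (rule ccontr)
      assume "\<not> s < t"
      then have "t = s" using t s' by simp
      then have "w (Y + b) s < - \<theta>1" using t(3) by simp
      moreover have "w y s \<le> w (Y + b) s" by (rule w_antimono) (use yR sT T_pos in auto)
      ultimately show False using sT l th1 by linarith
    qed
    show False
    proof (rule trap_right[of t])
      fix x assume "y \<le> x"
      then have "w x t \<le> w (Y + b) t" by (intro w_antimono) (use yR t s'\<tau> in auto)
      then show "w x t \<le> - \<theta>1" using t by simp
    next
      fix q assume "t \<le> q" "q \<le> \<tau>"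
      then show "w y q \<le> \<eta>'" using after[of q] st by simp
    qed (use t st sT in auto)
  qed
qed

text \<open>The dichotomy on the upper side: either one period increases all small positive values,
  or values that it does not increase accumulate at 0.\<close>

lemma not_decreasing_below:
  assumes r: "r > 0" and P: "\<And>a. - r < a \<Longrightarrow> a < 0 \<Longrightarrow> flow T a < a"
  shows False
proof (cases "\<exists>s>0. \<forall>a. 0 < a \<and> a < s \<longrightarrow> a < flow T a")
  case True
  then obtain s where s: "s > 0" "\<forall>a. 0 < a \<and> a < s \<longrightarrow> a < flow T a" by blast
  show ?thesis by (rule not_unstable[of "min r s"]) (use r P s in simp_all)
next
  case False
  have above: "\<exists>a. 0 < a \<and> a < s \<and> flow T a \<le> a" if "s > 0" for s
    using False that not_less by blast
  show ?thesis
    by (rule not_bounded_above[OF r], rule P, assumption, assumption, rule above, assumption)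
qed

end

section \<open>The main result\<close>

lemma periodic_int:
  fixes g :: "real \<Rightarrow> 'a"
  assumes per: "\<And>t. g (t + T) = g t"
  shows "g (t + of_int n * T) = g t"
proof -
  have nat: "g (t + real n * T) = g t" for t n
  proof (induction n)
    case (Suc n)
    have "t + real (Suc n) * T = (t + real n * T) + T" by (simp add: distrib_right)
    then have "g (t + real (Suc n) * T) = g ((t + real n * T) + T)" by (rule arg_cong)
    then show ?case unfolding per Suc .
  qed simp
  show ?thesis
  proof (cases "n \<ge> 0")
    case True
    then show ?thesis using nat[of t "nat n"] by simp
  next
    case False
    have e: "t + of_int n * T + real (nat (- n)) * T = t" using False by (simp add: algebra_simps)
    show ?thesis using nat[of "t + of_int n * T" "nat (- n)"] unfolding e by (rule sym)
  qed
qed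

lemma continuous_interval_bounded:
  fixes g :: "real \<Rightarrow> real"
  assumes "continuous_on {a..b} g"
  obtains B where "\<And>t. a \<le> t \<Longrightarrow> t \<le> b \<Longrightarrow> \<bar>g t\<bar> \<le> B"
proof -
  have "bounded (g ` {a..b})"
    by (rule compact_imp_bounded[OF compact_continuous_image[OF assms]]) simp
  then obtain B where "\<forall>x\<in>g ` {a..b}. norm x \<le> B" unfolding bounded_iff by blast
  then show thesis by (intro that[of B]) auto
qed

lemma periodic_bounded:
  fixes g :: "real \<Rightarrow> real"
  assumes "T > 0" and per: "\<And>t. g (t + T) = g t" and cont: "continuous_on UNIV g"
  obtains B where "\<And>t. \<bar>g t\<bar> \<le> B"
proof -
  obtain B where B: "\<And>t. 0 \<le> t \<Longrightarrow> t \<le> T \<Longrightarrow> \<bar>g t\<bar> \<le> B"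
    by (rule continuous_interval_bounded[OF continuous_on_subset[OF cont]]) (rule subset_UNIV, rule that)
  show thesis
  proof (rule that)
    fix t
    define n where "n = \<lfloor>t / T\<rfloor>"
    have "of_int n * T \<le> t" "t \<le> of_int n * T + T"
      using floor_divide_lower[OF assms(1), of t] floor_divide_upper[OF assms(1), of t]
      by (simp_all add: n_def algebra_simps)
    then have "\<bar>g (t + of_int (- n) * T)\<bar> \<le> B" by (intro B) auto
    then show "\<bar>g t\<bar> \<le> B" unfolding periodic_int[where g=g and T=T, OF per] .
  qed
qed

definition clamp0 :: "real \<Rightarrow> real \<Rightarrow> real" where "clamp0 M w = max 0 (min M w)"

text \<open>Continuation by tangent lines outside \<open>{0..M}\<close>. Its derivative is
  \<open>fu\<close> at the clamped point, hence globally bounded and Lipschitz, while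
  \<open>f\<close> is unchanged on the range of the solutions.\<close>

definition lin_ext :: "real \<Rightarrow> (real \<Rightarrow> real \<Rightarrow> real) \<Rightarrow> (real \<Rightarrow> real \<Rightarrow> real) \<Rightarrow> real \<Rightarrow> real \<Rightarrow> real" where
  "lin_ext M f fu t w = f t (clamp0 M w) + fu t (clamp0 M w) * (w - clamp0 M w)"

lemma clamp0_bounds: "M > 0 \<Longrightarrow> 0 \<le> clamp0 M w" "M > 0 \<Longrightarrow> clamp0 M w \<le> M"
  by (auto simp: clamp0_def)

lemma clamp0_id: "0 \<le> w \<Longrightarrow> w \<le> M \<Longrightarrow> clamp0 M w = w"
  by (simp add: clamp0_def)

lemma clamp0_lip: "\<bar>clamp0 M a - clamp0 M b\<bar> \<le> \<bar>a - b\<bar>"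
  by (auto simp: clamp0_def max_def min_def)

lemma lin_ext_id: "0 \<le> w \<Longrightarrow> w \<le> M \<Longrightarrow> lin_ext M f fu t w = f t w"
  by (simp add: lin_ext_def clamp0_id)

section \<open>The nonlinearity: global bounds by periodicity, extension, and uniqueness for the
  ODE\<close>

locale kinetics =
  fixes f fu :: "real \<Rightarrow> real \<Rightarrow> real" and T :: real
  assumes T_pos: "T > 0"
    and f_hoelder: "locally_hoelder_f f"
    and f_deriv: "w \<ge> 0 \<Longrightarrow> (f t has_real_derivative fu t w) (at w within {0..})"
    and fu_cont: "continuous_on (UNIV \<times> {0..}) (\<lambda>(t, w). fu t w)"
    and f_zero: "f t 0 = 0"
    and f_per: "w \<ge> 0 \<Longrightarrow> f (t + T) w = f t w"
    and fu_lip: "\<exists>L. \<forall>t a b. 0 \<le> a \<and> a \<le> M \<and> 0 \<le> b \<and> b \<le> M \<longrightarrow> \<bar>fu t a - fu t b\<bar> \<le> L * \<bar>a - b\<bar>"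
begin

lemma f_cont_t: assumes "w \<ge> 0" shows "continuous_on UNIV (\<lambda>t. f t w)"
proof -
  have "isCont (\<lambda>t. f t w) t" for t
  proof -
    have "compact ({t - 1..t + 1} \<times> {w})" by (intro compact_Times) auto
    then obtain \<alpha> C where \<alpha>: "0 < \<alpha>" and C: "\<And>z1 z2. z1 \<in> {t - 1..t + 1} \<times> {w} \<Longrightarrow> z2 \<in> {t - 1..t + 1} \<times> {w} \<Longrightarrow>
        \<bar>f (fst z1) (snd z1) - f (fst z2) (snd z2)\<bar> \<le> C * dist z1 z2 powr \<alpha>"
      using f_hoelder assms unfolding locally_hoelder_f_def by (metis (no_types, lifting) Sigma_mono atLeast_iff empty_subsetI insert_subset subset_UNIV)
    have "((\<lambda>s. C * \<bar>s - t\<bar> powr \<alpha>) \<longlongrightarrow> C * \<bar>t - t\<bar> powr \<alpha>) (at t)"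
      by (intro tendsto_intros) (use \<alpha> in auto)
    then have lim: "((\<lambda>s. C * \<bar>s - t\<bar> powr \<alpha>) \<longlongrightarrow> 0) (at t)" using \<alpha> by simp
    have "((\<lambda>s. f s w - f t w) \<longlongrightarrow> 0) (at t)"
    proof (rule Lim_null_comparison[OF _ lim])
      have "\<forall>\<^sub>F s in at t. s \<in> {t - 1<..<t + 1}" by (intro eventually_at_in_open') auto
      then show "\<forall>\<^sub>F s in at t. norm (f s w - f t w) \<le> C * \<bar>s - t\<bar> powr \<alpha>"
      proof eventually_elim
        case (elim s)
        then show ?case using C[of "(s, w)" "(t, w)"] by (simp add: dist_Pair_Pair dist_real_def)
      qed
    qed
    then show ?thesis unfolding isCont_def by (rule LIM_zero_cancel)
  qed
  then show ?thesis by (simp add: continuous_at_imp_continuous_on)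
qed

lemma fu_cont_t: assumes "w \<ge> 0" shows "continuous_on UNIV (\<lambda>t. fu t w)"
proof -
  have "continuous_on UNIV ((\<lambda>(t, w). fu t w) \<circ> (\<lambda>t. (t, w)))"
    by (intro continuous_on_compose continuous_intros continuous_on_subset[OF fu_cont]) (use assms in auto)
  then show ?thesis by (simp add: o_def)
qed

text \<open>Both values are right derivatives of the same function, so uniqueness of limits applies
  also at the boundary point \<open>w = 0\<close>.\<close>

lemma fu_per: assumes w: "w \<ge> 0" shows "fu (t + T) w = fu t w"
proof -
  have "(f (t + T) has_real_derivative fu t w) (at w within {0..})"
    by (rule has_field_derivative_transform_within[OF f_deriv[OF w, of t], of 1]) (use w f_per in auto)
  then have a: "(f (t + T) has_real_derivative fu t w) (at_right w)"
    by (rule DERIV_subset) (use w in auto)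
  have b: "(f (t + T) has_real_derivative fu (t + T) w) (at_right w)"
    by (rule DERIV_subset[OF f_deriv[OF w, of "t + T"]]) (use w in auto)
  show ?thesis
    using tendsto_unique[OF trivial_limit_at_right_real b[unfolded has_field_derivative_iff] a[unfolded has_field_derivative_iff]] .
qed

text \<open>At \<open>w = 0\<close> continuity and periodicity bound \<open>fu\<close> for all
  times; the Lipschitz bound, uniform in \<open>t\<close>, extends this to
  \<open>{0..M}\<close>.\<close>

lemma fu_bounded:
  assumes M: "M > 0"
  obtains L where "L > 0" "\<And>t w. 0 \<le> w \<Longrightarrow> w \<le> M \<Longrightarrow> \<bar>fu t w\<bar> \<le> L"
proof -
  obtain B where B: "\<And>t. \<bar>fu t 0\<bar> \<le> B"
    using periodic_bounded[OF T_pos, of "\<lambda>t. fu t 0"] fu_per fu_cont_t by auto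
  obtain K where K: "\<forall>t a b. 0 \<le> a \<and> a \<le> M \<and> 0 \<le> b \<and> b \<le> M \<longrightarrow> \<bar>fu t a - fu t b\<bar> \<le> K * \<bar>a - b\<bar>"
    using fu_lip by blast
  show thesis
  proof (rule that)
    show "\<bar>B\<bar> + \<bar>K\<bar> * M + 1 > 0" using M by (simp add: add_nonneg_pos)
    fix t w assume w: "0 \<le> w" "w \<le> M"
    have "\<bar>fu t w - fu t 0\<bar> \<le> K * \<bar>w - 0\<bar>" using K[rule_format, of w 0 t] w M by simp
    also have "\<dots> \<le> \<bar>K\<bar> * M" using w by (intro mult_mono) auto
    finally show "\<bar>fu t w\<bar> \<le> \<bar>B\<bar> + \<bar>K\<bar> * M + 1" using B[of t] by linarith
  qed
qed

lemma f_lipschitz: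
  assumes M: "M > 0"
  obtains L where "L > 0" "\<And>t a b. 0 \<le> a \<Longrightarrow> a \<le> M \<Longrightarrow> 0 \<le> b \<Longrightarrow> b \<le> M \<Longrightarrow> \<bar>f t a - f t b\<bar> \<le> L * \<bar>a - b\<bar>"
proof -
  obtain L where L: "L > 0" "\<And>t w. 0 \<le> w \<Longrightarrow> w \<le> M \<Longrightarrow> \<bar>fu t w\<bar> \<le> L" by (rule fu_bounded[OF M]) (rule that)
  show thesis
  proof (rule that[OF L(1)])
    fix t a b assume ab: "0 \<le> a" "a \<le> M" "0 \<le> b" "b \<le> M"
    have "norm (f t a - f t b) \<le> L * norm (a - b)"
    proof (rule field_differentiable_bound[where S="{0..M}" and f'="fu t"])
      show "(f t has_field_derivative fu t w) (at w within {0..M})" if "w \<in> {0..M}" for w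
        by (rule DERIV_subset[OF f_deriv]) (use that in auto)
    qed (use ab L in auto)
    then show "\<bar>f t a - f t b\<bar> \<le> L * \<bar>a - b\<bar>" by simp
  qed
qed

text \<open>The three pieces have matching one-sided derivatives at 0 and at \<open>M\<close>, and
  these are glued along closed pieces that cover a neighbourhood.\<close>

lemma lin_ext_deriv:
  assumes M: "M > 0"
  shows "(lin_ext M f fu t has_real_derivative fu t (clamp0 M w)) (at w)"
proof -
  define g where "g = lin_ext M f fu t"
  have low: "g w = fu t 0 * w" if "w \<le> 0" for w
    using that M by (simp add: g_def lin_ext_def clamp0_def f_zero)
  have mid: "g w = f t w" if "0 \<le> w" "w \<le> M" for w using that by (simp add: g_def lin_ext_id)
  have high: "g w = f t M + fu t M * (w - M)" if "M \<le> w" for w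
    using that M by (simp add: g_def lin_ext_def clamp0_def)
  have d_low: "(g has_real_derivative fu t 0) (at w within {..0})" if "w \<le> 0" for w
    by (rule has_field_derivative_transform_within[of "\<lambda>w. fu t 0 * w" _ _ _ 1])
       (use that low in \<open>auto intro!: derivative_eq_intros\<close>)
  have d_mid: "(g has_real_derivative fu t w) (at w within {0..M})" if "0 \<le> w" "w \<le> M" for w
    by (rule has_field_derivative_transform_within[OF DERIV_subset[OF f_deriv], of _ _ 1])
       (use that mid in auto)
  have d_high: "(g has_real_derivative fu t M) (at w within {M..})" if "M \<le> w" for w
    by (rule has_field_derivative_transform_within[of "\<lambda>w. f t M + fu t M * (w - M)" _ _ _ 1])
       (use that high in \<open>auto intro!: derivative_eq_intros\<close>)
  have glue: "(g has_real_derivative d) (at w)"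
    if "(g has_real_derivative d) (at w within A)" "(g has_real_derivative d) (at w within B)"
      "w \<in> S" "open S" "S \<subseteq> A \<union> B" for d w A B S
  proof -
    have "(g has_real_derivative d) (at w within A \<union> B)"
      using that(1,2) unfolding has_field_derivative_iff by (rule Lim_Un)
    then have "(g has_real_derivative d) (at w within S)" using that(5) by (rule DERIV_subset)
    then show ?thesis using at_within_open[OF that(3,4)] by simp
  qed
  have "(g has_real_derivative fu t (clamp0 M w)) (at w)"
  proof -
    consider "w < 0" | "w = 0" | "0 < w" "w < M" | "w = M" | "M < w" by linarith
    then show ?thesis
    proof cases
      case 1
      then show ?thesis using glue[OF d_low d_low, of w "{..<0}"] M by (simp add: clamp0_def subset_iff)
    next
      case 2
      have "(g has_real_derivative fu t 0) (at 0)"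
        by (rule glue[OF d_low[of 0] d_mid[of 0], of "{..<M}"]) (use M in auto)
      then show ?thesis using 2 M by (simp add: clamp0_def)
    next
      case 3
      then show ?thesis using glue[OF d_mid d_mid, of w "{0<..<M}"] M by (simp add: clamp0_def subset_iff)
    next
      case 4
      have "(g has_real_derivative fu t M) (at M)"
        by (rule glue[OF d_mid[of M] d_high[of M], of "{0<..}"]) (use M in auto)
      then show ?thesis using 4 M by (simp add: clamp0_def)
    next
      case 5
      then show ?thesis using glue[OF d_high d_high, of w "{M<..}"] M by (simp add: clamp0_def subset_iff)
    qed
  qed
  then show ?thesis by (simp add: g_def)
qed

lemma perturbed_field:
  assumes M: "M > 0" and p: "continuous_on UNIV p" "\<And>t. p (t + T) = p t"
  obtains L L2 where "c11_field (\<lambda>t w. lin_ext M f fu t (p t + w) - lin_ext M f fu t (p t))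
    (\<lambda>t w. fu t (clamp0 M (p t + w))) L L2 T"
proof -
  define g where "g = lin_ext M f fu"
  define gu where "gu t w = fu t (clamp0 M w)" for t w
  obtain L where L: "L > 0" "\<And>t w. 0 \<le> w \<Longrightarrow> w \<le> M \<Longrightarrow> \<bar>fu t w\<bar> \<le> L" by (rule fu_bounded[OF M]) (rule that)
  obtain K where K: "\<forall>t a b. 0 \<le> a \<and> a \<le> M \<and> 0 \<le> b \<and> b \<le> M \<longrightarrow> \<bar>fu t a - fu t b\<bar> \<le> K * \<bar>a - b\<bar>"
    using fu_lip by blast
  note cb = clamp0_bounds[OF M]
  have gu_bound: "\<bar>gu t w\<bar> \<le> L" for t w unfolding gu_def using cb by (intro L)
  have gu_lip: "\<bar>gu t a - gu t b\<bar> \<le> \<bar>K\<bar> * \<bar>a - b\<bar>" for t a b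
  proof -
    have "\<bar>gu t a - gu t b\<bar> \<le> K * \<bar>clamp0 M a - clamp0 M b\<bar>" unfolding gu_def using K cb by blast
    also have "\<dots> \<le> \<bar>K\<bar> * \<bar>a - b\<bar>" using clamp0_lip by (intro mult_mono) auto
    finally show ?thesis .
  qed
  have g_deriv: "(g t has_real_derivative gu t w) (at w)" for t w
    unfolding g_def gu_def by (rule lin_ext_deriv[OF M])
  have g_lip: "\<bar>g t a - g t b\<bar> \<le> L * \<bar>a - b\<bar>" for t a b
    using field_differentiable_bound[of UNIV "g t" "gu t" L a b] g_deriv gu_bound by auto
  have g_cont: "continuous_on UNIV (\<lambda>t. g t w)" for w
    unfolding g_def lin_ext_def by (intro continuous_intros f_cont_t fu_cont_t cb)
  have gu_cont: "continuous_on UNIV (\<lambda>t. gu t w)" for w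
    unfolding gu_def by (intro fu_cont_t cb)
  have g_per: "g (t + T) w = g t w" for t w
    unfolding g_def lin_ext_def using f_per[OF cb(1)] fu_per[OF cb(1)] by simp
  have "c11_field (\<lambda>t w. g t (p t + w) - g t (p t)) (\<lambda>t w. gu t (p t + w)) L \<bar>K\<bar> T"
  proof
    show "continuous_on UNIV (\<lambda>t. g t (p t + w) - g t (p t))" for w
      by (intro continuous_intros continuous_on_nemytskii[where G=g, OF g_cont g_lip] p(1))
    show "continuous_on UNIV (\<lambda>t. gu t (p t + w))" for w
      by (intro continuous_intros continuous_on_nemytskii[where G=gu, OF gu_cont gu_lip] p(1))
    show "((\<lambda>w. g t (p t + w) - g t (p t)) has_real_derivative gu t (p t + w)) (at w)" for t w
    proof -
      have "((\<lambda>w. g t (p t + w)) has_real_derivative gu t (p t + w) * 1) (at w)"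
        by (rule DERIV_chain2[OF g_deriv]) (auto intro!: derivative_eq_intros)
      from DERIV_diff[OF this DERIV_const] show ?thesis by simp
    qed
    show "\<bar>gu t (p t + a) - gu t (p t + b)\<bar> \<le> \<bar>K\<bar> * \<bar>a - b\<bar>" for t a b
      using gu_lip[of t "p t + a" "p t + b"] by simp
  qed (use T_pos L gu_bound g_per p in auto)
  then show thesis unfolding g_def gu_def by (rule that)
qed

text \<open>Both solutions are bounded on the finite interval, so a Lipschitz constant for their
  common range makes the weighted square of the difference nonincreasing. This identifies a solution
  for \<open>f\<close> itself with one obtained from the extended field.\<close>

lemma ode_unique:
  assumes h: "\<And>t. 0 \<le> t \<Longrightarrow> t \<le> \<tau> \<Longrightarrow> 0 \<le> h t \<and> (h has_real_derivative f t (h t)) (at t within {0..})"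
    and k: "\<And>t. 0 \<le> t \<Longrightarrow> t \<le> \<tau> \<Longrightarrow> 0 \<le> k t \<and> (k has_real_derivative f t (k t)) (at t within {0..})"
    and eq: "h 0 = k 0" and \<tau>: "0 \<le> \<tau>"
  shows "h \<tau> = k \<tau>"
proof -
  have hc: "continuous_on {0..\<tau>} h" by (rule DERIV_continuous_on, rule DERIV_subset) (use h in auto)
  have kc: "continuous_on {0..\<tau>} k" by (rule DERIV_continuous_on, rule DERIV_subset) (use k in auto)
  obtain A where A: "\<And>t. 0 \<le> t \<Longrightarrow> t \<le> \<tau> \<Longrightarrow> \<bar>h t\<bar> \<le> A"
    by (rule continuous_interval_bounded[OF hc]) (rule that)
  obtain B where B: "\<And>t. 0 \<le> t \<Longrightarrow> t \<le> \<tau> \<Longrightarrow> \<bar>k t\<bar> \<le> B"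
    by (rule continuous_interval_bounded[OF kc]) (rule that)
  define N where "N = \<bar>A\<bar> + \<bar>B\<bar> + 1"
  have N: "N > 0" by (simp add: N_def)
  obtain L where L: "\<And>t a b. 0 \<le> a \<Longrightarrow> a \<le> N \<Longrightarrow> 0 \<le> b \<Longrightarrow> b \<le> N \<Longrightarrow> \<bar>f t a - f t b\<bar> \<le> L * \<bar>a - b\<bar>"
    by (rule f_lipschitz[OF N]) (rule that, assumption)
  define z where "z t = - ((h t - k t)\<^sup>2 * exp (- 2 * L * t))" for t
  have "z 0 \<le> z \<tau>"
  proof (rule DERIV_nonneg_imp_increasing_open[OF \<tau>])
    show "continuous_on {0..\<tau>} z" unfolding z_def by (intro continuous_intros hc kc)
    fix t assume t: "0 < t" "t < \<tau>"
    have at: "at t within {0..} = at t" using at_within_interior[of t "{0..}"] t by simp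
    define d where "d = h t - k t"
    define e where "e = f t (h t) - f t (k t)"
    have "(z has_real_derivative (2 * L * d\<^sup>2 - 2 * d * e) * exp (- 2 * L * t)) (at t)"
      unfolding z_def d_def e_def using h[of t] k[of t] t unfolding at
      by (auto intro!: derivative_eq_intros simp: algebra_simps power2_eq_square)
    moreover have "d * e \<le> L * d\<^sup>2"
    proof -
      have "h t \<le> N" "k t \<le> N" using A[of t] B[of t] t by (auto simp: N_def)
      then have "\<bar>e\<bar> \<le> L * \<bar>d\<bar>" unfolding e_def d_def using h[of t] k[of t] t by (intro L) auto
      then have "\<bar>d\<bar> * \<bar>e\<bar> \<le> \<bar>d\<bar> * (L * \<bar>d\<bar>)" by (rule mult_left_mono) simp
      moreover have "d * e \<le> \<bar>d\<bar> * \<bar>e\<bar>" by (simp add: abs_mult[symmetric])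
      moreover have "\<bar>d\<bar> * (L * \<bar>d\<bar>) = L * d\<^sup>2" by (simp add: power2_eq_square)
      ultimately show ?thesis by linarith
    qed
    then have "(2 * L * d\<^sup>2 - 2 * d * e) * exp (- 2 * L * t) \<ge> 0" by simp
    ultimately show "\<exists>y. (z has_real_derivative y) (at t) \<and> 0 \<le> y" by blast
  qed
  then have "(h \<tau> - k \<tau>)\<^sup>2 * exp (- 2 * L * \<tau>) \<le> 0" by (simp add: z_def eq)
  moreover have "exp (- 2 * L * \<tau>) > 0" by simp
  ultimately have "(h \<tau> - k \<tau>)\<^sup>2 \<le> 0" by (simp add: mult_le_0_iff)
  then show ?thesis by simp
qed

end

text \<open>If \<open>p\<close> were such a limit, \<open>u - p\<close> would satisfy
  \<open>zero_limit\<close>. Condition (i) becomes \<open>flow T b < b\<close> for small negative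
  \<open>b\<close> and condition (ii) becomes \<open>flow T b <= b\<close> for small
  \<open>\<bar>b\<bar>\<close>; \<open>not_decreasing_below\<close> and
  \<open>not_nonincreasing\<close> exclude them.\<close>

theorem theorem1p5:
  fixes f fu :: "real \<Rightarrow> real \<Rightarrow> real" and T :: real
    and u0 :: "real \<Rightarrow> real" and u :: "real \<Rightarrow> real \<Rightarrow> real" and p :: "real \<Rightarrow> real"
  assumes T_pos: "T > 0"
    and f_hoelder: "locally_hoelder_f f"
    and f_C1: "\<forall>t. \<forall>w\<ge>0. (f t has_real_derivative fu t w) (at w within {0..})"
    and fu_cont: "continuous_on (UNIV \<times> {0..}) (\<lambda>(t,w). fu t w)"
    and f_zero: "\<forall>t. f t 0 = 0"
    and f_per: "\<forall>t. \<forall>w\<ge>0. f (t + T) w = f t w"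
    and fu_lip: "\<forall>M. \<exists>L. \<forall>t w1 w2. 0 \<le> w1 \<and> w1 \<le> M \<and> 0 \<le> w2 \<and> w2 \<le> M \<longrightarrow>
                   \<bar>fu t w1 - fu t w2\<bar> \<le> L * \<bar>w1 - w2\<bar>"
    and u0_meas: "u0 \<in> borel_measurable lborel"
    and u0_bdd: "\<exists>M. \<forall>x. \<bar>u0 x\<bar> \<le> M"
    and u0_nonneg: "\<forall>x. 0 \<le> u0 x"
    and u0_supp: "\<exists>R. \<forall>x. R < \<bar>x\<bar> \<longrightarrow> u0 x = 0"
    and u_sol: "cauchy_sol f u0 u"
    and u_bdd: "\<exists>M. \<forall>x. \<forall>t>0. \<bar>u x t\<bar> \<le> M"
    and p_per: "p \<in> Xper f T"
    and cond: "\<exists>\<epsilon>>0.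
       (\<forall>a\<in>{p 0 - \<epsilon><..<p 0}. \<exists>h. ode_sol f a h \<and> T_mono_decreasing T h) \<or>
       (\<forall>a\<in>{p 0 - \<epsilon><..<p 0 + \<epsilon>}. \<exists>h. ode_sol f a h \<and> T_mono_nonincreasing T h)"
  shows "(\<lambda>x t. p t) \<notin> omega_tilde f T u"
proof
  assume "(\<lambda>x t. p t) \<in> omega_tilde f T u"
  then obtain k :: "nat \<Rightarrow> nat" where k: "filterlim k at_top sequentially"
    and conv: "\<And>K e. compact (K :: (real \<times> real) set) \<Longrightarrow> e > 0 \<Longrightarrow>
       \<forall>\<^sub>F j in sequentially. \<forall>(x, t)\<in>K. \<bar>u x (t + real (k j) * T) - p t\<bar> < e"
    unfolding omega_tilde_def by blast
  interpret kin: kinetics f fu T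
  proof
    show "\<exists>L. \<forall>t a b. 0 \<le> a \<and> a \<le> M \<and> 0 \<le> b \<and> b \<le> M \<longrightarrow> \<bar>fu t a - fu t b\<bar> \<le> L * \<bar>a - b\<bar>" for M
      using fu_lip by blast
  qed (use T_pos f_hoelder f_C1 fu_cont f_zero f_per in auto)
  have p_nonneg: "0 \<le> p t" and p_T: "p (t + T) = p t" and p_deriv: "(p has_real_derivative f t (p t)) (at t)" for t
    using p_per by (auto simp: Xper_def)
  have p_cont: "continuous_on UNIV p" using p_deriv by (rule continuous_on_of_DERIV)
  have p_nat: "p (t + real n * T) = p t" for t n
    using periodic_int[where g=p and n="int n", OF p_T] by simp
  obtain Mp where Mp: "\<And>t. \<bar>p t\<bar> \<le> Mp" by (rule periodic_bounded[of T p, OF T_pos p_T p_cont]) (rule that)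
  obtain Mu where Mu: "\<And>x t. t > 0 \<Longrightarrow> \<bar>u x t\<bar> \<le> Mu" using u_bdd by blast
  \<comment> \<open>The summand 1 leaves room for ODE solutions that start slightly above
    \<open>p\<close>.\<close>
  define M where "M = \<bar>Mp\<bar> + \<bar>Mu\<bar> + 1"
  have M: "M > 0" by (simp add: M_def)
  have p_M: "p t + 1 \<le> M" for t using Mp[of t] by (simp add: M_def)
  have u_M: "u x t \<le> M" if "t > 0" for x t using Mu[OF that, of x] by (simp add: M_def)
  have u_nonneg: "0 \<le> u x t" if "t > 0" for x t using u_sol that by (simp add: cauchy_sol_def)
  have u_classical: "classical_sol_on f {0<..} u" using u_sol by (simp add: cauchy_sol_def)
  define g where "g = lin_ext M f fu"
  have g_f: "g t w = f t w" if "0 \<le> w" "w \<le> M" for t w using that by (simp add: g_def lin_ext_id)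
  define F where "F t w = g t (p t + w) - g t (p t)" for t w
  define Fw where "Fw t w = fu t (clamp0 M (p t + w))" for t w
  obtain L L2 where field: "c11_field F Fw L L2 T"
    using kin.perturbed_field[OF M p_cont p_T] unfolding F_def[abs_def] Fw_def[abs_def] g_def by blast
  interpret c: c11_field F Fw L L2 T by (rule field)
  have gp: "g t (p t) = f t (p t)" for t using p_nonneg[of t] p_M[of t] by (intro g_f) auto
  define \<Lambda> where "\<Lambda> = exp (L * T)"
  have Lam: "\<Lambda> > 0" by (simp add: \<Lambda>_def)
  \<comment> \<open>This trajectory is the zero solution of the original equation, seen relative to
    \<open>p\<close>. It serves twice: for the nonnegativity of \<open>p t + c.flow t b\<close> when
    \<open>b >= - p 0\<close>, and for the lower bound of \<open>p\<close>.\<close>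
  have flow_p: "c.flow t (- p 0) = - p t" if "t \<ge> 0" for t
  proof -
    have "((\<lambda>t. - p t) has_real_derivative F t (- p t)) (at t within {0..})" for t
    proof -
      have "F t (- p t) = - f t (p t)" using M gp[of t] g_f[of 0 t] by (simp add: F_def f_zero)
      then show ?thesis using DERIV_minus[OF p_deriv[of t]] by (simp add: has_field_derivative_at_within)
    qed
    from c.flow_unique[OF this that] show ?thesis by simp
  qed
  \<comment> \<open>As long as \<open>p t\<close> plus the trajectory does not exceed
    \<open>M\<close>, it solves the original equation and so must coincide with the given
    \<open>h\<close>.\<close>
  have period_map: "h T - p 0 = c.flow T (a - p 0)"
    if h: "ode_sol f a h" and a: "\<And>t. 0 \<le> t \<Longrightarrow> t \<le> T \<Longrightarrow> p t + c.flow t (a - p 0) \<le> M" for a h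
  proof -
    have h0: "h 0 = a" and h_pos: "0 \<le> h t" and h_deriv: "(h has_real_derivative f t (h t)) (at t within {0..})" if "t \<ge> 0" for t
      using h that by (auto simp: ode_sol_def)
    have "0 \<le> a" using h0[of 0] h_pos[of 0] by simp
    have "h T = p T + c.flow T (a - p 0)"
    proof (rule kin.ode_unique[of T h "\<lambda>t. p t + c.flow t (a - p 0)"])
      fix t assume t: "0 \<le> t" "t \<le> T"
      show "0 \<le> h t \<and> (h has_real_derivative f t (h t)) (at t within {0..})" using h_pos h_deriv t by blast
      have "c.flow t (- p 0) \<le> c.flow t (a - p 0)" using \<open>0 \<le> a\<close> t by (intro c.flow_mono) auto
      then have nn: "0 \<le> p t + c.flow t (a - p 0)" using flow_p t by simp
      have "((\<lambda>t. p t + c.flow t (a - p 0)) has_real_derivative f t (p t) + F t (c.flow t (a - p 0))) (at t within {0..})"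
        by (intro DERIV_add has_field_derivative_at_within[OF p_deriv] c.flow_deriv_within t)
      moreover have "f t (p t) + F t (c.flow t (a - p 0)) = f t (p t + c.flow t (a - p 0))"
        using g_f[OF nn a[OF t], of t] gp[of t] by (simp add: F_def)
      ultimately show "0 \<le> p t + c.flow t (a - p 0) \<and> ((\<lambda>t. p t + c.flow t (a - p 0)) has_real_derivative f t (p t + c.flow t (a - p 0))) (at t within {0..})"
        using nn by simp
    qed (use h0[of 0] T_pos in auto)
    then show ?thesis using p_T[of 0] by simp
  qed
  have below: "p t + c.flow t a \<le> M" if "a \<le> 0" "0 \<le> t" for t a
    using c.flow_mono[of a 0 t] that p_M[of t] by simp
  \<comment> \<open>A deviation of at most \<open>1 / \<Lambda>\<close> grows to at most 1 during a
    period, which is the room left in \<open>M\<close>.\<close>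
  have above: "p t + c.flow t a \<le> M" if "0 \<le> a" "a \<le> 1 / \<Lambda>" "0 \<le> t" "t \<le> T" for t a
  proof -
    have "c.flow t a \<le> \<Lambda> * a" using c.flow_abs_bounds(2)[of t a] that by (simp add: \<Lambda>_def)
    also have "\<dots> \<le> 1" using that Lam by (simp add: field_simps)
    finally show ?thesis using p_M[of t] by simp
  qed
  obtain \<epsilon> where eps: "\<epsilon> > 0" and cond': "(\<forall>a\<in>{p 0 - \<epsilon><..<p 0}. \<exists>h. ode_sol f a h \<and> T_mono_decreasing T h) \<or>
       (\<forall>a\<in>{p 0 - \<epsilon><..<p 0 + \<epsilon>}. \<exists>h. ode_sol f a h \<and> T_mono_nonincreasing T h)"
    using cond by blast
  \<comment> \<open>Either condition supplies a solution starting at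
    \<open>p 0 - \<epsilon> / 2\<close>, and solutions in the sense of \<open>ode_sol\<close> are
    nonnegative.\<close>
  have p0: "p 0 > 0"
  proof -
    define a where "a = p 0 - \<epsilon> / 2"
    have "a \<in> {p 0 - \<epsilon><..<p 0}" "a \<in> {p 0 - \<epsilon><..<p 0 + \<epsilon>}" using eps by (auto simp: a_def)
    then obtain h where "ode_sol f a h" using cond' by blast
    then have "0 \<le> a" by (auto simp: ode_sol_def)
    then show ?thesis using eps by (simp add: a_def)
  qed
  define pm where "pm = p 0 / \<Lambda>"
  have pm: "pm > 0" using p0 Lam by (simp add: pm_def)
  \<comment> \<open>The zero solution starts at distance \<open>p 0\<close> from \<open>p\<close>
    and can approach it by at most the factor \<open>\<Lambda>\<close> within a period; periodicity
    covers later times.\<close>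
  have p_ge: "pm \<le> p t" if t: "t \<ge> 0" for t
  proof -
    obtain n where n: "real n * T \<le> t" "t < real n * T + T" using period_decomposition[OF T_pos t] by blast
    define s where "s = t - real n * T"
    have s: "0 \<le> s" "s \<le> T" using n by (simp_all add: s_def)
    have "c.flow s (- p 0) \<le> - p 0 / \<Lambda>" using c.flow_abs_bounds(3)[OF s, of "- p 0"] p0 by (simp add: \<Lambda>_def)
    then have "pm \<le> p s" using flow_p[OF s(1)] by (simp add: pm_def)
    also have "p s = p t" using p_nat[of s n] by (simp add: s_def)
    finally show ?thesis .
  qed
  obtain B where B: "\<And>x. \<bar>u0 x\<bar> \<le> B" using u0_bdd by blast
  obtain R0 where R0: "\<And>x. R0 < \<bar>x\<bar> \<Longrightarrow> u0 x = 0" using u0_supp by blast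
  define R where "R = max R0 0"
  obtain Lf where Lf: "Lf > 0" "\<And>t a b. 0 \<le> a \<Longrightarrow> a \<le> M \<Longrightarrow> 0 \<le> b \<Longrightarrow> b \<le> M \<Longrightarrow> \<bar>f t a - f t b\<bar> \<le> Lf * \<bar>a - b\<bar>"
    by (rule kin.f_lipschitz[OF M]) (rule that)
  interpret cc: compact_cauchy f u0 u R M Lf B
  proof
    show "((\<lambda>t. integral {a..b} (\<lambda>x. \<bar>u x t - u0 x\<bar>)) \<longlongrightarrow> 0) (at_right 0)" for a b
      using u_sol by (simp add: cauchy_sol_def)
    show "u0 x \<le> B" for x using B[of x] by simp
  qed (use u_classical u_nonneg u_M f_zero Lf u0_meas u0_nonneg R0 in \<open>auto simp: R_def\<close>)
  define w where "w x t = u x t - p t" for x t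
  have w_sol: "classical_sol_on F {0<..} w"
  proof -
    obtain ut ux uxx where uc: "continuous_on (UNIV \<times> {0<..}) (\<lambda>(x, t). u x t)"
      "continuous_on (UNIV \<times> {0<..}) (\<lambda>(x, t). ut x t)" "continuous_on (UNIV \<times> {0<..}) (\<lambda>(x, t). ux x t)"
      "continuous_on (UNIV \<times> {0<..}) (\<lambda>(x, t). uxx x t)"
      and *: "\<forall>x. \<forall>t\<in>{0<..}. ((\<lambda>s. u x s) has_real_derivative ut x t) (at t) \<and>
             ((\<lambda>y. u y t) has_real_derivative ux x t) (at x) \<and>
             ((\<lambda>y. ux y t) has_real_derivative uxx x t) (at x) \<and>
             ut x t = uxx x t + f t (u x t)"
      using u_classical unfolding classical_sol_on_def by blast
    have F0: "continuous_on UNIV (\<lambda>t. F t (- p t))"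
      by (intro c.continuous_on_F continuous_intros p_cont)
    have Fp: "F t (- p t) = - f t (p t)" for t using M gp[of t] g_f[of 0 t] by (simp add: F_def f_zero)
    have fp_cont: "continuous_on UNIV (\<lambda>t. f t (p t))"
      using continuous_on_minus[OF F0] by (simp add: Fp)
    have pc: "continuous_on (UNIV \<times> {0<..}) (\<lambda>z :: real \<times> real. q (snd z))" if "continuous_on UNIV q" for q :: "real \<Rightarrow> real"
      by (rule continuous_on_compose2[OF that]) (auto intro!: continuous_intros)
    show ?thesis
      unfolding classical_sol_on_def
    proof (rule exI[of _ "\<lambda>x t. ut x t - f t (p t)"], rule exI[of _ ux], rule exI[of _ uxx], intro conjI allI ballI)
      show "continuous_on (UNIV \<times> {0<..}) (\<lambda>(x, t). w x t)"
        using continuous_on_diff[OF uc(1) pc[OF p_cont]] by (simp add: w_def case_prod_unfold)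
      show "continuous_on (UNIV \<times> {0<..}) (\<lambda>(x, t). ut x t - f t (p t))"
        using continuous_on_diff[OF uc(2) pc[OF fp_cont]] by (simp add: case_prod_unfold)
      fix x t :: real assume t: "t \<in> {0<..}"
      then have u: "((\<lambda>s. u x s) has_real_derivative ut x t) (at t)" "((\<lambda>y. u y t) has_real_derivative ux x t) (at x)"
        "((\<lambda>y. ux y t) has_real_derivative uxx x t) (at x)" "ut x t = uxx x t + f t (u x t)"
        using * by blast+
      show "((\<lambda>s. w x s) has_real_derivative ut x t - f t (p t)) (at t)"
        unfolding w_def by (rule DERIV_diff[OF u(1) p_deriv])
      show "((\<lambda>y. w y t) has_real_derivative ux x t) (at x)"
        unfolding w_def using DERIV_diff[OF u(2) DERIV_const] by simp
      show "((\<lambda>y. ux y t) has_real_derivative uxx x t) (at x)" by (rule u(3))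
      have "F t (w x t) = f t (u x t) - f t (p t)"
        using g_f[of "u x t" t] u_nonneg[of t x] u_M[of t x] gp[of t] t by (simp add: F_def w_def)
      then show "ut x t - f t (p t) = uxx x t + F t (w x t)" using u(4) by simp
    qed (use uc in auto)
  qed
  \<comment> \<open>Far out \<open>u <= pm / 2\<close>, while \<open>p >= pm\<close>; the difference
    is the depth \<open>pm / 2\<close>.\<close>
  interpret z: zero_limit F Fw L L2 T w M R "pm / 2" k
  proof
    show "classical_sol_on F {0<..} w" by (rule w_sol)
    show "\<bar>w x t\<bar> \<le> M" if "t > 0" for x t
      using u_nonneg[OF that, of x] u_M[OF that, of x] p_nonneg[of t] p_M[of t] by (simp add: w_def abs_le_iff)
    show "w y t \<le> w x t" if "R < x" "x \<le> y" "t > 0" for x y t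
      using cc.u_antimono[OF that] by (simp add: w_def)
    show "w x t \<le> w r t \<or> w x t \<le> w (- r) t" if "R < r" "t > 0" "r \<le> \<bar>x\<bar>" for r x t
      using cc.u_le_off_centre[OF that] by (simp add: w_def)
    show "pm / 2 > 0" using pm by simp
    show "\<exists>X. \<forall>x t. X \<le> \<bar>x\<bar> \<and> 0 < t \<and> t \<le> \<tau> \<longrightarrow> w x t \<le> - (pm / 2)" for \<tau>
    proof -
      obtain X where X: "\<And>x t. X \<le> \<bar>x\<bar> \<Longrightarrow> 0 < t \<Longrightarrow> t \<le> \<tau> \<Longrightarrow> u x t \<le> pm / 2"
        using cc.u_decay_abs[OF half_gt_zero[OF pm], of \<tau>] by metis
      have "w x t \<le> - (pm / 2)" if "X \<le> \<bar>x\<bar> \<and> 0 < t \<and> t \<le> \<tau>" for x t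
        using X[of x t] p_ge[of t] that by (simp add: w_def)
      then show ?thesis by blast
    qed
    show "filterlim k at_top sequentially" by (rule k)
    show "\<forall>\<^sub>F j in sequentially. \<forall>x t. \<bar>x\<bar> \<le> A \<and> \<bar>t\<bar> \<le> A \<longrightarrow> \<bar>w x (t + real (k j) * T)\<bar> < e" if "e > 0" for e A
    proof -
      have "compact ({- A..A} \<times> {- A..A})" by (intro compact_Times) auto
      from conv[OF this that] show ?thesis
      proof eventually_elim
        case (elim j)
        show ?case
        proof (intro allI impI)
          fix x t assume "\<bar>x\<bar> \<le> A \<and> \<bar>t\<bar> \<le> A"
          then have "(x, t) \<in> {- A..A} \<times> {- A..A}" by (simp add: abs_le_iff minus_le_iff)
          with elim have "\<bar>u x (t + real (k j) * T) - p t\<bar> < e" by blast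
          then show "\<bar>w x (t + real (k j) * T)\<bar> < e" by (simp add: w_def p_nat)
        qed
      qed
    qed
  qed
  from cond' show False
  proof
    assume dec: "\<forall>a\<in>{p 0 - \<epsilon><..<p 0}. \<exists>h. ode_sol f a h \<and> T_mono_decreasing T h"
    show False
    proof (rule z.not_decreasing_below[OF eps])
      fix b assume b: "- \<epsilon> < b" "b < 0"
      then have "p 0 + b \<in> {p 0 - \<epsilon><..<p 0}" by simp
      then obtain h where h: "ode_sol f (p 0 + b) h" "T_mono_decreasing T h" using dec by blast
      have "h T - p 0 = c.flow T (p 0 + b - p 0)" by (rule period_map[OF h(1)]) (use below b in auto)
      moreover have "h (0 + T) < h 0" using h(2) unfolding T_mono_decreasing_def by blast
      moreover have "h 0 = p 0 + b" using h(1) by (simp add: ode_sol_def)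
      ultimately show "c.flow T b < b" by simp
    qed
  next
    assume noninc: "\<forall>a\<in>{p 0 - \<epsilon><..<p 0 + \<epsilon>}. \<exists>h. ode_sol f a h \<and> T_mono_nonincreasing T h"
    show False
    proof (rule z.not_nonincreasing[of "min \<epsilon> (1 / \<Lambda>)"])
      show "min \<epsilon> (1 / \<Lambda>) > 0" using eps Lam by simp
      fix b assume b: "\<bar>b\<bar> < min \<epsilon> (1 / \<Lambda>)"
      then have "p 0 + b \<in> {p 0 - \<epsilon><..<p 0 + \<epsilon>}" by (auto simp: abs_less_iff)
      then obtain h where h: "ode_sol f (p 0 + b) h" "T_mono_nonincreasing T h" using noninc by blast
      have "p t + c.flow t b \<le> M" if "0 \<le> t" "t \<le> T" for t
        using below[of b t] above[of b t] b that by (cases "b \<le> 0") auto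
      then have "h T - p 0 = c.flow T (p 0 + b - p 0)" by (intro period_map[OF h(1)]) auto
      moreover have "h (0 + T) \<le> h 0"
        using h(2) unfolding T_mono_nonincreasing_def T_mono_decreasing_def T_periodic_on_def
        by (metis order_refl less_imp_le)
      moreover have "h 0 = p 0 + b" using h(1) by (simp add: ode_sol_def)
      ultimately show "c.flow T b \<le> b" by simp
    qed
  qed
qed

end
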